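(* Let $\beta\in\mathbb{Z}_+$. Given $n\in\mathbb{Z}_+$, there is a constant $C>0$, independent of $k$ and $d$, such that for all $k\ge k_0$ and $\mathbf{d}=(d,\ldots,d)\in\mathbb{N}^6$ with $d\ge n-1$, $$\|\eta-\hat\eta_\beta\|_{L^2(\partial K)}\le C\,\frac{C_k}{c_k}\,k^{-\frac{\beta}{3}}\,\frac{(\log k)^{n+\frac12}}{d^n}$$ for the $\beta$-asymptotic Galerkin approximation $\hat\eta_\beta\in\sigma_\beta+\mathcal{C}_{\mathbf d}$ to $\eta$ based on frequency dependent changes of variables.
   Context: Notation: $\mathbb{Z}_+=\{0,1,2,\ldots\}$, $\mathbb{N}=\{1,2,\ldots\}$, $-\mathbb{N}=\{-1,-2,\ldots\}$, $t_-=\min\{t,0\}$; an empty sum is zero. Scattering problem. $K\subset\mathbb{R}^2$ is a compact, strictly convex obstacle with smooth boundary of length $2P$ and exterior unit normal $\nu$; $u^{\rm inc}(x)=e^{ik\alpha\cdot x}$ with $|\alpha|=1$, $k>0$; $u$ is the solution of $(\Delta+k^2)u=0$ in $\mathbb{R}^2\setminus K$, $\partial_\nu u=-\partial_\nu u^{\rm inc}$ on $\partial K$, $\lim_{r=|x|\to\infty}\sqrt r(\partial_r u-iku)=0$. The total field on $\partial K$ is $\eta=u+u^{\rm inc}$. $\gamma$ is the $2P$-periodic counterclockwise arc length parametrization of $\partial K$ for which $\alpha\cdot\nu(\gamma(s))$ vanishes on $[0,2P]$ exactly at $s=t_1,t_2$, with $0<t_1<t_2<2P$, $t_1+t_2=2P$,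 is negative on $(t_1,t_2)$ (illuminated region) and positive on $[0,t_1)\cup(t_2,2P]$ (shadow region). Functions on $\partial K$ are identified via $\gamma$ with $2P$-periodic functions of $s$; $\eta^{\rm slow}(s,k)=e^{-ik\alpha\cdot\gamma(s)}\eta(s,k)$. Hörmander class: a $C^\infty$ function $a(s,k)$ on $[0,2P]\times(0,\infty)$ belongs to $S^{\mu}_{\varrho,\delta}$ if for all $n,m\in\mathbb{Z}_+$ and every $\kappa>0$ there is $C$ with $|D_s^nD_k^m a(s,k)|\le C k^{\mu+\delta n-\varrho m}$ for $s\in[0,2P]$, $k\ge\kappa$. Asymptotic expansion (a known fact). $\eta^{\rm slow}\in S^0_{\frac23,\frac13}$ and $\eta^{\rm slow}\sim\sum_{p,q,r\in\mathbb{Z}_+,\,\ell\in-\mathbb{N}}a_{p,q,r,\ell}$ with $$a_{p,q,r,\ell}(s,k)=k^{-\frac{1+2p+3q+r+\ell}{3}+(\ell+1)_-}\,b_{p,q,r,\ell}(s)\,(\Psi^{r,\ell})^{(p)}(k^{\frac13}Z(s)),$$ where $b_{p,q,r,\ell}$ are $2P$-periodic complex-valued $C^\infty$ functions; $Z$ is a $2P$-periodic real-valued $C^\infty$ function, positive on the illuminated region, negative on the shadow region, vanishing precisely to first order at $t_1,t_2$; $\Psi^{r,\ell}$ are complex-valued $C^\infty$ functions on $\mathbb{R}$ with $\Psi^{r,\ell}(\tau)\sim\sum_{j\in\mathbb{Z}_+}a_{r,\ell,j}\tau^{1+\ell-2r-3j}$ as $\tau\to+\infty$ (in the sense of symbols)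 and rapidly decreasing with all derivatives as $\tau\to-\infty$. The relation $\sim$ means: for every $M>0$ there is a finite index set $F_M$ such that $\eta^{\rm slow}-\sum_{F}a_{p,q,r,\ell}\in S^{-M}_{\frac23,\frac13}$ for every finite $F\supseteq F_M$. Definition of $\sigma_\beta$. $$\vartheta(p,q,r,\ell)=-\frac{1+2p+3q+r+\ell}{3}+(\ell+1)_-+\begin{cases}0, & 1+\ell-2r-p<0,\\ \frac{1+\ell-2r-p}{3}, & 1+\ell-2r-p\ge 0,\end{cases}$$ $\mathcal{F}_\beta=\{(p,q,r,\ell)\in\mathbb{Z}_+^3\times(-\mathbb{N}):\vartheta(p,q,r,\ell)>-\beta/3\}$, $\sigma_\beta^{\rm slow}=\sum_{\mathcal{F}_\beta}a_{p,q,r,\ell}$, $\sigma_\beta=e^{ik\alpha\cdot\gamma}\sigma_\beta^{\rm slow}$, $\rho_\beta=\eta-\sigma_\beta$. Integral equation. For some $k_0>1$ and all $k\ge k_0$, $\eta$ solves an integral equation $\mathcal{R}_k\eta=f$ on $L^2(\partial K)$ where the linear operator $\mathcal{R}_k$ is continuous and coercive with constants $C_k,c_k>0$: $|\langle\mu,\mathcal{R}_k\phi\rangle|\le C_k\|\mu\|\|\phi\|$ and $|\langle\mu,\mathcal{R}_k\mu\rangle|\ge c_k\|\mu\|^2$ for all $\mu,\phi\in L^2(\partial K)$. Put $f_\beta=f-\mathcal{R}_k\sigma_\beta$, so that $\mathcal{R}_k\rho_\beta=f_\beta$. Regions. Fix positive constants $\xi_j,\xi_j',\zeta_j,\zeta_j'$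 ($j=1,2$) with $t_1+\xi_1\le t_1+\xi_1'=t_2-\xi_2'\le t_2-\xi_2$ and $t_2+\zeta_2\le t_2+\zeta_2'=2P+t_1-\zeta_1'\le 2P+t_1-\zeta_1$. Intervals $\mathcal{I}_j=[a_j,b_j]$ (in the parameter domain, modulo $2P$): $\mathcal{I}_1=[t_1+\xi_1k^{-\frac13},t_1+\xi_1']$, $\mathcal{I}_2=[t_2-\xi_2',t_2-\xi_2k^{-\frac13}]$, $\mathcal{I}_3=[t_1-\zeta_1',t_1-\zeta_1k^{-\frac13}]$, $\mathcal{I}_4=[t_2+\zeta_2k^{-\frac13},t_2+\zeta_2']$, $\mathcal{I}_5=[t_1-\zeta_1k^{-\frac13},t_1+\xi_1k^{-\frac13}]$, $\mathcal{I}_6=[t_2-\xi_2k^{-\frac13},t_2+\zeta_2k^{-\frac13}]$. Changes of variables $\phi_j:\mathcal{I}_j\to\mathcal{I}_j$ (bijections): $\phi_1=t_1+\varphi_1k^{\psi_1}$, $\phi_2=t_2-\varphi_2k^{\psi_2}$, $\phi_3=t_1-\varphi_3k^{\psi_3}$, $\phi_4=t_2+\varphi_4k^{\psi_4}$, $\phi_5(s)=s$, $\phi_6(s)=s$, where $\psi_1(s)=-\frac13\frac{b_1-s}{b_1-a_1}$, $\varphi_1(s)=\xi_1+(\xi_1'-\xi_1)\frac{s-a_1}{b_1-a_1}$; $\psi_2(s)=-\frac13\frac{s-a_2}{b_2-a_2}$, $\varphi_2(s)=\xi_2'+(\xi_2-\xi_2')\frac{s-a_2}{b_2-a_2}$;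 $\psi_3(s)=-\frac13\frac{s-a_3}{b_3-a_3}$, $\varphi_3(s)=\zeta_1'+(\zeta_1-\zeta_1')\frac{s-a_3}{b_3-a_3}$; $\psi_4(s)=-\frac13\frac{b_4-s}{b_4-a_4}$, $\varphi_4(s)=\zeta_2+(\zeta_2'-\zeta_2)\frac{s-a_4}{b_4-a_4}$. Galerkin method. $\mathbb{P}_d$ is the space of polynomials of degree at most $d$, $\mathbf{1}_{\mathcal I}$ the characteristic function of $\mathcal I$, and for $\mathbf d=(d_1,\ldots,d_6)$, $\mathcal{C}_{\mathbf d}=e^{ik\alpha\cdot\gamma}\bigoplus_{j=1}^{6}\mathbf{1}_{\mathcal{I}_j}\,(\mathbb{P}_{d_j}\circ\phi_j^{-1})\subset L^2(\partial K)$. The $\beta$-asymptotic Galerkin approximation based on frequency dependent changes of variables is $\hat\eta_\beta=\sigma_\beta+\hat\rho_\beta$, where $\hat\rho_\beta\in\mathcal{C}_{\mathbf d}$ is the unique solution of $\langle\hat\mu,\mathcal{R}_k\hat\rho_\beta\rangle=\langle\hat\mu,f_\beta\rangle$ for all $\hat\mu\in\mathcal{C}_{\mathbf d}$. *)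

theory Defs
  imports
    "HOL-Analysis.Analysis"
    "HOL-Computational_Algebra.Polynomial"
begin

definition vderiv :: "(real \<Rightarrow> 'a::real_normed_vector) \<Rightarrow> real \<Rightarrow> 'a" where
  "vderiv f = (\<lambda>t. vector_derivative f (at t))"

definition smooth :: "(real \<Rightarrow> 'a::real_normed_vector) \<Rightarrow> bool" where
  "smooth f \<longleftrightarrow> (\<forall>n t. (vderiv ^^ n) f differentiable (at t))"

definition dderiv :: "('a::real_normed_vector \<Rightarrow> 'b::real_normed_vector) \<Rightarrow> 'a \<Rightarrow> 'a \<Rightarrow> 'b" where
  "dderiv f v x = frechet_derivative f (at x) v"

definition Ds :: "(real \<Rightarrow> real \<Rightarrow> complex) \<Rightarrow> real \<Rightarrow> real \<Rightarrow> complex" where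
  "Ds a = (\<lambda>s k. vderiv (\<lambda>s'. a s' k) s)"

definition Dk :: "(real \<Rightarrow> real \<Rightarrow> complex) \<Rightarrow> real \<Rightarrow> real \<Rightarrow> complex" where
  "Dk a = (\<lambda>s k. vderiv (a s) k)"

inductive_set partials :: "(real \<Rightarrow> real \<Rightarrow> complex) \<Rightarrow> (real \<Rightarrow> real \<Rightarrow> complex) set"
  for a where
  "a \<in> partials a"
| "g \<in> partials a \<Longrightarrow> Ds g \<in> partials a"
| "g \<in> partials a \<Longrightarrow> Dk g \<in> partials a"

text \<open>Joint smoothness on \<open>\<real> \<times> (0,\<infinity>)\<close>: the mixed partial derivatives of all orders exist and are
  jointly continuous.\<close>

definition smooth2 :: "(real \<Rightarrow> real \<Rightarrow> complex) \<Rightarrow> bool" where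
  "smooth2 a \<longleftrightarrow> (\<forall>g \<in> partials a.
     continuous_on (UNIV \<times> {0<..}) (\<lambda>(s, k). g s k) \<and>
     (\<forall>s. \<forall>k>0. (\<lambda>s'. g s' k) differentiable (at s) \<and> g s differentiable (at k)))"

definition periodic :: "real \<Rightarrow> (real \<Rightarrow> 'a) \<Rightarrow> bool" where
  "periodic T f \<longleftrightarrow> (\<forall>s. f (s + T) = f s)"

text \<open>Hoermander class over the closed curve of length \<open>2P\<close>.  Functions on the curve are
  \<open>2P\<close>-periodic functions of arc length, so smoothness on the curve is smoothness of the periodic
  function on the whole line (in particular across the points \<open>0\<close> and \<open>2P\<close>).\<close>

definition hoermander :: "real \<Rightarrow> real \<Rightarrow> real \<Rightarrow> real \<Rightarrow> (real \<Rightarrow> real \<Rightarrow> complex) set" where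
  "hoermander P \<mu> \<rho> \<delta> = {a.
     (\<forall>k>0. periodic (2 * P) (\<lambda>s. a s k)) \<and> smooth2 a \<and>
     (\<forall>n m. \<forall>\<kappa>>0. \<exists>C. \<forall>s\<in>{0..2 * P}. \<forall>k\<ge>\<kappa>.
        cmod ((Ds ^^ n) ((Dk ^^ m) a) s k) \<le> C * k powr (\<mu> + \<delta> * real n - \<rho> * real m))}"

definition strictly_convex :: "'a::euclidean_space set \<Rightarrow> bool" where
  "strictly_convex K \<longleftrightarrow> (\<forall>x\<in>K. \<forall>y\<in>K. x \<noteq> y \<longrightarrow> open_segment x y \<subseteq> interior K)"

definition normal :: "(real \<Rightarrow> real^2) \<Rightarrow> real \<Rightarrow> real^2" where
  "normal \<gamma> s = vector [vderiv \<gamma> s $ 2, - (vderiv \<gamma> s $ 1)]"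

text \<open>The last condition says that the clockwise normal of \<open>\<gamma>\<close> points out of \<open>K\<close>, i.e. that \<open>\<gamma>\<close> runs
  counterclockwise and that \<open>normal \<gamma>\<close> is the exterior unit normal.\<close>

definition ccw_arclength_param :: "(real^2) set \<Rightarrow> real \<Rightarrow> (real \<Rightarrow> real^2) \<Rightarrow> bool" where
  "ccw_arclength_param K P \<gamma> \<longleftrightarrow>
     smooth \<gamma> \<and> periodic (2 * P) \<gamma> \<and> inj_on \<gamma> {0..<2 * P} \<and> \<gamma> ` {0..<2 * P} = frontier K \<and>
     (\<forall>s. norm (vderiv \<gamma> s) = 1) \<and>
     (\<forall>s. \<forall>\<^sub>F h in at_right 0. \<gamma> s + h *\<^sub>R normal \<gamma> s \<notin> K)"

definition shadow_boundary :: "real \<Rightarrow> (real \<Rightarrow> real^2) \<Rightarrow> real^2 \<Rightarrow> (nat \<Rightarrow> real) \<Rightarrow> bool" where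
  "shadow_boundary P \<gamma> \<alpha> t \<longleftrightarrow>
     0 < t 1 \<and> t 1 < t 2 \<and> t 2 < 2 * P \<and> t 1 + t 2 = 2 * P \<and>
     (\<forall>s\<in>{0..2 * P}. \<alpha> \<bullet> normal \<gamma> s = 0 \<longleftrightarrow> s = t 1 \<or> s = t 2) \<and>
     (\<forall>s\<in>{t 1<..<t 2}. \<alpha> \<bullet> normal \<gamma> s < 0) \<and>
     (\<forall>s\<in>{0..<t 1} \<union> {t 2<..2 * P}. \<alpha> \<bullet> normal \<gamma> s > 0)"

definition plane_wave :: "real^2 \<Rightarrow> real \<Rightarrow> real^2 \<Rightarrow> complex" where
  "plane_wave \<alpha> k x = exp (\<i> * of_real (k * (\<alpha> \<bullet> x)))"

text \<open>Classical solution of the exterior Neumann problem: \<open>C\<^sup>2\<close> outside \<open>K\<close>, \<open>C\<^sup>1\<close> up to the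
  boundary.  The normal derivative on the boundary is taken from outside, and the radiation
  condition holds uniformly in all directions.\<close>

definition scattering_solution ::
    "(real^2) set \<Rightarrow> (real \<Rightarrow> real^2) \<Rightarrow> real^2 \<Rightarrow> real \<Rightarrow> (real^2 \<Rightarrow> complex) \<Rightarrow> bool" where
  "scattering_solution K \<gamma> \<alpha> k u \<longleftrightarrow>
     (\<forall>x\<in>- K. u differentiable (at x)) \<and>
     (\<forall>v\<in>Basis. \<forall>x\<in>- K. dderiv u v differentiable (at x)) \<and>
     (\<forall>v\<in>Basis. \<forall>w\<in>Basis. continuous_on (- K) (dderiv (dderiv u v) w)) \<and>
     continuous_on (- interior K) u \<and>
     (\<forall>v\<in>Basis. \<exists>g. continuous_on (- interior K) g \<and> (\<forall>x\<in>- K. g x = dderiv u v x)) \<and>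
     (\<forall>x\<in>- K. (\<Sum>v\<in>Basis. dderiv (dderiv u v) v x) + of_real (k\<^sup>2) * u x = 0) \<and>
     (\<forall>s. ((\<lambda>h. (u (\<gamma> s + h *\<^sub>R normal \<gamma> s) - u (\<gamma> s)) / of_real h) \<longlongrightarrow>
             - dderiv (plane_wave \<alpha> k) (normal \<gamma> s) (\<gamma> s)) (at_right 0)) \<and>
     ((\<lambda>x. of_real (sqrt (norm x)) * (dderiv u (x /\<^sub>R norm x) x - \<i> * of_real k * u x))
        \<longlongrightarrow> 0) at_infinity"

definition eta :: "(real \<Rightarrow> real^2 \<Rightarrow> complex) \<Rightarrow> (real \<Rightarrow> real^2) \<Rightarrow> real^2 \<Rightarrow> real \<Rightarrow> real \<Rightarrow> complex" where
  "eta u \<gamma> \<alpha> s k = u k (\<gamma> s) + plane_wave \<alpha> k (\<gamma> s)"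

definition eta_slow :: "(real \<Rightarrow> real^2 \<Rightarrow> complex) \<Rightarrow> (real \<Rightarrow> real^2) \<Rightarrow> real^2 \<Rightarrow> real \<Rightarrow> real \<Rightarrow> complex" where
  "eta_slow u \<gamma> \<alpha> s k = exp (- (\<i> * of_real (k * (\<alpha> \<bullet> \<gamma> s)))) * eta u \<gamma> \<alpha> s k"

type_synonym index = "nat \<times> nat \<times> nat \<times> int"

definition indices :: "index set" where
  "indices = {(p, q, r, l). l \<le> - 1}"

definition base_exponent :: "index \<Rightarrow> real" where
  "base_exponent = (\<lambda>(p, q, r, l).
     - (1 + 2 * real p + 3 * real q + real r + real_of_int l) / 3 + real_of_int (min (l + 1) 0))"

definition expansion_term ::
    "(index \<Rightarrow> real \<Rightarrow> complex) \<Rightarrow> (real \<Rightarrow> real) \<Rightarrow> (nat \<Rightarrow> int \<Rightarrow> real \<Rightarrow> complex)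
      \<Rightarrow> index \<Rightarrow> real \<Rightarrow> real \<Rightarrow> complex" where
  "expansion_term b Z \<Psi> = (\<lambda>(p, q, r, l) s k.
     of_real (k powr base_exponent (p, q, r, l)) * b (p, q, r, l) s *
     (vderiv ^^ p) (\<Psi> r l) (k powr (1/3) * Z s))"

definition theta :: "index \<Rightarrow> real" where
  "theta = (\<lambda>(p, q, r, l). base_exponent (p, q, r, l) +
     (let e = 1 + l - 2 * int r - int p in if e < 0 then 0 else real_of_int e / 3))"

definition indices_beta :: "nat \<Rightarrow> index set" where
  "indices_beta \<beta> = {i \<in> indices. theta i > - real \<beta> / 3}"

text \<open>Asymptotic expansion \<open>\<Psi>(\<tau>) \<sim> \<Sum>j. c j \<tau>^(e - 3j)\<close> as \<open>\<tau> \<rightarrow> +\<infinity>\<close> in the sense of symbols, i.e.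
  with the natural estimates for all derivatives of the remainders.\<close>

definition symbol_expansion :: "(real \<Rightarrow> complex) \<Rightarrow> int \<Rightarrow> (nat \<Rightarrow> complex) \<Rightarrow> bool" where
  "symbol_expansion \<psi> e c \<longleftrightarrow> (\<forall>N n. \<exists>C. \<forall>\<tau>\<ge>1.
     cmod ((vderiv ^^ n) (\<lambda>x. \<psi> x - (\<Sum>j<N. c j * of_real (x powi (e - 3 * int j)))) \<tau>)
       \<le> C * \<tau> powi (e - 3 * int N - int n))"

definition rapidly_decreasing_at_bot :: "(real \<Rightarrow> complex) \<Rightarrow> bool" where
  "rapidly_decreasing_at_bot \<psi> \<longleftrightarrow>
     (\<forall>N n. \<exists>C. \<forall>\<tau>\<le>-1. \<bar>\<tau>\<bar> ^ N * cmod ((vderiv ^^ n) \<psi> \<tau>) \<le> C)"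

definition expansion_data ::
    "real \<Rightarrow> (nat \<Rightarrow> real) \<Rightarrow> (index \<Rightarrow> real \<Rightarrow> complex) \<Rightarrow> (real \<Rightarrow> real)
      \<Rightarrow> (nat \<Rightarrow> int \<Rightarrow> real \<Rightarrow> complex) \<Rightarrow> (nat \<Rightarrow> int \<Rightarrow> nat \<Rightarrow> complex) \<Rightarrow> bool" where
  "expansion_data P t b Z \<Psi> a \<longleftrightarrow>
     (\<forall>i\<in>indices. smooth (b i) \<and> periodic (2 * P) (b i)) \<and>
     smooth Z \<and> periodic (2 * P) Z \<and>
     (\<forall>s\<in>{t 1<..<t 2}. Z s > 0) \<and> (\<forall>s\<in>{0..<t 1} \<union> {t 2<..2 * P}. Z s < 0) \<and>
     (\<forall>j\<in>{1, 2}. Z (t j) = 0 \<and> vderiv Z (t j) \<noteq> 0) \<and>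
     (\<forall>r. \<forall>l\<le>-1. smooth (\<Psi> r l) \<and> symbol_expansion (\<Psi> r l) (1 + l - 2 * int r) (a r l) \<and>
        rapidly_decreasing_at_bot (\<Psi> r l))"

definition has_expansion ::
    "real \<Rightarrow> (real \<Rightarrow> real \<Rightarrow> complex) \<Rightarrow> (index \<Rightarrow> real \<Rightarrow> real \<Rightarrow> complex) \<Rightarrow> bool" where
  "has_expansion P w A \<longleftrightarrow>
     w \<in> hoermander P 0 (2/3) (1/3) \<and>
     (\<forall>M>0. \<exists>F\<^sub>M. finite F\<^sub>M \<and> F\<^sub>M \<subseteq> indices \<and>
        (\<forall>F. finite F \<and> F\<^sub>M \<subseteq> F \<and> F \<subseteq> indices \<longrightarrow>
           (\<lambda>s k. w s k - (\<Sum>i\<in>F. A i s k)) \<in> hoermander P (- M) (2/3) (1/3)))"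

definition sigma_beta ::
    "(real \<Rightarrow> real^2) \<Rightarrow> real^2 \<Rightarrow> (index \<Rightarrow> real \<Rightarrow> real \<Rightarrow> complex) \<Rightarrow> nat \<Rightarrow> real \<Rightarrow> real \<Rightarrow> complex" where
  "sigma_beta \<gamma> \<alpha> A \<beta> s k = plane_wave \<alpha> k (\<gamma> s) * (\<Sum>i\<in>indices_beta \<beta>. A i s k)"

text \<open>Elements of the Hilbert space are represented by periodic Borel functions; equality in the
  space is equality almost everywhere.\<close>

definition L2 :: "real \<Rightarrow> (real \<Rightarrow> complex) set" where
  "L2 P = {f. periodic (2 * P) f \<and> f \<in> borel_measurable borel \<and>
              set_integrable lborel {0..2 * P} (\<lambda>s. (cmod (f s))\<^sup>2)}"

definition l2inner :: "real \<Rightarrow> (real \<Rightarrow> complex) \<Rightarrow> (real \<Rightarrow> complex) \<Rightarrow> complex" where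
  "l2inner P f g = (LINT s:{0..2 * P}|lborel. f s * cnj (g s))"

definition l2norm :: "real \<Rightarrow> (real \<Rightarrow> complex) \<Rightarrow> real" where
  "l2norm P f = sqrt (LINT s:{0..2 * P}|lborel. (cmod (f s))\<^sup>2)"

definition l2eq :: "(real \<Rightarrow> complex) \<Rightarrow> (real \<Rightarrow> complex) \<Rightarrow> bool" where
  "l2eq f g \<longleftrightarrow> (AE s in lborel. f s = g s)"

definition linear_operator :: "real \<Rightarrow> ((real \<Rightarrow> complex) \<Rightarrow> real \<Rightarrow> complex) \<Rightarrow> bool" where
  "linear_operator P R \<longleftrightarrow>
     (\<forall>f\<in>L2 P. R f \<in> L2 P) \<and>
     (\<forall>f\<in>L2 P. \<forall>g\<in>L2 P. l2eq (R (\<lambda>s. f s + g s)) (\<lambda>s. R f s + R g s)) \<and>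
     (\<forall>f\<in>L2 P. \<forall>c. l2eq (R (\<lambda>s. c * f s)) (\<lambda>s. c * R f s))"

definition continuous_operator :: "real \<Rightarrow> ((real \<Rightarrow> complex) \<Rightarrow> real \<Rightarrow> complex) \<Rightarrow> real \<Rightarrow> bool" where
  "continuous_operator P R C \<longleftrightarrow>
     (\<forall>\<mu>\<in>L2 P. \<forall>\<phi>\<in>L2 P. cmod (l2inner P \<mu> (R \<phi>)) \<le> C * l2norm P \<mu> * l2norm P \<phi>)"

definition coercive_operator :: "real \<Rightarrow> ((real \<Rightarrow> complex) \<Rightarrow> real \<Rightarrow> complex) \<Rightarrow> real \<Rightarrow> bool" where
  "coercive_operator P R c \<longleftrightarrow>
     (\<forall>\<mu>\<in>L2 P. cmod (l2inner P \<mu> (R \<mu>)) \<ge> c * (l2norm P \<mu>)\<^sup>2)"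

definition region_constants ::
    "real \<Rightarrow> (nat \<Rightarrow> real) \<Rightarrow> (nat \<Rightarrow> real) \<Rightarrow> (nat \<Rightarrow> real) \<Rightarrow> (nat \<Rightarrow> real) \<Rightarrow> (nat \<Rightarrow> real) \<Rightarrow> bool" where
  "region_constants P t \<xi> \<xi>' \<zeta> \<zeta>' \<longleftrightarrow>
     (\<forall>j\<in>{1, 2}. \<xi> j > 0 \<and> \<xi>' j > 0 \<and> \<zeta> j > 0 \<and> \<zeta>' j > 0) \<and>
     t 1 + \<xi> 1 \<le> t 1 + \<xi>' 1 \<and> t 1 + \<xi>' 1 = t 2 - \<xi>' 2 \<and> t 2 - \<xi>' 2 \<le> t 2 - \<xi> 2 \<and>
     t 2 + \<zeta> 2 \<le> t 2 + \<zeta>' 2 \<and> t 2 + \<zeta>' 2 = 2 * P + t 1 - \<zeta>' 1 \<and>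
     2 * P + t 1 - \<zeta>' 1 \<le> 2 * P + t 1 - \<zeta> 1"

text \<open>Only the indices \<open>1, \<dots>, 6\<close> are used (\<open>1, \<dots>, 4\<close> for the exponent \<open>\<psi>\<close> and the factor \<open>\<phi>c\<close>).\<close>

locale regions =
  fixes t \<xi> \<xi>' \<zeta> \<zeta>' :: "nat \<Rightarrow> real" and k :: real
begin

definition lo :: "nat \<Rightarrow> real" where
  "lo j =
    (if j = 1 then t 1 + \<xi> 1 * k powr (-1/3)
     else if j = 2 then t 2 - \<xi>' 2
     else if j = 3 then t 1 - \<zeta>' 1
     else if j = 4 then t 2 + \<zeta> 2 * k powr (-1/3)
     else if j = 5 then t 1 - \<zeta> 1 * k powr (-1/3)
     else t 2 - \<xi> 2 * k powr (-1/3))"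

definition hi :: "nat \<Rightarrow> real" where
  "hi j =
    (if j = 1 then t 1 + \<xi>' 1
     else if j = 2 then t 2 - \<xi> 2 * k powr (-1/3)
     else if j = 3 then t 1 - \<zeta> 1 * k powr (-1/3)
     else if j = 4 then t 2 + \<zeta>' 2
     else if j = 5 then t 1 + \<xi> 1 * k powr (-1/3)
     else t 2 + \<zeta> 2 * k powr (-1/3))"

definition \<I> :: "nat \<Rightarrow> real set" where
  "\<I> j = {lo j..hi j}"

definition \<psi> :: "nat \<Rightarrow> real \<Rightarrow> real" where
  "\<psi> j s =
    (if j = 1 \<or> j = 4 then - (1/3) * ((hi j - s) / (hi j - lo j))
     else - (1/3) * ((s - lo j) / (hi j - lo j)))"

definition \<phi>c :: "nat \<Rightarrow> real \<Rightarrow> real" where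
  "\<phi>c j s =
    (if j = 1 then \<xi> 1 + (\<xi>' 1 - \<xi> 1) * ((s - lo 1) / (hi 1 - lo 1))
     else if j = 2 then \<xi>' 2 + (\<xi> 2 - \<xi>' 2) * ((s - lo 2) / (hi 2 - lo 2))
     else if j = 3 then \<zeta>' 1 + (\<zeta> 1 - \<zeta>' 1) * ((s - lo 3) / (hi 3 - lo 3))
     else \<zeta> 2 + (\<zeta>' 2 - \<zeta> 2) * ((s - lo 4) / (hi 4 - lo 4)))"

definition \<phi> :: "nat \<Rightarrow> real \<Rightarrow> real" where
  "\<phi> j s =
    (if j = 1 then t 1 + \<phi>c 1 s * k powr \<psi> 1 s
     else if j = 2 then t 2 - \<phi>c 2 s * k powr \<psi> 2 s
     else if j = 3 then t 1 - \<phi>c 3 s * k powr \<psi> 3 s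
     else if j = 4 then t 2 + \<phi>c 4 s * k powr \<psi> 4 s
     else s)"

end

text \<open>The six intervals tile one period \<open>[t 1 - \<zeta>' 1, t 2 + \<zeta>' 2]\<close>, which may start to the left of \<open>0\<close>;
  the elements of the space are the periodic functions given there by the sum of the six pieces.\<close>

definition galerkin_space ::
    "real \<Rightarrow> (real \<Rightarrow> real^2) \<Rightarrow> real^2 \<Rightarrow> (nat \<Rightarrow> real) \<Rightarrow> (nat \<Rightarrow> real) \<Rightarrow> (nat \<Rightarrow> real)
      \<Rightarrow> (nat \<Rightarrow> real) \<Rightarrow> (nat \<Rightarrow> real) \<Rightarrow> real \<Rightarrow> (nat \<Rightarrow> nat) \<Rightarrow> (real \<Rightarrow> complex) set" where
  "galerkin_space P \<gamma> \<alpha> t \<xi> \<xi>' \<zeta> \<zeta>' k d = {f \<in> L2 P. \<exists>p :: nat \<Rightarrow> complex poly.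
     (\<forall>j\<in>{1..6}. degree (p j) \<le> d j) \<and>
     (AE s in lborel. s \<in> {t 1 - \<zeta>' 1..t 2 + \<zeta>' 2} \<longrightarrow>
        f s = plane_wave \<alpha> k (\<gamma> s) *
          (\<Sum>j=1..6. indicator (regions.\<I> t \<xi> \<xi>' \<zeta> \<zeta>' k j) s *
             poly (p j) (of_real
               (inv_into (regions.\<I> t \<xi> \<xi>' \<zeta> \<zeta>' k j) (regions.\<phi> t \<xi> \<xi>' \<zeta> \<zeta>' k j) s))))}"

definition galerkin_equation ::
    "real \<Rightarrow> ((real \<Rightarrow> complex) \<Rightarrow> real \<Rightarrow> complex) \<Rightarrow> (real \<Rightarrow> complex) \<Rightarrow> (real \<Rightarrow> complex) set
      \<Rightarrow> (real \<Rightarrow> complex) \<Rightarrow> bool" where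
  "galerkin_equation P R g V \<rho> \<longleftrightarrow>
     \<rho> \<in> V \<and> (\<forall>\<mu>\<in>V. l2inner P \<mu> (R \<rho>) = l2inner P \<mu> g)"

text \<open>The solution is unique only up to null sets, so a representative is chosen.\<close>

definition galerkin_solution ::
    "real \<Rightarrow> ((real \<Rightarrow> complex) \<Rightarrow> real \<Rightarrow> complex) \<Rightarrow> (real \<Rightarrow> complex) \<Rightarrow> (real \<Rightarrow> complex) set
      \<Rightarrow> real \<Rightarrow> complex" where
  "galerkin_solution P R g V = (SOME \<rho>. galerkin_equation P R g V \<rho>)"

text \<open>\<open>\<sigma> + \<rho>\<close> where \<open>\<rho> \<in> V\<close> is the Galerkin approximation for the right-hand side \<open>f - R \<sigma>\<close>.\<close>

definition asymptotic_galerkin ::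
    "real \<Rightarrow> ((real \<Rightarrow> complex) \<Rightarrow> real \<Rightarrow> complex) \<Rightarrow> (real \<Rightarrow> complex) \<Rightarrow> (real \<Rightarrow> complex) set
      \<Rightarrow> (real \<Rightarrow> complex) \<Rightarrow> real \<Rightarrow> complex" where
  "asymptotic_galerkin P R f V \<sigma> s =
     \<sigma> s + galerkin_solution P R (\<lambda>s. f s - R \<sigma> s) V s"

end

theory Submission
  imports Defs
begin

text \<open>
  A coercive Galerkin method is quasi-optimal (\<open>galerkin_quasi_optimal\<close>), so the error is at most
  \<open>C\<^sub>R k / c\<^sub>R k\<close> times the distance of \<open>\<rho> = \<eta> - \<sigma>\<^sub>\<beta>\<close> from the Galerkin space.  The plane wave has
  modulus one and occurs both in \<open>\<rho>\<close> and in the elements of the space; what has to be approximated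
  is the slowly oscillating factor \<open>F\<close> of \<open>\<rho>\<close>, by a polynomial in the variable \<open>\<phi>\<^sub>j^(-1)(s)\<close> on each
  of the six intervals.

  \<^item> \<^emph>\<open>How large are the derivatives of F?\<close>  A term of the expansion is \<open>k\<^sup>e b(s) \<Psi>(k^(1/3) Z(s))\<close>.  All
    the functions \<open>(\<tau> d/d\<tau>)\<^sup>m \<Psi>\<close> are bounded, because \<open>\<Psi>\<close> is a symbol of nonpositive order, and
    near a shadow boundary point \<open>t\<^sub>j\<close> the function \<open>Z\<close> has a simple zero, so that
    \<open>(s - t\<^sub>j) d/ds\<close> acts on functions of \<open>k^(1/3) Z(s)\<close> like a bounded multiple of \<open>\<tau> d/d\<tau>\<close>.  Hence
    \<open>F\<close> stays of size \<open>k^(-\<beta>/3)\<close> under any number of applications of \<open>(s - t\<^sub>j) d/ds\<close>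
    (\<open>remainder_symbol_bound_away\<close>), and within distance \<open>O(k^(-1/3))\<close> of \<open>t\<^sub>j\<close> under any number of
    applications of \<open>k^(-1/3) d/ds\<close> (\<open>remainder_symbol_bound_near\<close>).

  \<^item> \<^emph>\<open>What does the change of variables do?\<close>  On a transition interval \<open>\<phi> - t\<^sub>j\<close> is an affine
    function times an exponential whose exponent has slope of order \<open>log k\<close>, so
    \<open>\<phi>' = O(log k) (\<phi> - t\<^sub>j)\<close>.  Therefore \<open>(log k)^(-1) d/ds\<close> acts on functions of \<open>\<phi>\<close> like a bounded
    multiple of the vector field \<open>(s - t\<^sub>j) d/ds\<close>: each ordinary derivative of \<open>F \<circ> \<phi>\<close> costs one
    factor \<open>log k\<close>.  The Jacobian \<open>\<phi>'\<close> in the \<open>L\<^sup>2\<close> norm costs another \<open>(log k)^(1/2)\<close>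
    (\<open>exponential_chart_approximation\<close>).

  \<^item> \<^emph>\<open>How well do polynomials approximate?\<close>  On \<open>[-1, 1]\<close> the best mean-square approximation by
    polynomials of degree \<open>d\<close> has error at most \<open>2/(d + 1)\<close> times the \<open>L\<^sup>2\<close> norm of the derivative,
    up to an arbitrarily small quantity (\<open>jackson_complex\<close>).  Applying this \<open>n\<close> times, with degrees
    \<open>d, d - 1, \<dots>, d - n + 1\<close>, yields the factor \<open>d^(-n)\<close>; the last step makes sense exactly for
    \<open>d \<ge> n - 1\<close> (\<open>jackson_iterated\<close>).

  Both of the first two points say how a vector field is transported by a map.  The predicate
  \<open>symbol_bound\<close> therefore bounds iterated derivatives along a weighted field \<open>w d/dx\<close>, and a single
  composition rule, \<open>symbol_bound_compose\<close>, does the work of the Faa di Bruno formula.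
\<close>

section \<open>Polynomial approximation in the mean\<close>

fun cheb :: "nat \<Rightarrow> real poly" where
  "cheb 0 = 1"
| "cheb (Suc 0) = [:0, 1:]"
| "cheb (Suc (Suc n)) = [:0, 2:] * cheb (Suc n) - cheb n"

lemma poly_cheb_cos: "poly (cheb n) (cos \<theta>) = cos (real n * \<theta>)"
proof (induction n rule: cheb.induct)
  case (3 n)
  have "cos (real (Suc (Suc n)) * \<theta>) + cos (real n * \<theta>) = 2 * cos \<theta> * cos (real (Suc n) * \<theta>)"
    using cos_add[of "real (Suc n) * \<theta>" \<theta>] cos_diff[of "real (Suc n) * \<theta>" \<theta>]
    by (simp add: algebra_simps)
  then show ?case using 3 by simp
qed auto

lemma degree_cheb_le: "degree (cheb n) \<le> n"
proof (induction n rule: cheb.induct)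
  case (3 n)
  have "degree ([:0, 2:] * cheb (Suc n)) \<le> Suc (Suc n)"
    using degree_mult_le[of "[:0, 2::real:]" "cheb (Suc n)"] 3 by simp
  then show ?case using 3 by (auto intro!: degree_diff_le)
qed auto

lemma coeff_cheb_pos: "coeff (cheb n) n > 0"
proof (induction n rule: cheb.induct)
  case (3 n)
  have "coeff (cheb n) (Suc (Suc n)) = 0"
    using degree_cheb_le[of n] by (intro coeff_eq_0) auto
  then show ?case using 3 by simp
qed auto

text \<open>
  The Chebyshev polynomials have nonzero leading coefficients, so they form a triangular basis.
\<close>

lemma cheb_expansion:
  assumes "degree p < N"
  shows "\<exists>c. p = (\<Sum>j<N. smult (c j) (cheb j))"
  using assms
proof (induction N arbitrary: p)
  case (Suc N)
  define a where "a = coeff p N / coeff (cheb N) N"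
  define q where "q = p - smult a (cheb N)"
  have q0: "coeff q i = 0" if "i \<ge> N" for i
  proof (cases "i = N")
    case True
    then show ?thesis using coeff_cheb_pos[of N] by (simp add: q_def a_def)
  next
    case False
    with that have "degree p < i" "degree (cheb N) < i"
      using Suc.prems degree_cheb_le[of N] by auto
    then show ?thesis by (simp add: q_def coeff_eq_0)
  qed
  show ?case
  proof (cases "N = 0")
    case True
    then have "degree p = 0" using Suc.prems by simp
    then obtain b where "p = [:b:]" by (metis degree_eq_zeroE)
    then show ?thesis using True by (intro exI[of _ "\<lambda>_. b"]) simp
  next
    case False
    have "degree q < N"
      using q0 False by (metis degree_0 leading_coeff_0_iff linorder_not_le not_gr_zero)
    then obtain c where c: "q = (\<Sum>j<N. smult (c j) (cheb j))" using Suc.IH by blast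
    have "p = (\<Sum>j<Suc N. smult ((c(N := a)) j) (cheb j))"
      using c by (simp add: q_def algebra_simps)
    then show ?thesis by blast
  qed
qed simp

lemma integral_cos_nat: "((\<lambda>\<theta>. cos (of_int m * \<theta>)) has_integral (if m = 0 then pi else 0)) {0..pi}"
proof (cases "m = 0")
  case True
  then show ?thesis using has_integral_const_real[of "1::real" 0 pi] by simp
next
  case False
  have "((\<lambda>\<theta>. cos (of_int m * \<theta>)) has_integral
      (sin (of_int m * pi) / of_int m - sin (of_int m * 0) / of_int m)) {0..pi}"
    by (rule fundamental_theorem_of_calculus)
      (use False in \<open>auto intro!: derivative_eq_intros simp: has_real_derivative_iff_has_vector_derivative[symmetric]\<close>)
  moreover have "sin (of_int m * pi) = 0" by (simp add: sin_times_pi_eq_0)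
  ultimately show ?thesis using False by simp
qed

lemma integral_cos_cos:
  "((\<lambda>\<theta>. cos (real i * \<theta>) * cos (real j * \<theta>)) has_integral
     (if i = j then (if i = 0 then pi else pi / 2) else 0)) {0..pi}"
proof -
  have eq: "cos (real i * \<theta>) * cos (real j * \<theta>) =
      (cos (of_int (int i - int j) * \<theta>) + cos (of_int (int i + int j) * \<theta>)) / 2" for \<theta>
    by (simp add: cos_times_cos algebra_simps)
  show ?thesis unfolding eq
    using has_integral_divide[OF has_integral_add[OF integral_cos_nat[of "int i - int j"]
        integral_cos_nat[of "int i + int j"]], of 2]
    by (rule has_integral_eq_rhs) auto
qed

lemma integral_sin_sin:
  "((\<lambda>\<theta>. sin (real i * \<theta>) * sin (real j * \<theta>)) has_integral
     (if i = j then (if i = 0 then 0 else pi / 2) else 0)) {0..pi}"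
proof -
  have eq: "sin (real i * \<theta>) * sin (real j * \<theta>) =
      (cos (of_int (int i - int j) * \<theta>) - cos (of_int (int i + int j) * \<theta>)) / 2" for \<theta>
    by (simp add: sin_times_sin algebra_simps)
  show ?thesis unfolding eq
    using has_integral_divide[OF has_integral_diff[OF integral_cos_nat[of "int i - int j"]
        integral_cos_nat[of "int i + int j"]], of 2]
    by (rule has_integral_eq_rhs) auto
qed

lemma integral_square_sum_orthogonal:
  fixes e :: "nat \<Rightarrow> real \<Rightarrow> real"
  assumes "\<And>i j. ((\<lambda>\<theta>. e i \<theta> * e j \<theta>) has_integral (if i = j then w i else 0)) S" "finite J"
  shows "((\<lambda>\<theta>. (\<Sum>j\<in>J. c j * e j \<theta>)\<^sup>2) has_integral (\<Sum>j\<in>J. (c j)\<^sup>2 * w j)) S"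
proof -
  have eq: "(\<lambda>\<theta>. (\<Sum>j\<in>J. c j * e j \<theta>)\<^sup>2) = (\<lambda>\<theta>. \<Sum>i\<in>J. \<Sum>j\<in>J. c i * c j * (e i \<theta> * e j \<theta>))"
    by (simp add: power2_eq_square sum_product mult_ac)
  have "((\<lambda>\<theta>. \<Sum>i\<in>J. \<Sum>j\<in>J. c i * c j * (e i \<theta> * e j \<theta>)) has_integral
      (\<Sum>i\<in>J. \<Sum>j\<in>J. c i * c j * (if i = j then w i else 0))) S"
    by (intro has_integral_sum has_integral_mult_right assms)
  also have "(\<Sum>i\<in>J. \<Sum>j\<in>J. c i * c j * (if i = j then w i else 0)) = (\<Sum>j\<in>J. (c j)\<^sup>2 * w j)"
    using assms(2) by (simp add: if_distrib[of "\<lambda>x. _ * x"] sum.delta' power2_eq_square cong: if_cong)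
  finally show ?thesis by (simp add: eq)
qed

text \<open>
  The substitution \<open>x = cos \<theta>\<close>; the orientation is reversed, hence the detour through \<open>- cos\<close>.
\<close>

lemma integral_cos_substitution:
  fixes f :: "real \<Rightarrow> real"
  assumes "continuous_on {-1..1} f"
  shows "((\<lambda>\<theta>. sin \<theta> * f (cos \<theta>)) has_integral integral {-1..1} f) {0..pi}"
proof -
  have "((\<lambda>\<theta>. sin \<theta> *\<^sub>R f (- (- cos \<theta>))) has_integral
        (integral {- cos 0..- cos pi} (\<lambda>x. f (- x)))) {0..pi}"
    by (rule has_integral_substitution[where g = "\<lambda>\<theta>. - cos \<theta>" and c = "-1" and d = 1])
      (auto intro!: derivative_eq_intros continuous_intros continuous_on_compose2[OF assms])
  moreover have "integral {-1..1} (\<lambda>x. f (- x)) = integral {-1..1} f"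
    using Henstock_Kurzweil_Integration.integral_reflect_real[of 1 "-1" f] by simp
  ultimately show ?thesis by simp
qed

text \<open>
  The substitution \<open>x = cos \<theta>\<close> turns the Chebyshev expansion of \<open>p\<close> into a cosine sum with
  coefficients \<open>c j\<close>, and \<open>p'(cos \<theta>) sin \<theta>\<close> into a sine sum with coefficients \<open>j c j\<close>.  Dropping the
  terms with \<open>j > d\<close> therefore loses at most \<open>(d + 1)^(-2)\<close> times the square norm of the sine sum.  The
  Jacobian \<open>sin \<theta>\<close> is at most \<open>1\<close> on the left; on the right one factor of \<open>sin\<^sup>2 \<theta>\<close> serves as the
  Jacobian and the other is at most \<open>1\<close>.  So both norms are those of the unweighted space, which is
  what allows the estimate to be iterated.
\<close>

lemma polynomial_truncation_error:
  fixes p :: "real poly"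
  shows "\<exists>q. degree q \<le> d \<and>
    integral {-1..1} (\<lambda>x. (poly p x - poly q x)\<^sup>2)
      \<le> integral {-1..1} (\<lambda>x. (poly (pderiv p) x)\<^sup>2) / (real d + 1)\<^sup>2"
proof -
  \<comment> \<open>The summand \<open>d\<close> ensures that all indices up to \<open>d\<close> occur in the expansion.\<close>
  define N where "N = Suc (degree p + d)"
  obtain c where c: "p = (\<Sum>j<N. smult (c j) (cheb j))"
    using cheb_expansion[of p N] by (auto simp: N_def)
  define q where "q = (\<Sum>j\<le>d. smult (c j) (cheb j))"
  have dq: "degree q \<le> d"
    unfolding q_def
    by (intro degree_sum_le) (auto intro!: order.trans[OF degree_smult_le] order.trans[OF degree_cheb_le])
  have split: "{..<N} = {..d} \<union> {Suc d..<N}" by (auto simp: N_def)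
  have pq: "p - q = (\<Sum>j\<in>{Suc d..<N}. smult (c j) (cheb j))"
    unfolding c q_def split by (subst sum.union_disjoint) auto
  have pq_cos: "poly p (cos \<theta>) - poly q (cos \<theta>) = (\<Sum>j\<in>{Suc d..<N}. c j * cos (real j * \<theta>))" for \<theta>
    unfolding poly_diff[symmetric] pq by (simp add: poly_sum poly_cheb_cos)
  have p_cos: "poly p (cos \<theta>) = (\<Sum>j<N. c j * cos (real j * \<theta>))" for \<theta>
    by (subst c) (simp add: poly_sum poly_cheb_cos)
  have dp_cos: "poly (pderiv p) (cos \<theta>) * sin \<theta> = (\<Sum>j<N. (real j * c j) * sin (real j * \<theta>))" for \<theta>
  proof -
    have "((\<lambda>\<theta>. poly p (cos \<theta>)) has_real_derivative poly (pderiv p) (cos \<theta>) * (- sin \<theta>)) (at \<theta>)"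
      by (rule DERIV_chain2[OF poly_DERIV]) (auto intro!: derivative_eq_intros)
    moreover have "((\<lambda>\<theta>. poly p (cos \<theta>)) has_real_derivative
        (\<Sum>j<N. - (real j * c j * sin (real j * \<theta>)))) (at \<theta>)"
      unfolding p_cos by (auto intro!: derivative_eq_intros sum.cong)
    ultimately show ?thesis
      using DERIV_unique by (fastforce simp: sum_negf)
  qed
  have 1: "((\<lambda>\<theta>. (poly p (cos \<theta>) - poly q (cos \<theta>))\<^sup>2) has_integral
      (\<Sum>j\<in>{Suc d..<N}. (c j)\<^sup>2 * (if j = 0 then pi else pi / 2))) {0..pi}"
    unfolding pq_cos by (rule integral_square_sum_orthogonal[OF integral_cos_cos]) auto
  have 2: "((\<lambda>\<theta>. (poly (pderiv p) (cos \<theta>) * sin \<theta>)\<^sup>2) has_integral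
      (\<Sum>j<N. (real j * c j)\<^sup>2 * (if j = 0 then 0 else pi / 2))) {0..pi}"
    unfolding dp_cos
    by (rule integral_square_sum_orthogonal[OF integral_sin_sin]) auto
  have sin01: "sin \<theta> \<ge> 0" "sin \<theta> \<le> 1" if "\<theta> \<in> {0..pi}" for \<theta>
    using that by (auto intro: sin_ge_zero)
  have "integral {-1..1} (\<lambda>x. (poly p x - poly q x)\<^sup>2)
      \<le> (\<Sum>j\<in>{Suc d..<N}. (c j)\<^sup>2 * (if j = 0 then pi else pi / 2))"
    by (rule has_integral_le[OF integral_cos_substitution 1])
      (use sin01 in \<open>auto intro!: continuous_intros mult_left_le_one_le\<close>)
  also have "\<dots> \<le> (\<Sum>j\<in>{Suc d..<N}. (real j * c j)\<^sup>2 * (if j = 0 then 0 else pi / 2) / (real d + 1)\<^sup>2)"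
  proof (rule sum_mono)
    fix j assume j: "j \<in> {Suc d..<N}"
    then have "(real d + 1)\<^sup>2 \<le> (real j)\<^sup>2" by (intro power_mono) auto
    then have "(c j)\<^sup>2 * (real d + 1)\<^sup>2 \<le> (c j)\<^sup>2 * (real j)\<^sup>2" by (intro mult_left_mono) auto
    then show "(c j)\<^sup>2 * (if j = 0 then pi else pi / 2)
        \<le> (real j * c j)\<^sup>2 * (if j = 0 then 0 else pi / 2) / (real d + 1)\<^sup>2"
      using j by (simp add: field_simps power_mult_distrib add_pos_nonneg)
  qed
  also have "\<dots> = (\<Sum>j\<in>{Suc d..<N}. (real j * c j)\<^sup>2 * (if j = 0 then 0 else pi / 2)) / (real d + 1)\<^sup>2"
    by (simp add: sum_divide_distrib)
  also have "\<dots> \<le> (\<Sum>j<N. (real j * c j)\<^sup>2 * (if j = 0 then 0 else pi / 2)) / (real d + 1)\<^sup>2"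
    by (intro divide_right_mono sum_mono2) auto
  also have "\<dots> \<le> integral {-1..1} (\<lambda>x. (poly (pderiv p) x)\<^sup>2) / (real d + 1)\<^sup>2"
  proof (intro divide_right_mono has_integral_le[OF 2 integral_cos_substitution])
    fix \<theta> assume \<theta>: "\<theta> \<in> {0..pi}"
    have "(poly (pderiv p) (cos \<theta>) * sin \<theta>)\<^sup>2 = sin \<theta> * (sin \<theta> * (poly (pderiv p) (cos \<theta>))\<^sup>2)"
      by (simp add: power2_eq_square)
    also have "\<dots> \<le> sin \<theta> * (poly (pderiv p) (cos \<theta>))\<^sup>2"
      using sin01[OF \<theta>] by (intro mult_left_mono mult_left_le_one_le) auto
    finally show "(poly (pderiv p) (cos \<theta>) * sin \<theta>)\<^sup>2 \<le> sin \<theta> * (poly (pderiv p) (cos \<theta>))\<^sup>2" .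
  qed (auto intro!: continuous_intros)
  finally show ?thesis using dq by blast
qed

lemma poly_antiderivative:
  fixes q :: "'a::field_char_0 poly"
  shows "\<exists>p. pderiv p = q \<and> degree p \<le> Suc (degree q)"
proof -
  define p where "p = (\<Sum>i\<le>degree q. monom (coeff q i / of_nat (Suc i)) (Suc i))"
  have *: "pderiv (monom (coeff q i / of_nat (Suc i)) (Suc i)) = monom (coeff q i) i" for i
    by (simp add: pderiv_monom del: of_nat_Suc)
  have "pderiv p = (\<Sum>i\<le>degree q. monom (coeff q i) i)"
    unfolding p_def using * higher_pderiv_sum[of 1 "\<lambda>i. monom (coeff q i / of_nat (Suc i)) (Suc i)" "{..degree q}"]
    by simp
  then have "pderiv p = q" by (simp add: poly_as_sum_of_monoms)
  moreover have "degree p \<le> Suc (degree q)"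
    unfolding p_def by (intro degree_sum_le) (auto intro: order.trans[OF degree_monom_le])
  ultimately show ?thesis by blast
qed

lemma poly_uniformly_dense:
  fixes f :: "real \<Rightarrow> real"
  assumes "compact S" "continuous_on S f" "e > 0"
  shows "\<exists>p. \<forall>x\<in>S. \<bar>f x - poly p x\<bar> < e"
proof -
  obtain g where g: "real_polynomial_function g" "\<And>x. x \<in> S \<Longrightarrow> \<bar>f x - g x\<bar> < e"
    using Stone_Weierstrass_real_polynomial_function[OF assms] by blast
  obtain a n where "g = (\<lambda>x. \<Sum>i\<le>n. a i * x ^ i)"
    using g(1) real_polynomial_function_iff_sum by blast
  then have "g = poly (\<Sum>i\<le>n. monom (a i) i)" by (simp add: poly_sum poly_monom fun_eq_iff)
  with g(2) show ?thesis by blast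
qed

text \<open>
  By the Weierstrass theorem \<open>f'\<close> is uniformly close to a polynomial, whose antiderivative is then
  close to \<open>f\<close>; this reduces the claim to polynomials.  The constant \<open>4\<close> comes from applying
  \<open>(a + b)\<^sup>2 \<le> 2 a\<^sup>2 + 2 b\<^sup>2\<close> once to \<open>f\<close> and once to \<open>f'\<close>.
\<close>

lemma jackson_real:
  fixes f :: "real \<Rightarrow> real"
  assumes f': "\<And>x. x \<in> {-1..1} \<Longrightarrow> (f has_real_derivative f' x) (at x within {-1..1})"
    and cont: "continuous_on {-1..1} f'" and "\<epsilon> > 0"
  shows "\<exists>p. degree p \<le> d \<and> integral {-1..1} (\<lambda>x. (f x - poly p x)\<^sup>2)
    \<le> 4 * integral {-1..1} (\<lambda>x. (f' x)\<^sup>2) / (real d + 1)\<^sup>2 + \<epsilon>"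
proof -
  \<comment> \<open>The two replacements by polynomials cost \<open>16 \<delta>\<^sup>2 + 8 \<delta>\<^sup>2\<close> in total.\<close>
  define \<delta> where "\<delta> = sqrt (\<epsilon> / 24)"
  have \<delta>: "\<delta> > 0" "\<delta>\<^sup>2 = \<epsilon> / 24" using \<open>\<epsilon> > 0\<close> by (auto simp: \<delta>_def)
  obtain q where q: "\<And>x. x \<in> {-1..1} \<Longrightarrow> \<bar>f' x - poly q x\<bar> < \<delta>"
    using poly_uniformly_dense[OF compact_Icc cont \<delta>(1)] by blast
  obtain p0 where p0: "pderiv p0 = q" using poly_antiderivative by blast
  define p where "p = p0 + [:f (-1) - poly p0 (-1):]"
  have p: "pderiv p = q" "poly p (-1) = f (-1)" by (simp_all add: p_def p0 pderiv_add pderiv_pCons)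
  obtain r where r: "degree r \<le> d" "integral {-1..1} (\<lambda>x. (poly p x - poly r x)\<^sup>2)
      \<le> integral {-1..1} (\<lambda>x. (poly q x)\<^sup>2) / (real d + 1)\<^sup>2"
    using polynomial_truncation_error[of d p] p(1) by auto
  have cont_f: "continuous_on {-1..1} f"
    using f' DERIV_continuous continuous_on_eq_continuous_within by blast
  have fp: "\<bar>f x - poly p x\<bar> \<le> 2 * \<delta>" if "x \<in> {-1..1}" for x
  proof -
    have "norm ((f x - poly p x) - (f (-1) - poly p (-1))) \<le> \<delta> * norm (x - (-1))"
    proof (rule field_differentiable_bound[where S = "{-1..1}" and f' = "\<lambda>x. f' x - poly q x"])
      show "((\<lambda>x. f x - poly p x) has_field_derivative f' z - poly q z) (at z within {-1..1})"
        if "z \<in> {-1..1}" for z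
        using f'[OF that] DERIV_subset[OF poly_DERIV[of p z], of "{-1..1}"] p(1)
        by (auto intro: DERIV_diff)
    qed (use q that in \<open>auto intro: less_imp_le\<close>)
    also have "\<dots> \<le> \<delta> * 2" using that \<delta> by (intro mult_left_mono) auto
    finally show ?thesis using p(2) by simp
  qed
  have int1: "(\<lambda>x. (f x - poly r x)\<^sup>2) integrable_on {-1..1}"
    "(\<lambda>x. (poly p x - poly r x)\<^sup>2) integrable_on {-1..1}"
    "(\<lambda>x. (poly q x)\<^sup>2) integrable_on {-1..1}" "(\<lambda>x. (f' x)\<^sup>2) integrable_on {-1..1}"
    using cont cont_f by (auto intro!: integrable_continuous_interval continuous_intros)
  have sq: "(a + b)\<^sup>2 \<le> 2 * a\<^sup>2 + 2 * b\<^sup>2" for a b :: real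
    using zero_le_power2[of "a - b"] by (simp add: power2_eq_square algebra_simps)
  have c: "((\<lambda>x::real. c) has_integral 2 * c) {-1..1}" for c :: real
    using has_integral_const_real[of c "-1" 1] by simp
  define D where "D = (real d + 1)\<^sup>2"
  have D: "D \<ge> 1" unfolding D_def by (intro one_le_power) simp
  have q_int: "integral {-1..1} (\<lambda>x. (poly q x)\<^sup>2) \<le> 2 * integral {-1..1} (\<lambda>x. (f' x)\<^sup>2) + 2 * (2 * \<delta>\<^sup>2)"
  proof (rule has_integral_le[OF integrable_integral[OF int1(3)]
        has_integral_add[OF has_integral_mult_right[OF integrable_integral[OF int1(4)]] c]])
    fix x :: real assume x: "x \<in> {-1..1}"
    have "\<bar>poly q x - f' x\<bar> \<le> \<bar>\<delta>\<bar>" using q[OF x] \<delta>(1) by linarith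
    then have "(poly q x - f' x)\<^sup>2 \<le> \<delta>\<^sup>2" by (simp only: abs_le_square_iff)
    then show "(poly q x)\<^sup>2 \<le> 2 * (f' x)\<^sup>2 + 2 * \<delta>\<^sup>2"
      using sq[of "f' x" "poly q x - f' x"] by simp
  qed
  have "integral {-1..1} (\<lambda>x. (f x - poly r x)\<^sup>2)
      \<le> 2 * (2 * \<delta>)\<^sup>2 * 2 + 2 * integral {-1..1} (\<lambda>x. (poly p x - poly r x)\<^sup>2)"
  proof (rule has_integral_le[OF integrable_integral[OF int1(1)]
        has_integral_add[OF _ has_integral_mult_right[OF integrable_integral[OF int1(2)]]]])
    show "((\<lambda>x::real. 2 * (2 * \<delta>)\<^sup>2) has_integral 2 * (2 * \<delta>)\<^sup>2 * 2) {-1..1}"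
      using c[of "2 * (2 * \<delta>)\<^sup>2"] by (simp add: mult_ac)
    fix x :: real assume x: "x \<in> {-1..1}"
    have "\<bar>f x - poly p x\<bar> \<le> \<bar>2 * \<delta>\<bar>" using fp[OF x] \<delta>(1) by linarith
    then have "(f x - poly p x)\<^sup>2 \<le> (2 * \<delta>)\<^sup>2" by (simp only: abs_le_square_iff)
    then show "(f x - poly r x)\<^sup>2 \<le> 2 * (2 * \<delta>)\<^sup>2 + 2 * (poly p x - poly r x)\<^sup>2"
      using sq[of "f x - poly p x" "poly p x - poly r x"] by simp
  qed
  also have "\<dots> \<le> 2 * (2 * \<delta>)\<^sup>2 * 2 + 2 * (integral {-1..1} (\<lambda>x. (poly q x)\<^sup>2) / (real d + 1)\<^sup>2)"
    using r(2) by linarith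
  also have "\<dots> \<le> 16 * \<delta>\<^sup>2 + 2 * ((2 * integral {-1..1} (\<lambda>x. (f' x)\<^sup>2) + 4 * \<delta>\<^sup>2) / D)"
  proof -
    have "integral {-1..1} (\<lambda>x. (poly q x)\<^sup>2) / D \<le> (2 * integral {-1..1} (\<lambda>x. (f' x)\<^sup>2) + 4 * \<delta>\<^sup>2) / D"
      using q_int D by (intro divide_right_mono) auto
    moreover have "2 * (2 * \<delta>)\<^sup>2 * 2 = 16 * \<delta>\<^sup>2" by (simp add: power_mult_distrib)
    ultimately show ?thesis unfolding D_def by linarith
  qed
  also have "\<dots> = 4 * integral {-1..1} (\<lambda>x. (f' x)\<^sup>2) / D + 16 * \<delta>\<^sup>2 + 8 * \<delta>\<^sup>2 / D"
    by (simp add: add_divide_distrib)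
  finally have "integral {-1..1} (\<lambda>x. (f x - poly r x)\<^sup>2)
      \<le> 4 * integral {-1..1} (\<lambda>x. (f' x)\<^sup>2) / D + 16 * \<delta>\<^sup>2 + 8 * \<delta>\<^sup>2 / D" .
  moreover have "8 * \<delta>\<^sup>2 / D \<le> 8 * \<delta>\<^sup>2"
    using D by (simp add: divide_le_eq mult_le_cancel_left1)
  ultimately have "integral {-1..1} (\<lambda>x. (f x - poly r x)\<^sup>2)
      \<le> 4 * integral {-1..1} (\<lambda>x. (f' x)\<^sup>2) / (real d + 1)\<^sup>2 + \<epsilon>"
    unfolding D_def using \<delta>(2) by linarith
  with r(1) show ?thesis by blast
qed

lemma poly_map_of_real: "poly (map_poly of_real p) (of_real x :: complex) = of_real (poly p x)"
  by (induction p) (auto simp: map_poly_pCons)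

lemma degree_map_poly_of_real_le: "degree (map_poly of_real p :: complex poly) \<le> degree p"
  by (intro degree_le) (simp add: coeff_map_poly coeff_eq_0)

abbreviation mean_square :: "(real \<Rightarrow> complex) \<Rightarrow> real" where
  "mean_square g \<equiv> integral {-1..1} (\<lambda>x. (cmod (g x))\<^sup>2)"

lemma jackson_complex:
  fixes f :: "real \<Rightarrow> complex"
  assumes f': "\<And>x. x \<in> {-1..1} \<Longrightarrow> (f has_vector_derivative f' x) (at x within {-1..1})"
    and cont: "continuous_on {-1..1} f'" and "\<epsilon> > 0"
  shows "\<exists>p. degree p \<le> d \<and> mean_square (\<lambda>x. f x - poly p (of_real x))
    \<le> 4 * mean_square f' / (real d + 1)\<^sup>2 + \<epsilon>"
proof -
  have Re': "((\<lambda>x. Re (f x)) has_real_derivative Re (f' x)) (at x within {-1..1})"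
    and Im': "((\<lambda>x. Im (f x)) has_real_derivative Im (f' x)) (at x within {-1..1})"
    if "x \<in> {-1..1}" for x
    using bounded_linear.has_vector_derivative[OF bounded_linear_Re f'[OF that]]
      bounded_linear.has_vector_derivative[OF bounded_linear_Im f'[OF that]]
    by (auto simp: has_real_derivative_iff_has_vector_derivative)
  have cf: "continuous_on {-1..1} f"
    using f' has_vector_derivative_continuous continuous_on_eq_continuous_within by blast
  obtain p where p: "degree p \<le> d" "integral {-1..1} (\<lambda>x. (Re (f x) - poly p x)\<^sup>2)
      \<le> 4 * integral {-1..1} (\<lambda>x. (Re (f' x))\<^sup>2) / (real d + 1)\<^sup>2 + \<epsilon> / 2"
    using jackson_real[OF Re', of "\<epsilon> / 2" d] cont \<open>\<epsilon> > 0\<close> by (auto intro: continuous_intros)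
  obtain q where q: "degree q \<le> d" "integral {-1..1} (\<lambda>x. (Im (f x) - poly q x)\<^sup>2)
      \<le> 4 * integral {-1..1} (\<lambda>x. (Im (f' x))\<^sup>2) / (real d + 1)\<^sup>2 + \<epsilon> / 2"
    using jackson_real[OF Im', of "\<epsilon> / 2" d] cont \<open>\<epsilon> > 0\<close> by (auto intro: continuous_intros)
  define r :: "complex poly" where "r = map_poly of_real p + smult \<i> (map_poly of_real q)"
  have "degree r \<le> d"
    unfolding r_def using p(1) q(1)
    by (intro degree_add_le order.trans[OF degree_smult_le] order.trans[OF degree_map_poly_of_real_le]) auto
  have r: "(cmod (f x - poly r (of_real x)))\<^sup>2 = (Re (f x) - poly p x)\<^sup>2 + (Im (f x) - poly q x)\<^sup>2" for x
    by (simp add: r_def poly_map_of_real cmod_power2)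
  have "mean_square (\<lambda>x. f x - poly r (of_real x)) =
      integral {-1..1} (\<lambda>x. (Re (f x) - poly p x)\<^sup>2) + integral {-1..1} (\<lambda>x. (Im (f x) - poly q x)\<^sup>2)"
    unfolding r by (intro integral_add integrable_continuous_interval continuous_intros cf)
  also have "\<dots> \<le> 4 * (integral {-1..1} (\<lambda>x. (Re (f' x))\<^sup>2) + integral {-1..1} (\<lambda>x. (Im (f' x))\<^sup>2))
      / (real d + 1)\<^sup>2 + \<epsilon>"
    using p(2) q(2) by (simp add: distrib_left add_divide_distrib)
  also have "integral {-1..1} (\<lambda>x. (Re (f' x))\<^sup>2) + integral {-1..1} (\<lambda>x. (Im (f' x))\<^sup>2) =
      mean_square f'"
    unfolding cmod_power2
    by (intro integral_add[symmetric] integrable_continuous_interval continuous_intros cont)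
  finally show ?thesis using \<open>degree r \<le> d\<close> by blast
qed

section \<open>Functions with bounded weighted derivatives\<close>

text \<open>
  Iterated differentiation along the vector field \<open>w d/dx\<close>: the functions \<open>f, (w D) f, \<dots>, (w D)\<^sup>n f\<close>
  exist and are bounded by \<open>A\<close> on \<open>S\<close>.  A constant weight \<open>c\<close> encodes bounds \<open>A / c\<^sup>j\<close> on ordinary
  derivatives, the weight \<open>x - t\<close> encodes bounds \<open>O(\<bar>x - t\<bar>^(-j))\<close>.  Derivatives are taken within \<open>S\<close>,
  so closed intervals are admitted as domains.
\<close>

fun symbol_bound :: "nat \<Rightarrow> real set \<Rightarrow> (real \<Rightarrow> real) \<Rightarrow> real \<Rightarrow> (real \<Rightarrow> 'a::real_normed_vector) \<Rightarrow> bool" where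
  "symbol_bound 0 S w A f \<longleftrightarrow> continuous_on S f \<and> (\<forall>x\<in>S. norm (f x) \<le> A)"
| "symbol_bound (Suc n) S w A f \<longleftrightarrow> (\<forall>x\<in>S. norm (f x) \<le> A) \<and>
     (\<exists>f'. (\<forall>x\<in>S. (f has_vector_derivative f' x) (at x within S)) \<and>
           symbol_bound n S w A (\<lambda>x. w x *\<^sub>R f' x))"

lemma symbol_bound_SucE:
  assumes "symbol_bound (Suc n) S w A f"
  obtains f' where "\<And>x. x \<in> S \<Longrightarrow> (f has_vector_derivative f' x) (at x within S)"
    "symbol_bound n S w A (\<lambda>x. w x *\<^sub>R f' x)"
  using assms by auto

lemma symbol_bound_SucI:
  assumes "symbol_bound n S w A (\<lambda>x. w x *\<^sub>R f' x)"
    "\<And>x. x \<in> S \<Longrightarrow> (f has_vector_derivative f' x) (at x within S)"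
    "\<And>x. x \<in> S \<Longrightarrow> norm (f x) \<le> A"
  shows "symbol_bound (Suc n) S w A f"
  using assms by auto

lemma symbol_bound_norm: "symbol_bound n S w A f \<Longrightarrow> x \<in> S \<Longrightarrow> norm (f x) \<le> A"
  by (cases n) auto

lemma symbol_bound_continuous: "symbol_bound n S w A f \<Longrightarrow> continuous_on S f"
  by (cases n) (auto simp: continuous_on_eq_continuous_within intro: has_vector_derivative_continuous)

lemma symbol_bound_SucD: "symbol_bound (Suc n) S w A f \<Longrightarrow> symbol_bound n S w A f"
proof (induction n arbitrary: f)
  case 0
  then show ?case using symbol_bound_continuous[OF 0] by auto
next
  case (Suc n)
  obtain f' where f': "\<And>x. x \<in> S \<Longrightarrow> (f has_vector_derivative f' x) (at x within S)"
      "symbol_bound (Suc n) S w A (\<lambda>x. w x *\<^sub>R f' x)"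
    using symbol_bound_SucE[OF Suc.prems(1)] by blast
  show ?case
    by (rule symbol_bound_SucI[OF Suc.IH[OF f'(2)] f'(1) symbol_bound_norm[OF Suc.prems(1)]])
qed

lemma symbol_bound_mono_order:
  assumes "symbol_bound n S w A f" "m \<le> n"
  shows "symbol_bound m S w A f"
  using assms(2,1) by (induction rule: dec_induct) (auto dest: symbol_bound_SucD simp del: symbol_bound.simps)

lemma symbol_bound_mono: "symbol_bound n S w A f \<Longrightarrow> A \<le> B \<Longrightarrow> symbol_bound n S w B f"
proof (induction n arbitrary: f)
  case 0
  then show ?case by force
next
  case (Suc n)
  obtain f' where f': "\<And>x. x \<in> S \<Longrightarrow> (f has_vector_derivative f' x) (at x within S)"
      "symbol_bound n S w A (\<lambda>x. w x *\<^sub>R f' x)"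
    using symbol_bound_SucE[OF Suc.prems(1)] by blast
  have "symbol_bound n S w B (\<lambda>x. w x *\<^sub>R f' x)" by (rule Suc.IH[OF f'(2) Suc.prems(2)])
  then show ?case
    by (rule symbol_bound_SucI) (use f'(1) symbol_bound_norm[OF Suc.prems(1)] Suc.prems(2) in \<open>auto intro: order.trans\<close>)
qed

lemma symbol_bound_cong:
  "symbol_bound n S w A f \<Longrightarrow> (\<And>x. x \<in> S \<Longrightarrow> f x = g x) \<Longrightarrow> symbol_bound n S w A g"
proof (induction n arbitrary: f g)
  case 0
  then show ?case by (auto simp: continuous_on_cong[of S S f g])
next
  case (Suc n)
  obtain f' where f': "\<And>x. x \<in> S \<Longrightarrow> (f has_vector_derivative f' x) (at x within S)"
      "symbol_bound n S w A (\<lambda>x. w x *\<^sub>R f' x)"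
    using symbol_bound_SucE[OF Suc.prems(1)] by blast
  have "(g has_vector_derivative f' x) (at x within S)" if "x \<in> S" for x
    using has_vector_derivative_transform[OF that _ f'(1)[OF that], of g] Suc.prems(2) by auto
  moreover have "symbol_bound n S w A (\<lambda>x. w x *\<^sub>R f' x)" by fact
  moreover have "norm (g x) \<le> A" if "x \<in> S" for x
    using symbol_bound_norm[OF Suc.prems(1) that] Suc.prems(2)[OF that] by simp
  ultimately show ?case by (intro symbol_bound_SucI)
qed

lemma symbol_bound_subset:
  "symbol_bound n S w A f \<Longrightarrow> T \<subseteq> S \<Longrightarrow> symbol_bound n T w A f"
proof (induction n arbitrary: f)
  case 0
  then show ?case by (auto intro: continuous_on_subset)
next
  case (Suc n)
  obtain f' where f': "\<And>x. x \<in> S \<Longrightarrow> (f has_vector_derivative f' x) (at x within S)"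
      "symbol_bound n S w A (\<lambda>x. w x *\<^sub>R f' x)"
    using symbol_bound_SucE[OF Suc.prems(1)] by blast
  have "\<And>x. x \<in> T \<Longrightarrow> (f has_vector_derivative f' x) (at x within T)"
    using f'(1) Suc.prems(2) has_vector_derivative_within_subset by blast
  moreover have "norm (f x) \<le> A" if "x \<in> T" for x
    using symbol_bound_norm[OF Suc.prems(1)] that Suc.prems(2) by blast
  ultimately show ?case using Suc.IH[OF f'(2) Suc.prems(2)] by (intro symbol_bound_SucI)
qed

lemma symbol_bound_add:
  "symbol_bound n S w A f \<Longrightarrow> symbol_bound n S w B g \<Longrightarrow> symbol_bound n S w (A + B) (\<lambda>x. f x + g x)"
proof (induction n arbitrary: f g)
  case 0
  then show ?case by (auto intro!: continuous_on_add norm_triangle_le add_mono)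
next
  case (Suc n)
  obtain f' where f': "\<And>x. x \<in> S \<Longrightarrow> (f has_vector_derivative f' x) (at x within S)"
      "symbol_bound n S w A (\<lambda>x. w x *\<^sub>R f' x)"
    using symbol_bound_SucE[OF Suc.prems(1)] by blast
  obtain g' where g': "\<And>x. x \<in> S \<Longrightarrow> (g has_vector_derivative g' x) (at x within S)"
      "symbol_bound n S w B (\<lambda>x. w x *\<^sub>R g' x)"
    using symbol_bound_SucE[OF Suc.prems(2)] by blast
  have "symbol_bound n S w (A + B) (\<lambda>x. w x *\<^sub>R (f' x + g' x))"
    using Suc.IH[OF f'(2) g'(2)] by (simp add: scaleR_add_right)
  moreover have "\<And>x. x \<in> S \<Longrightarrow> ((\<lambda>x. f x + g x) has_vector_derivative f' x + g' x) (at x within S)"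
    using f'(1) g'(1) by (intro has_vector_derivative_add)
  moreover have "\<And>x. x \<in> S \<Longrightarrow> norm (f x + g x) \<le> A + B"
    using symbol_bound_norm[OF Suc.prems(1)] symbol_bound_norm[OF Suc.prems(2)]
    by (intro norm_triangle_le add_mono)
  ultimately show ?case by (rule symbol_bound_SucI)
qed

lemma symbol_bound_linear:
  assumes "bounded_linear h" "\<And>y. norm (h y) \<le> c * norm y" "c \<ge> 0"
  shows "symbol_bound n S w A f \<Longrightarrow> symbol_bound n S w (c * A) (\<lambda>x. h (f x))"
proof (induction n arbitrary: f)
  case 0
  then show ?case
    using bounded_linear.continuous_on[OF assms(1)] assms(3)
    by (auto intro!: order.trans[OF assms(2)] mult_left_mono)
next
  case (Suc n)
  obtain f' where f': "\<And>x. x \<in> S \<Longrightarrow> (f has_vector_derivative f' x) (at x within S)"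
      "symbol_bound n S w A (\<lambda>x. w x *\<^sub>R f' x)"
    using symbol_bound_SucE[OF Suc.prems(1)] by blast
  have "symbol_bound n S w (c * A) (\<lambda>x. w x *\<^sub>R h (f' x))"
    using Suc.IH[OF f'(2)] linear_scale[OF bounded_linear.linear[OF assms(1)]] by simp
  moreover have "\<And>x. x \<in> S \<Longrightarrow> ((\<lambda>x. h (f x)) has_vector_derivative h (f' x)) (at x within S)"
    using f'(1) bounded_linear.has_vector_derivative[OF assms(1)] by blast
  moreover have "\<And>x. x \<in> S \<Longrightarrow> norm (h (f x)) \<le> c * A"
    using symbol_bound_norm[OF Suc.prems(1)] assms(3)
    by (auto intro!: order.trans[OF assms(2)] mult_left_mono)
  ultimately show ?case by (rule symbol_bound_SucI)
qed

lemma symbol_bound_scaleR: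
  "symbol_bound n S w A f \<Longrightarrow> symbol_bound n S w (\<bar>c\<bar> * A) (\<lambda>x. c *\<^sub>R f x)"
  by (rule symbol_bound_linear) (auto intro: bounded_linear_scaleR_right)

text \<open>
  Every application of the Leibniz rule doubles the number of terms, hence the factor \<open>2\<^sup>n\<close>.
\<close>

lemma symbol_bound_bilinear:
  assumes "bounded_bilinear h" "\<And>a b. norm (h a b) \<le> norm a * norm b"
  shows "symbol_bound n S w A f \<Longrightarrow> symbol_bound n S w B g \<Longrightarrow> A \<ge> 0 \<Longrightarrow> B \<ge> 0
    \<Longrightarrow> symbol_bound n S w (2 ^ n * A * B) (\<lambda>x. h (f x) (g x))"
proof (induction n arbitrary: f g)
  case 0
  then show ?case
    by (auto intro!: bounded_bilinear.continuous_on[OF assms(1)] order.trans[OF assms(2)] mult_mono)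
next
  case (Suc n)
  interpret bounded_bilinear h by fact
  obtain f' where f': "\<And>x. x \<in> S \<Longrightarrow> (f has_vector_derivative f' x) (at x within S)"
      "symbol_bound n S w A (\<lambda>x. w x *\<^sub>R f' x)"
    using symbol_bound_SucE[OF Suc.prems(1)] by blast
  obtain g' where g': "\<And>x. x \<in> S \<Longrightarrow> (g has_vector_derivative g' x) (at x within S)"
      "symbol_bound n S w B (\<lambda>x. w x *\<^sub>R g' x)"
    using symbol_bound_SucE[OF Suc.prems(2)] by blast
  have fg: "symbol_bound n S w A f" "symbol_bound n S w B g"
    using Suc.prems symbol_bound_SucD by blast+
  have "symbol_bound n S w (2 ^ n * A * B + 2 ^ n * A * B)
      (\<lambda>x. h (f x) (w x *\<^sub>R g' x) + h (w x *\<^sub>R f' x) (g x))"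
    using Suc.IH[OF fg(1) g'(2)] Suc.IH[OF f'(2) fg(2)] Suc.prems by (intro symbol_bound_add) auto
  moreover have "2 ^ n * A * B + 2 ^ n * A * B = 2 ^ Suc n * A * B" by simp
  ultimately have "symbol_bound n S w (2 ^ Suc n * A * B) (\<lambda>x. w x *\<^sub>R (h (f x) (g' x) + h (f' x) (g x)))"
    by (simp only: scaleR_add_right scaleR_left scaleR_right)
  moreover have "\<And>x. x \<in> S \<Longrightarrow> ((\<lambda>x. h (f x) (g x)) has_vector_derivative
      h (f x) (g' x) + h (f' x) (g x)) (at x within S)"
    using f'(1) g'(1) by (intro has_vector_derivative)
  moreover have "norm (h (f x) (g x)) \<le> 2 ^ Suc n * A * B" if "x \<in> S" for x
  proof -
    have "norm (h (f x) (g x)) \<le> 1 * (A * B)"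
      using symbol_bound_norm[OF Suc.prems(1) that] symbol_bound_norm[OF Suc.prems(2) that] Suc.prems(3)
      by (simp add: order.trans[OF assms(2) mult_mono])
    also have "\<dots> \<le> 2 ^ Suc n * (A * B)"
      using Suc.prems(3,4) by (intro mult_right_mono one_le_power) auto
    finally show ?thesis by (simp add: mult_ac)
  qed
  ultimately show ?case by (rule symbol_bound_SucI)
qed

lemma symbol_bound_mult:
  fixes f g :: "real \<Rightarrow> 'a::real_normed_algebra"
  assumes "symbol_bound n S w A f" "symbol_bound n S w B g" "A \<ge> 0" "B \<ge> 0"
  shows "symbol_bound n S w (2 ^ n * A * B) (\<lambda>x. f x * g x)"
  by (rule symbol_bound_bilinear[OF bounded_bilinear_mult norm_mult_ineq assms])

lemma symbol_bound_scaleR_fun: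
  assumes "symbol_bound n S w A f" "symbol_bound n S w B g" "A \<ge> 0" "B \<ge> 0"
  shows "symbol_bound n S w (2 ^ n * A * B) (\<lambda>x. f x *\<^sub>R g x)"
  by (rule symbol_bound_bilinear[OF bounded_bilinear_scaleR _ assms]) simp

lemma symbol_bound_const: "norm (c::'a::real_normed_vector) \<le> A \<Longrightarrow> symbol_bound n S w A (\<lambda>x. c)"
proof (induction n arbitrary: c)
  case (Suc n)
  have "A \<ge> 0" using Suc.prems norm_ge_zero order.trans by blast
  then have "symbol_bound n S w A (\<lambda>x. w x *\<^sub>R (0::'a))" using Suc.IH[of 0] by simp
  then show ?case by (rule symbol_bound_SucI[where f' = "\<lambda>_. 0"]) (use Suc.prems in auto)
qed simp

lemma symbol_bound_sum:
  assumes "finite I" "\<And>i. i \<in> I \<Longrightarrow> symbol_bound n S w (A i) (f i)"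
  shows "symbol_bound n S w (\<Sum>i\<in>I. A i) (\<lambda>x. \<Sum>i\<in>I. f i x)"
  using assms by (induction rule: finite_induct) (auto intro: symbol_bound_const symbol_bound_add)

text \<open>
  The hypothesis \<open>w\<^sub>1 E' = v (w\<^sub>2 \<circ> E)\<close> says that \<open>E\<close> maps the field \<open>w\<^sub>1 D\<close> to a multiple of the field
  \<open>w\<^sub>2 D\<close>.  Then \<open>(w\<^sub>1 D)(g \<circ> E) = v \<cdot> ((w\<^sub>2 D) g \<circ> E)\<close>, and since \<open>(w\<^sub>2 D) g\<close> satisfies a bound of order
  one less, induction and the product rule give the claim.
\<close>

lemma symbol_bound_compose:
  assumes "\<And>x. x \<in> S \<Longrightarrow> (E has_vector_derivative E' x) (at x within S)"
    and "\<And>x. x \<in> S \<Longrightarrow> E x \<in> T"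
    and "\<And>x. x \<in> S \<Longrightarrow> w\<^sub>1 x * E' x = v x * w\<^sub>2 (E x)"
    and "symbol_bound n S w\<^sub>1 B v" and "B \<ge> 1"
  shows "m \<le> Suc n \<Longrightarrow> symbol_bound m T w\<^sub>2 A g \<Longrightarrow> A \<ge> 0 \<Longrightarrow>
    symbol_bound m S w\<^sub>1 ((2 ^ n * B) ^ m * A) (\<lambda>x. g (E x))"
proof (induction m arbitrary: g)
  case 0
  have "continuous_on S E"
    using assms(1) by (auto simp: continuous_on_eq_continuous_within intro: has_vector_derivative_continuous)
  then show ?case using 0 assms(2)
    by (auto intro: continuous_on_compose2[of T g S E])
next
  case (Suc m)
  obtain g' where g': "\<And>x. x \<in> T \<Longrightarrow> (g has_vector_derivative g' x) (at x within T)"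
      "symbol_bound m T w\<^sub>2 A (\<lambda>x. w\<^sub>2 x *\<^sub>R g' x)"
    using symbol_bound_SucE[OF Suc.prems(2)] by blast
  have "symbol_bound m S w\<^sub>1 (2 ^ m * B * ((2 ^ n * B) ^ m * A)) (\<lambda>x. v x *\<^sub>R (w\<^sub>2 (E x) *\<^sub>R g' (E x)))"
    using Suc.IH[OF _ g'(2)] Suc.prems symbol_bound_mono_order[OF assms(4), of m] assms(5)
    by (intro symbol_bound_scaleR_fun) auto
  then have "symbol_bound m S w\<^sub>1 (2 ^ m * B * ((2 ^ n * B) ^ m * A)) (\<lambda>x. w\<^sub>1 x *\<^sub>R (E' x *\<^sub>R g' (E x)))"
    by (rule symbol_bound_cong) (simp add: assms(3))
  moreover have "2 ^ m * B * ((2 ^ n * B) ^ m * A) \<le> (2 ^ n * B) ^ Suc m * A"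
  proof -
    have "(2::real) ^ m \<le> 2 ^ n" using Suc.prems by (intro power_increasing) auto
    then have "2 ^ m * B * ((2 ^ n * B) ^ m * A) \<le> 2 ^ n * B * ((2 ^ n * B) ^ m * A)"
      using assms(5) Suc.prems by (intro mult_right_mono) auto
    then show ?thesis by (simp add: mult_ac)
  qed
  ultimately have "symbol_bound m S w\<^sub>1 ((2 ^ n * B) ^ Suc m * A) (\<lambda>x. w\<^sub>1 x *\<^sub>R (E' x *\<^sub>R g' (E x)))"
    by (rule symbol_bound_mono)
  moreover have "((\<lambda>x. g (E x)) has_vector_derivative E' x *\<^sub>R g' (E x)) (at x within S)" if "x \<in> S" for x
  proof -
    have "E ` S \<subseteq> T" using assms(2) by auto
    then have "(g has_vector_derivative g' (E x)) (at (E x) within E ` S)"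
      using g'(1)[OF assms(2)[OF that]] has_vector_derivative_within_subset by blast
    then show ?thesis using vector_diff_chain_within[OF assms(1)[OF that], of g] by (simp add: o_def)
  qed
  moreover have "norm (g (E x)) \<le> (2 ^ n * B) ^ Suc m * A" if "x \<in> S" for x
  proof -
    have "1 \<le> 2 ^ n * B" using assms(5) mult_mono[of 1 "2 ^ n" 1 B] by (simp add: one_le_power)
    then have "1 * A \<le> (2 ^ n * B) ^ Suc m * A"
      using Suc.prems by (intro mult_right_mono one_le_power) auto
    then show ?thesis using symbol_bound_norm[OF Suc.prems(2) assms(2)[OF that]] by simp
  qed
  ultimately show ?case by (rule symbol_bound_SucI)
qed

text \<open>
  Induction based on \<open>(w D)(1/f) = - ((w D) f) (1/f)\<^sup>2\<close>.  The bound must be uniform in the set, the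
  weight and the function, since all of them will depend on the wave number.
\<close>

lemma symbol_bound_inverse:
  assumes "c > 0" "A \<ge> 0"
  shows "\<exists>B\<ge>0. \<forall>S w (f :: real \<Rightarrow> real). symbol_bound n S w A f \<longrightarrow> (\<forall>x\<in>S. \<bar>f x\<bar> \<ge> c) \<longrightarrow>
    symbol_bound n S w B (\<lambda>x. inverse (f x))"
proof (induction n)
  case 0
  have "symbol_bound 0 S w (inverse c) (\<lambda>x. inverse (f x))"
    if f: "symbol_bound 0 S w A f" "\<forall>x\<in>S. \<bar>f x\<bar> \<ge> c" for S w and f :: "real \<Rightarrow> real"
  proof -
    have "norm (inverse (f x)) \<le> inverse c" if "x \<in> S" for x
      using assms(1) f(2) that by (auto simp: abs_inverse intro!: le_imp_inverse_le)
    moreover have "continuous_on S (\<lambda>x. inverse (f x))"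
      using f assms(1) by (intro continuous_on_inverse) force+
    ultimately show ?thesis by auto
  qed
  then show ?case using assms(1) by (intro exI[of _ "inverse c"]) (simp del: symbol_bound.simps)
next
  case (Suc n)
  then obtain B where B: "B \<ge> 0" "\<And>S w f. symbol_bound n S w A f \<Longrightarrow> (\<forall>x\<in>S. \<bar>f x\<bar> \<ge> c) \<Longrightarrow>
      symbol_bound n S w B (\<lambda>x. inverse (f x :: real))" by blast
  let ?B = "\<bar>-1\<bar> * (2 ^ n * A * (2 ^ n * B * B))"
  have "symbol_bound (Suc n) S w (?B + B) (\<lambda>x. inverse (f x))"
    if f: "symbol_bound (Suc n) S w A f" "\<forall>x\<in>S. \<bar>f x\<bar> \<ge> c" for S w and f :: "real \<Rightarrow> real"
  proof -
    note inv = B(2)[OF symbol_bound_SucD[OF f(1)] f(2)]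
    obtain f' where f': "\<And>x. x \<in> S \<Longrightarrow> (f has_vector_derivative f' x) (at x within S)"
        "symbol_bound n S w A (\<lambda>x. w x *\<^sub>R f' x)"
      using symbol_bound_SucE[OF f(1)] by blast
    have "symbol_bound n S w ?B (\<lambda>x. (-1) *\<^sub>R ((w x *\<^sub>R f' x) * (inverse (f x) * inverse (f x))))"
      using B(1) assms(2) by (intro symbol_bound_scaleR symbol_bound_mult f'(2) inv) auto
    then have "symbol_bound n S w ?B (\<lambda>x. w x *\<^sub>R (- (inverse (f x) * f' x * inverse (f x))))"
      by (rule symbol_bound_cong) (simp add: mult_ac)
    then have "symbol_bound n S w (?B + B) (\<lambda>x. w x *\<^sub>R (- (inverse (f x) * f' x * inverse (f x))))"
      by (rule symbol_bound_mono) (use B in auto)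
    then show ?thesis
    proof (rule symbol_bound_SucI)
      fix x assume x: "x \<in> S"
      then show "((\<lambda>x. inverse (f x)) has_vector_derivative - (inverse (f x) * f' x * inverse (f x)))
          (at x within S)"
        using DERIV_inverse'[of f "f' x" x S] f'(1)[OF x] assms(1) f(2)
        by (force simp: has_real_derivative_iff_has_vector_derivative)
      show "norm (inverse (f x)) \<le> ?B + B"
        using symbol_bound_norm[OF inv x] B(1) assms(2) by (simp add: add_increasing)
    qed
  qed
  moreover have "?B + B \<ge> 0" using B(1) assms(2) by simp
  ultimately show ?case by blast
qed

section \<open>Approximation rates for differentiable functions\<close>

lemma integral_cmod_square_le:
  fixes g :: "real \<Rightarrow> complex"
  assumes "continuous_on {-1..1} g" "\<And>x. x \<in> {-1..1} \<Longrightarrow> cmod (g x) \<le> A"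
  shows "mean_square g \<le> 2 * A\<^sup>2"
proof (rule has_integral_le[OF integrable_integral])
  show "((\<lambda>x::real. A\<^sup>2) has_integral 2 * A\<^sup>2) {-1..1}"
    using has_integral_const_real[of "A\<^sup>2" "-1" 1] by simp
  show "(\<lambda>x. (cmod (g x))\<^sup>2) integrable_on {-1..1}"
    using assms(1) by (intro integrable_continuous_interval continuous_intros)
qed (use assms(2) in \<open>auto intro!: power_mono\<close>)

text \<open>
  Let \<open>q\<close> be an approximation of \<open>c f'\<close> of degree at most \<open>d - 1\<close>, and \<open>Q\<close> an antiderivative of
  \<open>q/c\<close>.  The derivative of \<open>f - Q\<close> is as small as the induction hypothesis says, and \<open>f - Q\<close> is
  approximated by one more application of \<open>jackson_complex\<close>.
\<close>

lemma jackson_iterated: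
  fixes f :: "real \<Rightarrow> complex"
  assumes "symbol_bound n {-1..1} (\<lambda>_. c) A f" "c > 0" "n \<le> d + 1" "\<epsilon> > 0"
  shows "\<exists>p. degree p \<le> d \<and> mean_square (\<lambda>x. f x - poly p (of_real x))
    \<le> 2 * (A * (2 / c) ^ n / (\<Prod>i<n. real d + 1 - real i))\<^sup>2 + \<epsilon>"
  using assms(1,3,4)
proof (induction n arbitrary: f d \<epsilon>)
  case 0
  have "mean_square f \<le> 2 * A\<^sup>2"
    using symbol_bound_continuous[OF 0(1)] symbol_bound_norm[OF 0(1)] by (rule integral_cmod_square_le)
  then show ?case using 0 by (intro exI[of _ 0]) auto
next
  case (Suc n)
  obtain f' where f': "\<And>x. x \<in> {-1..1} \<Longrightarrow> (f has_vector_derivative f' x) (at x within {-1..1})"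
    "symbol_bound n {-1..1} (\<lambda>_. c) A (\<lambda>x. c *\<^sub>R f' x)"
    using symbol_bound_SucE[OF Suc.prems(1)] by blast
  have cont: "continuous_on {-1..1} f'"
    using continuous_on_scaleR[OF continuous_on_const symbol_bound_continuous[OF f'(2)], of "inverse c"] \<open>c > 0\<close>
    by simp
  \<comment> \<open>The error \<open>\<epsilon>'\<close> reappears with the factor \<open>4/c\<^sup>2\<close>, that is, as \<open>\<epsilon>/2\<close>.\<close>
  define \<epsilon>' where "\<epsilon>' = c\<^sup>2 * \<epsilon> / 8"
  have \<epsilon>': "\<epsilon>' > 0" using Suc.prems \<open>c > 0\<close> by (simp add: \<epsilon>'_def)
  define B where "B = A * (2 / c) ^ n / (\<Prod>i<n. real d - real i)"
  obtain q Q where q: "degree Q \<le> d" "pderiv Q = q"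
      "mean_square (\<lambda>x. c *\<^sub>R f' x - of_real c * poly q (of_real x)) \<le> 2 * B\<^sup>2 + \<epsilon>'"
  proof (cases "d = 0")
    case True
    then have "n = 0" using Suc.prems by simp
    have "mean_square (\<lambda>x. c *\<^sub>R f' x) \<le> 2 * A\<^sup>2"
      using symbol_bound_continuous[OF f'(2)] symbol_bound_norm[OF f'(2)] by (rule integral_cmod_square_le)
    then have "mean_square (\<lambda>x. c *\<^sub>R f' x) \<le> 2 * B\<^sup>2 + \<epsilon>'" using \<open>n = 0\<close> \<epsilon>' by (simp add: B_def)
    then show thesis by (intro that[of 0 0]) auto
  next
    case False
    then obtain r where r: "degree r \<le> d - 1"
      "mean_square (\<lambda>x. c *\<^sub>R f' x - poly r (of_real x))
        \<le> 2 * (A * (2 / c) ^ n / (\<Prod>i<n. real (d - 1) + 1 - real i))\<^sup>2 + \<epsilon>'"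
      using Suc.IH[OF f'(2) _ \<epsilon>', of "d - 1"] Suc.prems by auto
    obtain Q where Q: "pderiv Q = smult (inverse (of_real c)) r" "degree Q \<le> Suc (degree (smult (inverse (of_real c)) r))"
      using poly_antiderivative by blast
    have "degree Q \<le> d" using Q(2) r(1) False \<open>c > 0\<close> by simp
    moreover have "mean_square (\<lambda>x. c *\<^sub>R f' x - of_real c * poly (smult (inverse (of_real c)) r) (of_real x)) \<le> 2 * B\<^sup>2 + \<epsilon>'"
    proof -
      have "of_real c * poly (smult (inverse (of_real c)) r) (of_real x) = poly r (of_real x)" for x :: real
        using \<open>c > 0\<close> by simp
      then show ?thesis using r(2) False by (simp only: B_def) (simp add: of_nat_diff)
    qed
    ultimately show thesis using Q(1) by (intro that)
  qed
  have scale: "mean_square (\<lambda>x. c *\<^sub>R f' x - of_real c * poly q (of_real x)) = c\<^sup>2 * mean_square (\<lambda>x. f' x - poly q (of_real x))"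
  proof -
    have "(cmod (c *\<^sub>R f' x - of_real c * poly q (of_real x)))\<^sup>2 = c\<^sup>2 * (cmod (f' x - poly q (of_real x)))\<^sup>2" for x
      using \<open>c > 0\<close> by (simp add: scaleR_conv_of_real right_diff_distrib[symmetric] norm_mult power_mult_distrib)
    then show ?thesis by simp
  qed
  have "\<exists>p. degree p \<le> d \<and> mean_square (\<lambda>x. (f x - poly Q (of_real x)) - poly p (of_real x))
      \<le> 4 * mean_square (\<lambda>x. f' x - poly q (of_real x)) / (real d + 1)\<^sup>2 + \<epsilon> / 2"
  proof (rule jackson_complex)
    fix x :: real assume x: "x \<in> {-1..1}"
    have "((\<lambda>x. poly Q (of_real x)) has_vector_derivative poly q (of_real x)) (at x within {-1..1})"
      using has_vector_derivative_real_field[OF poly_DERIV[of Q "of_real x"]] q(2) by simp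
    then show "((\<lambda>x. f x - poly Q (of_real x)) has_vector_derivative f' x - poly q (of_real x)) (at x within {-1..1})"
      using f'(1)[OF x] by (intro has_vector_derivative_diff)
  qed (use cont Suc.prems in \<open>auto intro!: continuous_intros\<close>)
  then obtain p where p: "degree p \<le> d" "mean_square (\<lambda>x. (f x - poly Q (of_real x)) - poly p (of_real x))
      \<le> 4 * mean_square (\<lambda>x. f' x - poly q (of_real x)) / (real d + 1)\<^sup>2 + \<epsilon> / 2" by blast
  have "mean_square (\<lambda>x. f x - poly (Q + p) (of_real x)) = mean_square (\<lambda>x. (f x - poly Q (of_real x)) - poly p (of_real x))"
    by (simp add: diff_diff_eq)
  also note p(2)
  also have "4 * mean_square (\<lambda>x. f' x - poly q (of_real x)) / (real d + 1)\<^sup>2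
      \<le> 4 * ((2 * B\<^sup>2 + \<epsilon>') / c\<^sup>2) / (real d + 1)\<^sup>2"
    using q(3) \<open>c > 0\<close> unfolding scale
    by (intro divide_right_mono mult_left_mono) (auto simp: le_divide_eq mult_ac)
  also have "\<dots> = 2 * ((2 / c) / (real d + 1) * B)\<^sup>2 + \<epsilon> / 2 / (real d + 1)\<^sup>2"
    using \<open>c > 0\<close> by (simp add: \<epsilon>'_def power_mult_distrib power_divide add_divide_distrib)
  also have "(2 / c) / (real d + 1) * B = A * (2 / c) ^ Suc n / (\<Prod>i<Suc n. real d + 1 - real i)"
    unfolding B_def prod.lessThan_Suc_shift by (simp add: mult_ac)
  also have "\<epsilon> / 2 / (real d + 1)\<^sup>2 \<le> \<epsilon> / 2"
    using Suc.prems one_le_power[of "real d + 1" 2] by (simp add: divide_le_eq mult_le_cancel_left1)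
  finally have "mean_square (\<lambda>x. f x - poly (Q + p) (of_real x))
      \<le> 2 * (A * (2 / c) ^ Suc n / (\<Prod>i<Suc n. real d + 1 - real i))\<^sup>2 + \<epsilon>"
    by simp
  moreover have "degree (Q + p) \<le> d" using q(1) p(1) by (rule degree_add_le)
  ultimately show ?case by blast
qed

text \<open>
  Each factor satisfies \<open>n (d + 1 - i) \<ge> d\<close>; for the smallest one, \<open>i = n - 1\<close>, the two sides differ
  by \<open>(n - 1) (d + 1 - n) + 1\<close>, which is where \<open>n \<le> d + 1\<close> enters.
\<close>

lemma prod_falling_lower_bound:
  assumes "n \<le> d + 1"
  shows "real d ^ n \<le> real n ^ n * (\<Prod>i<n. real d + 1 - real i)"
proof -
  have "(\<Prod>i<n. real d) \<le> (\<Prod>i<n. real n * (real d + 1 - real i))"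
  proof (intro prod_mono conjI)
    fix i assume i: "i \<in> {..<n}"
    have "0 \<le> (real n - 1) * (real d + 1 - real n)"
      using assms i by (intro mult_nonneg_nonneg) auto
    then have "real d \<le> real n * (real d + 2 - real n)" by (simp add: algebra_simps)
    also have "\<dots> \<le> real n * (real d + 1 - real i)" using i by (intro mult_left_mono) auto
    finally show "real d \<le> real n * (real d + 1 - real i)" .
  qed simp
  then show ?thesis by (simp add: prod.distrib)
qed

lemma jackson_symbol_bound:
  fixes f :: "real \<Rightarrow> complex"
  assumes "symbol_bound n {-1..1} (\<lambda>_. c) A f" "c > 0" "A > 0" "n \<le> d + 1" "d \<ge> 1"
  shows "\<exists>p. degree p \<le> d \<and> mean_square (\<lambda>x. f x - poly p (of_real x))
    \<le> 3 * (A * (2 * real n / (c * real d)) ^ n)\<^sup>2"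
proof -
  let ?P = "\<Prod>i<n. real d + 1 - real i"
  let ?B = "A * (2 * real n / (c * real d)) ^ n"
  have B: "?B > 0" using assms by (cases "n = 0") auto
  obtain p where p: "degree p \<le> d" "mean_square (\<lambda>x. f x - poly p (of_real x))
    \<le> 2 * (A * (2 / c) ^ n / ?P)\<^sup>2 + ?B\<^sup>2"
    using jackson_iterated[OF assms(1,2,4) zero_less_power[OF B]] by blast
  have P: "?P > 0" using assms(4) by (intro prod_pos) auto
  have "A * (2 / c) ^ n / ?P \<le> A * (2 / c) ^ n * (real n ^ n / real d ^ n)"
    using prod_falling_lower_bound[OF assms(4)] P assms
    by (subst divide_inverse, intro mult_left_mono) (auto simp: field_simps)
  also have "\<dots> = ?B" by (simp add: power_divide power_mult_distrib)
  finally have "(A * (2 / c) ^ n / ?P)\<^sup>2 \<le> ?B\<^sup>2"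
    using P assms(2,3) by (intro power_mono) auto
  then show ?thesis using p by (intro exI[of _ p]) simp
qed

section \<open>Simple zeros and profile functions\<close>

lemma symbol_bound_const_weight:
  assumes "\<And>j x. x \<in> S \<Longrightarrow> (h j has_vector_derivative h (Suc j) x) (at x within S)"
    and "\<And>j x. j \<le> n \<Longrightarrow> x \<in> S \<Longrightarrow> norm (h j x) \<le> A"
  shows "symbol_bound n S (\<lambda>_. 1) A (h 0)"
proof -
  have "symbol_bound m S (\<lambda>_. 1) A (h i)" if "i + m \<le> n" for i m
    using that
  proof (induction m arbitrary: i)
    case 0
    have "continuous_on S (h i)"
      using assms(1) has_vector_derivative_continuous continuous_on_eq_continuous_within by blast
    then show ?case using 0 assms(2) by auto
  next
    case (Suc m)
    have "symbol_bound m S (\<lambda>_. 1) A (\<lambda>x. 1 *\<^sub>R h (Suc i) x)" using Suc.IH[of "Suc i"] Suc.prems by simp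
    then show ?case by (rule symbol_bound_SucI) (use assms Suc.prems in auto)
  qed
  from this[of 0 n] show ?thesis by simp
qed

text \<open>
  The composition rule for the identity map: ordinary derivatives may be replaced by derivatives
  along any field whose coefficient is itself well behaved.
\<close>

lemma symbol_bound_change_weight:
  assumes "symbol_bound n S (\<lambda>_. 1) A f" "symbol_bound n S w W w" "W \<ge> 1" "A \<ge> 0"
  shows "symbol_bound n S w ((2 ^ n * W) ^ n * A) f"
  by (rule symbol_bound_compose[where E = "\<lambda>x. x" and E' = "\<lambda>_. 1" and T = S and w\<^sub>2 = "\<lambda>_. 1" and v = w])
    (use assms in auto)

text \<open>
  The function \<open>s - t\<close> is an eigenfunction of \<open>(s - t) d/ds\<close>.
\<close>

lemma symbol_bound_weight_affine:
  assumes "\<And>x. x \<in> S \<Longrightarrow> \<bar>x - t\<bar> \<le> W"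
  shows "symbol_bound n S (\<lambda>s. s - t) W (\<lambda>s. s - t)"
proof (induction n)
  case 0
  then show ?case using assms by (auto intro!: continuous_intros)
next
  case (Suc n)
  have "symbol_bound n S (\<lambda>s. s - t) W (\<lambda>s. (s - t) *\<^sub>R (1::real))" using Suc by simp
  then show ?case
    by (rule symbol_bound_SucI) (use assms in \<open>auto intro!: derivative_eq_intros\<close>)
qed

lemma smooth_funpow_vderiv: "smooth f \<Longrightarrow> smooth ((vderiv ^^ p) f)"
  unfolding smooth_def by (metis comp_apply funpow_add)

lemma smooth_has_vector_derivative:
  "smooth f \<Longrightarrow> ((vderiv ^^ n) f has_vector_derivative (vderiv ^^ Suc n) f x) (at x within S)"
  unfolding smooth_def
  by (auto simp: vderiv_def[of "(vderiv ^^ n) f"] vector_derivative_works[symmetric]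
      intro: has_vector_derivative_at_within)

lemma smooth_continuous_on: "smooth f \<Longrightarrow> continuous_on S f"
  using smooth_has_vector_derivative[of f 0] has_vector_derivative_continuous
  by (fastforce simp: continuous_on_eq_continuous_within)

lemma smooth_symbol_bound:
  assumes "smooth f" "compact S"
  shows "\<exists>A\<ge>0. symbol_bound n S (\<lambda>_. 1) A f"
proof -
  have "\<exists>A. \<forall>x\<in>S. norm ((vderiv ^^ j) f x) \<le> A" for j
  proof -
    have "compact ((vderiv ^^ j) f ` S)"
      using assms smooth_continuous_on[OF smooth_funpow_vderiv] by (intro compact_continuous_image)
    then show ?thesis using compact_imp_bounded by (fastforce simp: bounded_iff)
  qed
  then obtain A where A: "\<And>j x. x \<in> S \<Longrightarrow> norm ((vderiv ^^ j) f x) \<le> A j" by metis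
  have "symbol_bound n S (\<lambda>_. 1) (\<Sum>j\<le>n. \<bar>A j\<bar>) ((vderiv ^^ 0) f)"
  proof (rule symbol_bound_const_weight)
    fix j x assume "j \<le> n" "x \<in> S"
    have "norm ((vderiv ^^ j) f x) \<le> \<bar>A j\<bar>" using A[OF \<open>x \<in> S\<close>, of j] by simp
    also have "\<dots> \<le> (\<Sum>j\<le>n. \<bar>A j\<bar>)" using \<open>j \<le> n\<close> by (intro member_le_sum) auto
    finally show "norm ((vderiv ^^ j) f x) \<le> (\<Sum>j\<le>n. \<bar>A j\<bar>)" .
  qed (use smooth_has_vector_derivative[OF assms(1)] in auto)
  then show ?thesis by (intro exI[of _ "\<Sum>j\<le>n. \<bar>A j\<bar>"]) (auto intro: sum_nonneg)
qed

text \<open>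
  The quotient extends continuously to \<open>t\<close> by the nonzero value \<open>Z'(t)\<close>.
\<close>

lemma simple_zero_quotient_bounds:
  fixes Z :: "real \<Rightarrow> real"
  assumes "smooth Z" "Z t = 0" "vderiv Z t \<noteq> 0" "compact T" "\<And>s. s \<in> T \<Longrightarrow> s \<noteq> t \<Longrightarrow> Z s \<noteq> 0"
  shows "\<exists>c C. c > 0 \<and> (\<forall>s\<in>T - {t}. c \<le> \<bar>Z s / (s - t)\<bar> \<and> \<bar>Z s / (s - t)\<bar> \<le> C)"
proof (cases "T = {}")
  case False
  define Q where "Q s = (if s = t then vderiv Z t else Z s / (s - t))" for s
  have cont: "continuous_on T Q"
    unfolding continuous_on_eq_continuous_within
  proof
    fix s assume "s \<in> T"
    show "continuous (at s within T) Q"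
    proof (cases "s = t")
      case True
      have "(Z has_field_derivative vderiv Z t) (at t within T)"
        using smooth_has_vector_derivative[OF assms(1), of 0 t T]
        by (simp add: has_real_derivative_iff_has_vector_derivative)
      then have "((\<lambda>s. Z s / (s - t)) \<longlongrightarrow> vderiv Z t) (at t within T)"
        using assms(2) by (simp add: has_field_derivative_iff)
      then have "(Q \<longlongrightarrow> vderiv Z t) (at t within T)"
        by (rule Lim_transform_eventually) (simp add: Q_def eventually_at_filter)
      then show ?thesis using True by (simp add: continuous_within Q_def)
    next
      case False
      have "isCont Z s"
        using smooth_continuous_on[OF assms(1), of UNIV] by (simp add: continuous_on_eq_continuous_at)
      then have "isCont (\<lambda>s. Z s / (s - t)) s" using False by (intro isCont_divide continuous_intros) auto
      then have "continuous (at s within T) (\<lambda>s. Z s / (s - t))"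
        by (rule continuous_at_imp_continuous_at_within)
      then show ?thesis
      proof (rule continuous_transform_within[where \<delta> = "\<bar>s - t\<bar>"])
        show "Z s' / (s' - t) = Q s'" if "dist s' s < \<bar>s - t\<bar>" for s'
          using that by (auto simp: Q_def dist_real_def)
      qed (use False \<open>s \<in> T\<close> in auto)
    qed
  qed
  have nz: "Q s \<noteq> 0" if "s \<in> T" for s using assms(3,5) that by (auto simp: Q_def)
  have cont': "continuous_on T (\<lambda>s. \<bar>Q s\<bar>)" using cont by (intro continuous_intros)
  obtain s1 where s1: "s1 \<in> T" "\<And>s. s \<in> T \<Longrightarrow> \<bar>Q s1\<bar> \<le> \<bar>Q s\<bar>"
    using continuous_attains_inf[OF assms(4) False cont'] by blast
  obtain s2 where s2: "s2 \<in> T" "\<And>s. s \<in> T \<Longrightarrow> \<bar>Q s\<bar> \<le> \<bar>Q s2\<bar>"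
    using continuous_attains_sup[OF assms(4) False cont'] by blast
  have "\<bar>Q s1\<bar> \<le> \<bar>Z s / (s - t)\<bar> \<and> \<bar>Z s / (s - t)\<bar> \<le> \<bar>Q s2\<bar>" if "s \<in> T - {t}" for s
  proof -
    have "Q s = Z s / (s - t)" using that by (simp add: Q_def)
    then show ?thesis using s1(2)[of s] s2(2)[of s] that by simp
  qed
  moreover have "\<bar>Q s1\<bar> > 0" using nz[OF s1(1)] by simp
  ultimately show ?thesis by blast
qed (auto intro: exI[of _ 1])

text \<open>
  The quotient \<open>Q = Z / (s - t)\<close> satisfies \<open>(s - t) Q' = Z' - Q\<close>.  So a bound on \<open>Q\<close> itself bootstraps
  to bounds on all its derivatives along \<open>(s - t) d/ds\<close>, and the function in question is \<open>Z' / Q\<close>.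
  It is the factor by which \<open>s \<mapsto> k^(1/3) Z(s)\<close> transports \<open>(s - t) d/ds\<close> to \<open>\<tau> d/d\<tau>\<close>; it does not
  depend on \<open>k\<close>.
\<close>

lemma simple_zero_logarithmic_derivative:
  fixes Z :: "real \<Rightarrow> real"
  assumes Z: "smooth Z" "Z t = 0" "vderiv Z t \<noteq> 0" and T: "compact T" "\<And>s. s \<in> T \<Longrightarrow> s \<noteq> t \<Longrightarrow> Z s \<noteq> 0"
  shows "\<exists>B\<ge>1. symbol_bound n (T - {t}) (\<lambda>s. s - t) B (\<lambda>s. (s - t) * vderiv Z s / Z s)"
proof -
  let ?S = "T - {t}" and ?w = "\<lambda>s. s - t"
  obtain c C where cC: "c > 0" "\<And>s. s \<in> ?S \<Longrightarrow> c \<le> \<bar>Z s / (s - t)\<bar>" "\<And>s. s \<in> ?S \<Longrightarrow> \<bar>Z s / (s - t)\<bar> \<le> C"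
    using simple_zero_quotient_bounds[OF Z T] by blast
  obtain W where W: "\<And>s. s \<in> T \<Longrightarrow> \<bar>s\<bar> \<le> W"
    using compact_imp_bounded[OF T(1)] by (auto simp: bounded_iff)
  have w: "symbol_bound n ?S ?w (\<bar>W\<bar> + \<bar>t\<bar> + 1) ?w" for n
    using W by (intro symbol_bound_weight_affine) fastforce
  obtain A where A: "\<And>n. A n \<ge> 0" "\<And>n. symbol_bound n ?S ?w (A n) (vderiv Z)"
  proof -
    have "\<exists>A\<ge>0. symbol_bound n ?S ?w A (vderiv Z)" for n
    proof -
      obtain A where "A \<ge> 0" "symbol_bound n T (\<lambda>_. 1) A (vderiv Z)"
        using smooth_symbol_bound[OF _ T(1), of "vderiv Z" n] smooth_funpow_vderiv[OF Z(1), of 1] by auto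
      then show ?thesis
        using symbol_bound_change_weight[OF symbol_bound_subset w, of n T A "vderiv Z"]
        by (intro exI[of _ "(2 ^ n * (\<bar>W\<bar> + \<bar>t\<bar> + 1)) ^ n * A"]) auto
    qed
    then show thesis using that by metis
  qed
  have quotient: "v + (-1) *\<^sub>R (z / u) = u *\<^sub>R ((v * u - z) / u\<^sup>2)" if "u \<noteq> 0" for u v z :: real
    using that by (simp add: field_simps power2_eq_square)
  have Q: "\<exists>B\<ge>0. symbol_bound n ?S ?w B (\<lambda>s. Z s / (s - t))" for n
  proof (induction n)
    case 0
    have "continuous_on ?S (\<lambda>s. Z s / (s - t))"
      using smooth_continuous_on[OF Z(1)] by (intro continuous_intros) auto
    then show ?case using cC by (intro exI[of _ "\<bar>C\<bar>"]) fastforce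
  next
    case (Suc n)
    then obtain B where B: "B \<ge> 0" "symbol_bound n ?S ?w B (\<lambda>s. Z s / (s - t))" by blast
    have "symbol_bound n ?S ?w (A n + \<bar>-1\<bar> * B) (\<lambda>s. vderiv Z s + (-1) *\<^sub>R (Z s / (s - t)))"
      by (intro symbol_bound_add symbol_bound_scaleR A B)
    then have "symbol_bound n ?S ?w (A n + \<bar>-1\<bar> * B) (\<lambda>s. (s - t) *\<^sub>R ((vderiv Z s * (s - t) - Z s) / (s - t)\<^sup>2))"
      by (rule symbol_bound_cong) (rule quotient, simp)
    then have "symbol_bound n ?S ?w (A n + B + \<bar>C\<bar>) (\<lambda>s. (s - t) *\<^sub>R ((vderiv Z s * (s - t) - Z s) / (s - t)\<^sup>2))"
      by (rule symbol_bound_mono) auto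
    then have "symbol_bound (Suc n) ?S ?w (A n + B + \<bar>C\<bar>) (\<lambda>s. Z s / (s - t))"
    proof (rule symbol_bound_SucI)
      fix x assume x: "x \<in> ?S"
      have "(Z has_real_derivative vderiv Z x) (at x within ?S)"
        using smooth_has_vector_derivative[OF Z(1), of 0] by (simp add: has_real_derivative_iff_has_vector_derivative)
      then show "((\<lambda>s. Z s / (s - t)) has_vector_derivative (vderiv Z x * (x - t) - Z x) / (x - t)\<^sup>2) (at x within ?S)"
        unfolding has_real_derivative_iff_has_vector_derivative[symmetric]
        using x by (auto intro!: derivative_eq_intros simp: power2_eq_square)
      show "norm (Z x / (x - t)) \<le> A n + B + \<bar>C\<bar>"
        using cC(3)[OF x] A(1)[of n] B(1) by simp
    qed
    then show ?case using A(1)[of n] B(1) by (intro exI[of _ "A n + B + \<bar>C\<bar>"]) auto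
  qed
  obtain B where B: "B \<ge> 0" "symbol_bound n ?S ?w B (\<lambda>s. Z s / (s - t))" using Q by blast
  obtain U where U: "U \<ge> 0" "symbol_bound n ?S ?w U (\<lambda>s. inverse (Z s / (s - t)))"
    using symbol_bound_inverse[OF cC(1) B(1), of n] B(2) cC(2) by blast
  have "symbol_bound n ?S ?w (2 ^ n * A n * U) (\<lambda>s. vderiv Z s * inverse (Z s / (s - t)))"
    using A U by (intro symbol_bound_mult) auto
  then have "symbol_bound n ?S ?w (2 ^ n * A n * U) (\<lambda>s. (s - t) * vderiv Z s / Z s)"
    by (rule symbol_bound_cong) (auto simp: field_simps)
  then have "symbol_bound n ?S ?w (2 ^ n * A n * U + 1) (\<lambda>s. (s - t) * vderiv Z s / Z s)"
    by (rule symbol_bound_mono) auto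
  then show ?thesis using A(1)[of n] U(1) by (intro exI[of _ "2 ^ n * A n * U + 1"]) auto
qed

text \<open>
  The symbol expansion covers \<open>\<tau> \<ge> 1\<close>, rapid decrease covers \<open>\<tau> \<le> -1\<close>, and compactness the rest.
\<close>

lemma profile_derivative_bounds:
  assumes "smooth \<psi>" "symbol_expansion \<psi> e c" "e \<le> 0" "rapidly_decreasing_at_bot \<psi>" "i \<le> j"
  shows "\<exists>C. \<forall>\<tau>. \<bar>\<tau>\<bar> ^ i * cmod ((vderiv ^^ j) \<psi> \<tau>) \<le> C"
proof -
  let ?f = "\<lambda>\<tau>. \<bar>\<tau>\<bar> ^ i * cmod ((vderiv ^^ j) \<psi> \<tau>)"
  obtain C1 where C1: "\<And>\<tau>. \<tau> \<ge> 1 \<Longrightarrow> cmod ((vderiv ^^ j) \<psi> \<tau>) \<le> C1 * \<tau> powi (e - int j)"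
  proof -
    have "\<exists>C. \<forall>\<tau>\<ge>1. cmod ((vderiv ^^ j) (\<lambda>x. \<psi> x - (\<Sum>j<0. c j * of_real (x powi (e - 3 * int j)))) \<tau>)
       \<le> C * \<tau> powi (e - 3 * int 0 - int j)"
      using assms(2) unfolding symbol_expansion_def by blast
    then show thesis using that by auto
  qed
  obtain C2 where C2: "\<And>\<tau>. \<tau> \<le> -1 \<Longrightarrow> ?f \<tau> \<le> C2"
    using assms(4) unfolding rapidly_decreasing_at_bot_def by blast
  have "compact (?f ` {-1..1})"
    using smooth_continuous_on[OF smooth_funpow_vderiv[OF assms(1)]]
    by (intro compact_continuous_image continuous_intros) auto
  then obtain C3 where C3: "\<And>\<tau>. \<tau> \<in> {-1..1} \<Longrightarrow> ?f \<tau> \<le> C3"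
    using compact_imp_bounded by (fastforce simp: bounded_iff)
  have "?f \<tau> \<le> \<bar>C1\<bar>" if "\<tau> \<ge> 1" for \<tau>
  proof -
    have "?f \<tau> \<le> \<tau> ^ i * (C1 * \<tau> powi (e - int j))"
      using that C1[OF that] by (intro mult_mono) auto
    also have "\<dots> = C1 * \<tau> powi (e - int j + int i)"
      using that by (simp add: power_int_add)
    also have "\<dots> \<le> \<bar>C1\<bar> * 1"
    proof (rule mult_mono)
      have "\<tau> powi (e - int j + int i) \<le> \<tau> powi 0"
        using that assms(3,5) by (intro power_int_increasing) auto
      then show "\<tau> powi (e - int j + int i) \<le> 1" by simp
    qed (use that in auto)
    finally show ?thesis by simp
  qed
  then have "?f \<tau> \<le> \<bar>C1\<bar> + \<bar>C2\<bar> + \<bar>C3\<bar>" for \<tau>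
    using C2[of \<tau>] C3[of \<tau>] by (cases "\<tau> \<ge> 1"; cases "\<tau> \<le> -1") fastforce+
  then show ?thesis by blast
qed

text \<open>
  Induction over all functions \<open>\<tau>\<^sup>i \<psi>^(i)\<close>, with \<open>\<psi>^(i)\<close> the \<open>i\<close>-th derivative, simultaneously, because
  \<open>\<tau> d/d\<tau> (\<tau>\<^sup>i \<psi>^(i)) = i \<tau>\<^sup>i \<psi>^(i) + \<tau>^(i+1) \<psi>^(i+1)\<close>.
\<close>

lemma symbol_bound_euler_weight:
  fixes \<psi> :: "real \<Rightarrow> 'a::real_normed_vector"
  assumes "smooth \<psi>" "\<And>j. \<exists>C. \<forall>\<tau>. \<bar>\<tau>\<bar> ^ j * norm ((vderiv ^^ j) \<psi> \<tau>) \<le> C"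
  shows "\<exists>A\<ge>0. symbol_bound n UNIV (\<lambda>\<tau>. \<tau>) A \<psi>"
proof -
  obtain C where C: "\<And>j \<tau>. \<bar>\<tau>\<bar> ^ j * norm ((vderiv ^^ j) \<psi> \<tau>) \<le> C j" using assms(2) by metis
  have C0: "C j \<ge> 0" for j using C[of 0 j] by (rule order.trans[rotated]) simp
  have "\<exists>A\<ge>0. symbol_bound n UNIV (\<lambda>\<tau>. \<tau>) A (\<lambda>\<tau>. \<tau> ^ i *\<^sub>R (vderiv ^^ i) \<psi> \<tau>)" for i
  proof (induction n arbitrary: i)
    case 0
    show ?case using C C0 smooth_continuous_on[OF smooth_funpow_vderiv[OF assms(1)], of UNIV i]
      by (intro exI[of _ "C i"]) (auto simp: power_abs intro!: continuous_intros)
  next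
    case (Suc n)
    obtain A B where A: "A \<ge> 0" "symbol_bound n UNIV (\<lambda>\<tau>. \<tau>) A (\<lambda>\<tau>. \<tau> ^ i *\<^sub>R (vderiv ^^ i) \<psi> \<tau>)"
      and B: "B \<ge> 0" "symbol_bound n UNIV (\<lambda>\<tau>. \<tau>) B (\<lambda>\<tau>. \<tau> ^ Suc i *\<^sub>R (vderiv ^^ Suc i) \<psi> \<tau>)"
      using Suc.IH by meson
    let ?D = "\<lambda>\<tau>. \<tau> ^ i *\<^sub>R (vderiv ^^ Suc i) \<psi> \<tau> + (real i * \<tau> ^ (i - 1)) *\<^sub>R (vderiv ^^ i) \<psi> \<tau>"
    have "symbol_bound n UNIV (\<lambda>\<tau>. \<tau>) (B + \<bar>real i\<bar> * A)
        (\<lambda>\<tau>. \<tau> ^ Suc i *\<^sub>R (vderiv ^^ Suc i) \<psi> \<tau> + real i *\<^sub>R (\<tau> ^ i *\<^sub>R (vderiv ^^ i) \<psi> \<tau>))"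
      by (intro symbol_bound_add symbol_bound_scaleR A B)
    then have "symbol_bound n UNIV (\<lambda>\<tau>. \<tau>) (B + \<bar>real i\<bar> * A) (\<lambda>\<tau>. \<tau> *\<^sub>R ?D \<tau>)"
      by (rule symbol_bound_cong) (cases i; simp add: scaleR_add_right mult_ac)
    then have "symbol_bound n UNIV (\<lambda>\<tau>. \<tau>) (B + \<bar>real i\<bar> * A + C i) (\<lambda>\<tau>. \<tau> *\<^sub>R ?D \<tau>)"
      by (rule symbol_bound_mono) (use C0 in auto)
    then have "symbol_bound (Suc n) UNIV (\<lambda>\<tau>. \<tau>) (B + \<bar>real i\<bar> * A + C i) (\<lambda>\<tau>. \<tau> ^ i *\<^sub>R (vderiv ^^ i) \<psi> \<tau>)"
    proof (rule symbol_bound_SucI)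
      fix x :: real
      have "((\<lambda>\<tau>. \<tau> ^ i) has_real_derivative real i * x ^ (i - 1)) (at x)"
        by (auto intro!: derivative_eq_intros)
      then show "((\<lambda>\<tau>. \<tau> ^ i *\<^sub>R (vderiv ^^ i) \<psi> \<tau>) has_vector_derivative ?D x) (at x)"
        using has_vector_derivative_scaleR smooth_has_vector_derivative[OF assms(1)] by blast
      show "norm (x ^ i *\<^sub>R (vderiv ^^ i) \<psi> x) \<le> B + \<bar>real i\<bar> * A + C i"
        using C[of x i] A(1) B(1) by (simp add: power_abs add_increasing)
    qed
    then show ?case using A(1) B(1) C0[of i] by (intro exI[of _ "B + \<bar>real i\<bar> * A + C i"]) auto
  qed
  from this[of 0] show ?thesis by simp
qed

section \<open>Galerkin approximation of periodic functions\<close>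

lemma nn_integral_translate:
  fixes f :: "real \<Rightarrow> ennreal"
  assumes [measurable]: "f \<in> borel_measurable borel"
  shows "(\<integral>\<^sup>+s. f s * indicator {a + c..<b + c} s \<partial>lborel) = (\<integral>\<^sup>+s. f (s + c) * indicator {a..<b} s \<partial>lborel)"
proof -
  have "(\<integral>\<^sup>+s. f s * indicator {a + c..<b + c} s \<partial>lborel) =
      (\<integral>\<^sup>+s. f s * indicator {a + c..<b + c} s \<partial>distr lborel borel ((+) c))"
    by (simp add: lborel_distr_plus)
  also have "\<dots> = (\<integral>\<^sup>+s. f (c + s) * indicator {a + c..<b + c} (c + s) \<partial>lborel)"
    by (subst nn_integral_distr) auto
  also have "\<dots> = (\<integral>\<^sup>+s. f (s + c) * indicator {a..<b} s \<partial>lborel)"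
    by (intro nn_integral_cong) (auto simp: add.commute split: split_indicator)
  finally show ?thesis .
qed

lemma nn_integral_Icc_eq_Ico:
  fixes f :: "real \<Rightarrow> ennreal"
  shows "(\<integral>\<^sup>+s. f s * indicator {a..b} s \<partial>lborel) = (\<integral>\<^sup>+s. f s * indicator {a..<b} s \<partial>lborel)"
proof (rule nn_integral_cong_AE)
  show "AE s in lborel. f s * indicator {a..b} s = f s * indicator {a..<b} s"
    using AE_lborel_singleton[of b] by eventually_elim (auto split: split_indicator)
qed

lemma nn_integral_Ico_split:
  fixes f :: "real \<Rightarrow> ennreal"
  assumes [measurable]: "f \<in> borel_measurable borel" and "a \<le> b" "b \<le> c"
  shows "(\<integral>\<^sup>+s. f s * indicator {a..<c} s \<partial>lborel) =
    (\<integral>\<^sup>+s. f s * indicator {a..<b} s \<partial>lborel) + (\<integral>\<^sup>+s. f s * indicator {b..<c} s \<partial>lborel)"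
proof -
  have "(\<integral>\<^sup>+s. f s * indicator {a..<c} s \<partial>lborel) =
      (\<integral>\<^sup>+s. f s * indicator {a..<b} s + f s * indicator {b..<c} s \<partial>lborel)"
    by (intro nn_integral_cong) (use assms in \<open>auto split: split_indicator\<close>)
  then show ?thesis by (simp add: nn_integral_add)
qed

lemma periodic_add_of_int:
  fixes f :: "real \<Rightarrow> 'a"
  assumes "periodic T f"
  shows "f (s + of_int n * T) = f s"
proof -
  have nat: "f (s + of_nat m * T) = f s" for s and m :: nat
  proof (induction m)
    case (Suc m)
    have "f (s + of_nat (Suc m) * T) = f ((s + of_nat m * T) + T)" by (simp add: algebra_simps)
    then show ?case using assms Suc by (simp add: periodic_def)
  qed simp
  show ?thesis
  proof (cases "n \<ge> 0")
    case True
    then show ?thesis using nat[of s "nat n"] by simp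
  next
    case False
    then show ?thesis using nat[of "s + of_int n * T" "nat (- n)"] by simp
  qed
qed

text \<open>
  The period starting at \<open>a\<close> is first moved to one starting at \<open>r \<in> [0, T]\<close>, then cut at \<open>T\<close>; the
  piece beyond \<open>T\<close> is a translate of \<open>[0, r)\<close>.
\<close>

lemma nn_integral_periodic:
  fixes f :: "real \<Rightarrow> ennreal"
  assumes [measurable]: "f \<in> borel_measurable borel" and per: "periodic T f" and "T > 0"
  shows "(\<integral>\<^sup>+s. f s * indicator {a..a + T} s \<partial>lborel) = (\<integral>\<^sup>+s. f s * indicator {0..T} s \<partial>lborel)"
proof -
  define n where "n = \<lfloor>a / T\<rfloor>"
  define r where "r = a - of_int n * T"
  have "of_int n \<le> a / T" "a / T < of_int n + 1" unfolding n_def by linarith+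
  then have r: "0 \<le> r" "r \<le> T" using \<open>T > 0\<close> by (auto simp: r_def field_simps)
  have a: "a = r + of_int n * T" by (simp add: r_def)
  let ?N = "\<lambda>x y. (\<integral>\<^sup>+s. f s * indicator {x..<y} s \<partial>lborel)"
  have shift: "?N (x + of_int m * T) (y + of_int m * T) = ?N x y" for x y m
    using nn_integral_translate[of f x "of_int m * T" y] periodic_add_of_int[OF per] by simp
  have "?N a (a + T) = ?N r (r + T)"
    using shift[of r n "r + T"] by (simp add: a algebra_simps)
  also have "\<dots> = ?N r T + ?N T (r + T)" using r by (intro nn_integral_Ico_split) auto
  also have "?N T (r + T) = ?N 0 r" using shift[of 0 1 r] by simp
  also have "?N r T + ?N 0 r = ?N 0 T"
    using nn_integral_Ico_split[of f 0 r T] r by (simp add: add.commute)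
  finally show ?thesis by (simp add: nn_integral_Icc_eq_Ico)
qed

text \<open>
  Nonnegative integrals are convenient for moving between different periods.
\<close>

lemma L2_iff:
  "f \<in> L2 P \<longleftrightarrow> periodic (2 * P) f \<and> f \<in> borel_measurable borel \<and>
     (\<integral>\<^sup>+s. ennreal ((cmod (f s))\<^sup>2) * indicator {0..2 * P} s \<partial>lborel) < \<infinity>"
proof -
  have "set_integrable lborel {0..2 * P} (\<lambda>s. (cmod (f s))\<^sup>2) \<longleftrightarrow>
      (\<integral>\<^sup>+s. ennreal ((cmod (f s))\<^sup>2) * indicator {0..2 * P} s \<partial>lborel) < \<infinity>"
    if [measurable]: "f \<in> borel_measurable borel"
  proof -
    have "(\<integral>\<^sup>+s. ennreal (norm (indicator {0..2 * P} s *\<^sub>R (cmod (f s))\<^sup>2)) \<partial>lborel) =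
        (\<integral>\<^sup>+s. ennreal ((cmod (f s))\<^sup>2) * indicator {0..2 * P} s \<partial>lborel)"
      by (intro nn_integral_cong) (auto split: split_indicator)
    then show ?thesis unfolding set_integrable_def integrable_iff_bounded by simp
  qed
  then show ?thesis unfolding L2_def by auto
qed

lemma l2norm_nn_integral:
  assumes [measurable]: "f \<in> borel_measurable borel"
  shows "(l2norm P f)\<^sup>2 = enn2real (\<integral>\<^sup>+s. ennreal ((cmod (f s))\<^sup>2) * indicator {0..2 * P} s \<partial>lborel)"
proof -
  have "(LINT s:{0..2 * P}|lborel. (cmod (f s))\<^sup>2) =
      enn2real (\<integral>\<^sup>+s. ennreal (indicator {0..2 * P} s *\<^sub>R (cmod (f s))\<^sup>2) \<partial>lborel)"
    unfolding set_lebesgue_integral_def by (rule integral_eq_nn_integral) auto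
  also have "(\<integral>\<^sup>+s. ennreal (indicator {0..2 * P} s *\<^sub>R (cmod (f s))\<^sup>2) \<partial>lborel) =
        (\<integral>\<^sup>+s. ennreal ((cmod (f s))\<^sup>2) * indicator {0..2 * P} s \<partial>lborel)"
    by (intro nn_integral_cong) (auto split: split_indicator)
  finally show ?thesis unfolding l2norm_def by simp
qed

lemma l2norm_nonneg: "l2norm P f \<ge> 0"
  by (simp add: l2norm_def set_lebesgue_integral_def)

lemma L2_measurable: "f \<in> L2 P \<Longrightarrow> f \<in> borel_measurable borel"
  by (simp add: L2_def)

lemma L2_scale: "f \<in> L2 P \<Longrightarrow> (\<lambda>s. c * f s) \<in> L2 P"
  by (auto simp: L2_def periodic_def norm_mult power_mult_distrib)

lemma cmod_add_square_le: "(cmod (a + b))\<^sup>2 \<le> 2 * (cmod a)\<^sup>2 + 2 * (cmod b)\<^sup>2"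
proof -
  have "(cmod (a + b))\<^sup>2 \<le> (cmod a + cmod b)\<^sup>2"
    by (intro power_mono norm_triangle_ineq) auto
  also have "\<dots> \<le> 2 * (cmod a)\<^sup>2 + 2 * (cmod b)\<^sup>2"
    using zero_le_power2[of "cmod a - cmod b"] by (simp add: power2_eq_square algebra_simps)
  finally show ?thesis .
qed

lemma L2_add:
  assumes "f \<in> L2 P" "g \<in> L2 P"
  shows "(\<lambda>s. f s + g s) \<in> L2 P"
proof -
  note [measurable] = L2_measurable[OF assms(1)] L2_measurable[OF assms(2)]
  have "set_integrable lborel {0..2 * P} (\<lambda>s. (cmod (f s + g s))\<^sup>2)"
  proof (rule set_integrable_bound)
    show "set_integrable lborel {0..2 * P} (\<lambda>s. 2 * (cmod (f s))\<^sup>2 + 2 * (cmod (g s))\<^sup>2)"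
      using assms by (auto simp: L2_def intro!: set_integral_add)
  qed (auto simp: set_borel_measurable_def cmod_add_square_le)
  then show ?thesis using assms by (auto simp: L2_def periodic_def)
qed

lemma L2_diff: "f \<in> L2 P \<Longrightarrow> g \<in> L2 P \<Longrightarrow> (\<lambda>s. f s - g s) \<in> L2 P"
  using L2_add[of f P "\<lambda>s. -1 * g s"] L2_scale[of g P "-1"] by simp

lemma L2_zero: "(\<lambda>s. 0) \<in> L2 P"
  by (auto simp: L2_def periodic_def set_integrable_def)

lemma l2inner_integrable:
  assumes "f \<in> L2 P" "g \<in> L2 P"
  shows "set_integrable lborel {0..2 * P} (\<lambda>s. f s * cnj (g s))"
proof (rule set_integrable_bound)
  note [measurable] = L2_measurable[OF assms(1)] L2_measurable[OF assms(2)]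
  show "set_integrable lborel {0..2 * P} (\<lambda>s. (cmod (f s))\<^sup>2 + (cmod (g s))\<^sup>2)"
    using assms by (auto simp: L2_def intro!: set_integral_add)
  have "cmod a * cmod b \<le> (cmod a)\<^sup>2 + (cmod b)\<^sup>2" for a b
    using zero_le_power2[of "cmod a - cmod b"] mult_nonneg_nonneg[OF norm_ge_zero[of a] norm_ge_zero[of b]]
    unfolding power2_diff by linarith
  then show "AE s in lborel. s \<in> {0..2 * P} \<longrightarrow> norm (f s * cnj (g s)) \<le> norm ((cmod (f s))\<^sup>2 + (cmod (g s))\<^sup>2)"
    by (simp add: norm_mult)
  have [measurable]: "cnj \<in> borel_measurable borel"
    by (intro borel_measurable_continuous_onI continuous_intros)
  show "set_borel_measurable lborel {0..2 * P} (\<lambda>s. f s * cnj (g s))"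
    unfolding set_borel_measurable_def by measurable
qed

lemma l2inner_add_left:
  assumes "f \<in> L2 P" "g \<in> L2 P" "h \<in> L2 P"
  shows "l2inner P (\<lambda>s. f s + g s) h = l2inner P f h + l2inner P g h"
  using l2inner_integrable[OF assms(1,3)] l2inner_integrable[OF assms(2,3)]
  by (simp add: l2inner_def distrib_right set_integral_add)

lemma l2inner_scale_left: "l2inner P (\<lambda>s. c * f s) h = c * l2inner P f h"
  by (simp add: l2inner_def mult.assoc)

lemma l2inner_add_right:
  assumes "f \<in> L2 P" "g \<in> L2 P" "h \<in> L2 P"
  shows "l2inner P h (\<lambda>s. f s + g s) = l2inner P h f + l2inner P h g"
  using l2inner_integrable[OF assms(3,1)] l2inner_integrable[OF assms(3,2)]
  by (simp add: l2inner_def distrib_left set_integral_add)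

lemma l2inner_scale_right: "l2inner P h (\<lambda>s. c * f s) = cnj c * l2inner P h f"
proof -
  have "l2inner P h (\<lambda>s. c * f s) = (LINT s:{0..2 * P}|lborel. cnj c * (h s * cnj (f s)))"
    by (simp add: l2inner_def mult_ac)
  then show ?thesis by (simp add: l2inner_def)
qed

lemma l2inner_cong_AE:
  assumes "f \<in> borel_measurable borel" "f' \<in> borel_measurable borel"
    "g \<in> borel_measurable borel" "g' \<in> borel_measurable borel"
    and "AE s in lborel. s \<in> {0..2 * P} \<longrightarrow> f s = f' s" "AE s in lborel. s \<in> {0..2 * P} \<longrightarrow> g s = g' s"
  shows "l2inner P f g = l2inner P f' g'"
proof -
  note [measurable] = assms(1-4)
  have [measurable]: "cnj \<in> borel_measurable borel"
    by (intro borel_measurable_continuous_onI continuous_intros)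
  show ?thesis unfolding l2inner_def set_lebesgue_integral_def
  proof (rule integral_cong_AE)
    show "AE s in lborel. indicator {0..2 * P} s *\<^sub>R (f s * cnj (g s)) = indicator {0..2 * P} s *\<^sub>R (f' s * cnj (g' s))"
      using assms(5,6) by eventually_elim (auto split: split_indicator)
  qed measurable
qed

lemma l2norm_zero_AE:
  assumes "f \<in> L2 P" "l2norm P f = 0"
  shows "AE s in lborel. s \<in> {0..2 * P} \<longrightarrow> f s = 0"
proof -
  note [measurable] = L2_measurable[OF assms(1)]
  have "(LINT s:{0..2 * P}|lborel. (cmod (f s))\<^sup>2) = 0"
    using assms(2) by (simp add: l2norm_def)
  then have "AE s in lborel. indicator {0..2 * P} s *\<^sub>R (cmod (f s))\<^sup>2 = 0"
    using assms(1) unfolding set_lebesgue_integral_def L2_def set_integrable_def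
    by (subst (asm) integral_nonneg_eq_0_iff_AE) auto
  then show ?thesis by eventually_elim (auto split: split_indicator_asm)
qed

lemma l2inner_null:
  assumes "f \<in> L2 P" "g \<in> L2 P" "l2norm P f = 0"
  shows "l2inner P f g = 0"
proof -
  have "l2inner P f g = l2inner P (\<lambda>s. 0) g"
    by (intro l2inner_cong_AE) (use assms L2_measurable l2norm_zero_AE in auto)
  then show ?thesis by (simp add: l2inner_def)
qed

definition l2_subspace :: "real \<Rightarrow> (real \<Rightarrow> complex) set \<Rightarrow> bool" where
  "l2_subspace P V \<longleftrightarrow> V \<subseteq> L2 P \<and> (\<lambda>s. 0) \<in> V \<and>
     (\<forall>u\<in>V. \<forall>v\<in>V. (\<lambda>s. u s + v s) \<in> V) \<and> (\<forall>u\<in>V. \<forall>c. (\<lambda>s. c * u s) \<in> V)"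

lemma l2_subspaceD:
  assumes "l2_subspace P V"
  shows "u \<in> V \<Longrightarrow> u \<in> L2 P" "(\<lambda>s. 0) \<in> V" "u \<in> V \<Longrightarrow> v \<in> V \<Longrightarrow> (\<lambda>s. u s + v s) \<in> V"
    "u \<in> V \<Longrightarrow> (\<lambda>s. c * u s) \<in> V" "u \<in> V \<Longrightarrow> v \<in> V \<Longrightarrow> (\<lambda>s. u s - v s) \<in> V"
proof -
  show *: "u \<in> V \<Longrightarrow> u \<in> L2 P" "(\<lambda>s. 0) \<in> V" "u \<in> V \<Longrightarrow> v \<in> V \<Longrightarrow> (\<lambda>s. u s + v s) \<in> V"
    "u \<in> V \<Longrightarrow> (\<lambda>s. c * u s) \<in> V" for u v c
    using assms by (auto simp: l2_subspace_def)
  show "u \<in> V \<Longrightarrow> v \<in> V \<Longrightarrow> (\<lambda>s. u s - v s) \<in> V"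
    using *(3)[of u "\<lambda>s. -1 * v s"] *(4)[of v "-1"] by simp
qed

lemma linear_operator_L2: "linear_operator P R \<Longrightarrow> f \<in> L2 P \<Longrightarrow> R f \<in> L2 P"
  by (simp add: linear_operator_def)

lemma l2inner_operator_add:
  assumes "linear_operator P R" "\<mu> \<in> L2 P" "f \<in> L2 P" "g \<in> L2 P"
  shows "l2inner P \<mu> (R (\<lambda>s. f s + g s)) = l2inner P \<mu> (R f) + l2inner P \<mu> (R g)"
proof -
  note R = linear_operator_L2[OF assms(1)]
  have "l2eq (R (\<lambda>s. f s + g s)) (\<lambda>s. R f s + R g s)" using assms by (simp add: linear_operator_def)
  then have "l2inner P \<mu> (R (\<lambda>s. f s + g s)) = l2inner P \<mu> (\<lambda>s. R f s + R g s)"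
    using L2_measurable[OF R[OF L2_add[OF assms(3,4)]]] L2_measurable[OF L2_add[OF R[OF assms(3)] R[OF assms(4)]]]
      L2_measurable[OF assms(2)]
    by (intro l2inner_cong_AE) (auto simp: l2eq_def)
  then show ?thesis using l2inner_add_right R assms by metis
qed

lemma l2inner_operator_scale:
  assumes "linear_operator P R" "\<mu> \<in> L2 P" "f \<in> L2 P"
  shows "l2inner P \<mu> (R (\<lambda>s. c * f s)) = cnj c * l2inner P \<mu> (R f)"
proof -
  note R = linear_operator_L2[OF assms(1)]
  have "l2eq (R (\<lambda>s. c * f s)) (\<lambda>s. c * R f s)" using assms by (simp add: linear_operator_def)
  then have "l2inner P \<mu> (R (\<lambda>s. c * f s)) = l2inner P \<mu> (\<lambda>s. c * R f s)"
    using L2_measurable[OF R[OF L2_scale[OF assms(3)]]] L2_measurable[OF L2_scale[OF R[OF assms(3)]]]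
      L2_measurable[OF assms(2)]
    by (intro l2inner_cong_AE) (auto simp: l2eq_def)
  then show ?thesis by (simp add: l2inner_scale_right)
qed

lemma l2inner_operator_diff:
  assumes "linear_operator P R" "\<mu> \<in> L2 P" "f \<in> L2 P" "g \<in> L2 P"
  shows "l2inner P \<mu> (R (\<lambda>s. f s - g s)) = l2inner P \<mu> (R f) - l2inner P \<mu> (R g)"
  using l2inner_operator_add[OF assms(1-3) L2_scale[OF assms(4), of "-1"]]
    l2inner_operator_scale[OF assms(1,2,4), of "-1"] by simp

lemma l2inner_diff_left:
  assumes "f \<in> L2 P" "g \<in> L2 P" "h \<in> L2 P"
  shows "l2inner P (\<lambda>s. f s - g s) h = l2inner P f h - l2inner P g h"
  using l2inner_add_left[OF assms(1) L2_scale[OF assms(2), of "-1"] assms(3)]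
    l2inner_scale_left[of P "-1" g h] by simp

lemma l2inner_diff_right:
  assumes "f \<in> L2 P" "g \<in> L2 P" "h \<in> L2 P"
  shows "l2inner P h (\<lambda>s. f s - g s) = l2inner P h f - l2inner P h g"
  using l2inner_add_right[OF assms(1) L2_scale[OF assms(2), of "-1"] assms(3)]
    l2inner_scale_right[of P h "-1" g] by simp

text \<open>
  The span is built one generator at a time, as required by the induction in
  \<open>galerkin_solvable_lin_span\<close>.
\<close>

fun lin_span :: "(real \<Rightarrow> complex) list \<Rightarrow> (real \<Rightarrow> complex) set" where
  "lin_span [] = {\<lambda>s. 0}"
| "lin_span (e # es) = {\<lambda>s. v s + a * e s |v a. v \<in> lin_span es}"

lemma lin_span_subspace: "set es \<subseteq> L2 P \<Longrightarrow> l2_subspace P (lin_span es)"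
proof (induction es)
  case Nil
  then show ?case by (simp add: l2_subspace_def L2_zero)
next
  case (Cons e es)
  then have V: "l2_subspace P (lin_span es)" and e: "e \<in> L2 P" by auto
  note V = l2_subspaceD[OF V]
  show ?case unfolding l2_subspace_def
  proof (intro conjI ballI allI)
    show "lin_span (e # es) \<subseteq> L2 P"
      using V(1) L2_scale[OF e] by (auto intro!: L2_add)
    show "(\<lambda>s. 0) \<in> lin_span (e # es)"
      using V(2) by (auto intro!: exI[of _ "\<lambda>s. 0"] exI[of _ 0])
  next
    fix u v assume "u \<in> lin_span (e # es)" "v \<in> lin_span (e # es)"
    then obtain u' v' a b where uv: "u = (\<lambda>s. u' s + a * e s)" "v = (\<lambda>s. v' s + b * e s)"
      "u' \<in> lin_span es" "v' \<in> lin_span es" by auto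
    have "(\<lambda>s. u s + v s) = (\<lambda>s. (u' s + v' s) + (a + b) * e s)"
      unfolding uv by (simp add: algebra_simps)
    then show "(\<lambda>s. u s + v s) \<in> lin_span (e # es)" using V(3)[OF uv(3,4)] by force
  next
    fix u c assume "u \<in> lin_span (e # es)"
    then obtain u' a where u: "u = (\<lambda>s. u' s + a * e s)" "u' \<in> lin_span es" by auto
    have "(\<lambda>s. c * u s) = (\<lambda>s. c * u' s + (c * a) * e s)" unfolding u by (simp add: algebra_simps)
    then show "(\<lambda>s. c * u s) \<in> lin_span (e # es)" using V(4)[OF u(2), of c] by force
  qed
qed

lemma lin_span_subset: "l2_subspace P V \<Longrightarrow> set es \<subseteq> V \<Longrightarrow> lin_span es \<subseteq> V"
proof (induction es)
  case (Cons e es)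
  then show ?case by (auto intro!: l2_subspaceD(3)[OF Cons.prems(1)] l2_subspaceD(4)[OF Cons.prems(1)])
qed (simp add: l2_subspace_def)

lemma lin_span_sum_list: "(\<lambda>s. \<Sum>x\<leftarrow>xs. a x * e x s) \<in> lin_span (map e xs)"
proof (induction xs)
  case (Cons x xs)
  then show ?case by (auto simp: add.commute intro!: exI[of _ "\<lambda>s. \<Sum>x\<leftarrow>xs. a x * e x s"] exI[of _ "a x"])
qed simp

text \<open>
  Let the Galerkin equation be solvable on a subspace and add a function \<open>e\<close>.  Subtracting from \<open>e\<close>
  the solution with right-hand side \<open>R e\<close> yields \<open>e'\<close> such that \<open>R e'\<close> is orthogonal to the subspace.
  Adding a multiple of \<open>e'\<close> to the old solution \<open>v1\<close> thus leaves the old equations intact, and the one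
  new equation is scalar, with coefficient \<open>\<langle>e', R e'\<rangle>\<close>.  By coercivity this vanishes only if \<open>e'\<close> is
  a null function, and then the new equation holds trivially.
\<close>

lemma galerkin_solvable_lin_span:
  assumes R: "linear_operator P R" and coer: "coercive_operator P R c" "c > 0"
  shows "set es \<subseteq> L2 P \<Longrightarrow> g \<in> L2 P \<Longrightarrow>
    \<exists>v\<in>lin_span es. \<forall>\<mu>\<in>lin_span es. l2inner P \<mu> (R v) = l2inner P \<mu> g"
proof (induction es arbitrary: g)
  case Nil
  then show ?case by (simp add: l2inner_def)
next
  case (Cons e es)
  note Radd = l2inner_operator_add[OF R] and Rscale = l2inner_operator_scale[OF R]
    and Rdiff = l2inner_operator_diff[OF R] and RL2 = linear_operator_L2[OF R]
  have e: "e \<in> L2 P" and es: "set es \<subseteq> L2 P" using Cons.prems by auto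
  note V = l2_subspaceD[OF lin_span_subspace[OF es]]
  obtain v0 where v0: "v0 \<in> lin_span es" "\<And>\<mu>. \<mu> \<in> lin_span es \<Longrightarrow> l2inner P \<mu> (R v0) = l2inner P \<mu> (R e)"
    using Cons.IH[OF es RL2[OF e]] by blast
  obtain v1 where v1: "v1 \<in> lin_span es" "\<And>\<mu>. \<mu> \<in> lin_span es \<Longrightarrow> l2inner P \<mu> (R v1) = l2inner P \<mu> g"
    using Cons.IH[OF es Cons.prems(2)] by blast
  define e' where "e' = (\<lambda>s. e s - v0 s)"
  have e': "e' \<in> L2 P" unfolding e'_def using e V(1)[OF v0(1)] by (rule L2_diff)
  define b where "b = (l2inner P e' g - l2inner P e' (R v1)) / l2inner P e' (R e')"
  \<comment> \<open>The inner product is conjugate linear in its second argument.\<close>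
  define v where "v = (\<lambda>s. v1 s + cnj b * e' s)"
  have Rv: "l2inner P \<mu> (R v) = l2inner P \<mu> (R v1) + b * l2inner P \<mu> (R e')" if "\<mu> \<in> L2 P" for \<mu>
    unfolding v_def using Radd[OF that V(1)[OF v1(1)] L2_scale[OF e']] Rscale[OF that e', of "cnj b"] by simp
  have v: "v \<in> lin_span (e # es)"
  proof -
    have "v = (\<lambda>s. (v1 s + (- cnj b) * v0 s) + cnj b * e s)"
      unfolding v_def e'_def by (simp add: algebra_simps)
    then show ?thesis using V(3)[OF v1(1) V(4)[OF v0(1), of "- cnj b"]] by auto
  qed
  have vL2: "v \<in> L2 P" unfolding v_def using V(1)[OF v1(1)] L2_scale[OF e'] by (rule L2_add)
  have on_V: "l2inner P \<mu> (R v) = l2inner P \<mu> g" if "\<mu> \<in> lin_span es" for \<mu>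
  proof -
    have "l2inner P \<mu> (R e') = 0"
      unfolding e'_def using Rdiff[OF V(1)[OF that] e V(1)[OF v0(1)]] v0(2)[OF that] by simp
    then show ?thesis using Rv[OF V(1)[OF that]] v1(2)[OF that] by simp
  qed
  have on_e': "l2inner P e' (R v) = l2inner P e' g"
  proof (cases "l2inner P e' (R e') = 0")
    case True
    have "c * (l2norm P e')\<^sup>2 \<le> 0" using coer(1) e' True unfolding coercive_operator_def by force
    then have "l2norm P e' = 0" using coer(2) by (simp add: mult_le_0_iff)
    then show ?thesis using l2inner_null[OF e' RL2[OF vL2]] l2inner_null[OF e' Cons.prems(2)] by simp
  next
    case False
    then show ?thesis using Rv[OF e'] by (simp add: b_def)
  qed
  have "l2inner P \<mu> (R v) = l2inner P \<mu> g" if \<mu>: "\<mu> \<in> lin_span (e # es)" for \<mu>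
  proof -
    obtain \<mu>' a where \<mu>': "\<mu>' \<in> lin_span es" "\<mu> = (\<lambda>s. \<mu>' s + a * e s)" using \<mu> by auto
    define \<mu>'' where "\<mu>'' = (\<lambda>s. \<mu>' s + a * v0 s)"
    have \<mu>'': "\<mu>'' \<in> lin_span es" unfolding \<mu>''_def using V(3,4) \<mu>' v0 by blast
    have "\<mu> = (\<lambda>s. \<mu>'' s + a * e' s)" unfolding \<mu>' \<mu>''_def e'_def by (simp add: algebra_simps)
    then have "l2inner P \<mu> h = l2inner P \<mu>'' h + a * l2inner P e' h" if "h \<in> L2 P" for h
      using l2inner_add_left[OF V(1)[OF \<mu>''] L2_scale[OF e'] that] by (simp add: l2inner_scale_left)
    then show ?thesis using on_V[OF \<mu>''] on_e' RL2[OF vL2] Cons.prems(2) by simp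
  qed
  then show ?case using v by blast
qed

lemma galerkin_solvable:
  assumes R: "linear_operator P R" and coer: "coercive_operator P R c" "c > 0"
    and V: "l2_subspace P V" and "g \<in> L2 P" "set es \<subseteq> V"
    and span: "\<And>u. u \<in> V \<Longrightarrow> \<exists>u'\<in>lin_span es. AE s in lborel. s \<in> {0..2 * P} \<longrightarrow> u s = u' s"
  shows "\<exists>\<rho>. galerkin_equation P R g V \<rho>"
proof -
  note VD = l2_subspaceD[OF V]
  have es: "set es \<subseteq> L2 P" using assms(6) VD(1) by blast
  obtain v where v: "v \<in> lin_span es" "\<And>\<mu>. \<mu> \<in> lin_span es \<Longrightarrow> l2inner P \<mu> (R v) = l2inner P \<mu> g"
    using galerkin_solvable_lin_span[OF R coer es assms(5)] by blast
  have vV: "v \<in> V" using lin_span_subset[OF V assms(6)] v(1) by blast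
  have "l2inner P \<mu> (R v) = l2inner P \<mu> g" if \<mu>: "\<mu> \<in> V" for \<mu>
  proof -
    obtain \<mu>' where \<mu>': "\<mu>' \<in> lin_span es" "AE s in lborel. s \<in> {0..2 * P} \<longrightarrow> \<mu> s = \<mu>' s"
      using span[OF \<mu>] by blast
    have "\<mu>' \<in> V" using \<mu>'(1) lin_span_subset[OF V assms(6)] by blast
    have "l2inner P \<mu> h = l2inner P \<mu>' h" if "h \<in> L2 P" for h
      by (intro l2inner_cong_AE L2_measurable[OF that] \<mu>'(2) L2_measurable[OF VD(1)[OF \<mu>]]
          L2_measurable[OF VD(1)[OF \<open>\<mu>' \<in> V\<close>]]) auto
    then show ?thesis using v(2)[OF \<mu>'(1)] linear_operator_L2[OF R VD(1)[OF vV]] assms(5) by simp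
  qed
  then show ?thesis using vV unfolding galerkin_equation_def by blast
qed

text \<open>
  Cea's lemma: the error \<open>e\<close> satisfies \<open>\<langle>\<mu>, R e\<rangle> = 0\<close> for all \<open>\<mu> \<in> V\<close>, so in \<open>\<langle>e, R e\<rangle>\<close> the left factor
  may be replaced by the difference of \<open>\<eta> - \<sigma>\<close> and any element of \<open>V\<close>.
\<close>

lemma galerkin_quasi_optimal:
  assumes R: "linear_operator P R" and cont: "continuous_operator P R C" "C > 0"
    and coer: "coercive_operator P R c" "c > 0"
    and V: "l2_subspace P V" and L2: "\<eta> \<in> L2 P" "\<sigma> \<in> L2 P" "f \<in> L2 P" and eq: "l2eq (R \<eta>) f"
    and solvable: "\<exists>\<rho>. galerkin_equation P R (\<lambda>s. f s - R \<sigma> s) V \<rho>"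
    and v: "v \<in> V"
  shows "l2norm P (\<lambda>s. \<eta> s - asymptotic_galerkin P R f V \<sigma> s) \<le> C / c * l2norm P (\<lambda>s. \<eta> s - \<sigma> s - v s)"
proof -
  note VD = l2_subspaceD[OF V] and RL2 = linear_operator_L2[OF R]
  define \<rho>h where "\<rho>h = galerkin_solution P R (\<lambda>s. f s - R \<sigma> s) V"
  have "galerkin_equation P R (\<lambda>s. f s - R \<sigma> s) V \<rho>h"
    unfolding \<rho>h_def galerkin_solution_def using solvable by (rule someI_ex)
  then have \<rho>h: "\<rho>h \<in> V" "\<And>\<mu>. \<mu> \<in> V \<Longrightarrow> l2inner P \<mu> (R \<rho>h) = l2inner P \<mu> (\<lambda>s. f s - R \<sigma> s)"
    by (auto simp: galerkin_equation_def)
  define \<rho> where "\<rho> = (\<lambda>s. \<eta> s - \<sigma> s)"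
  have \<rho>: "\<rho> \<in> L2 P" unfolding \<rho>_def using L2(1,2) by (rule L2_diff)
  define e where "e = (\<lambda>s. \<rho> s - \<rho>h s)"
  have e: "e \<in> L2 P" unfolding e_def using \<rho> VD(1)[OF \<rho>h(1)] by (rule L2_diff)
  have orth: "l2inner P \<mu> (R e) = 0" if "\<mu> \<in> V" for \<mu>
  proof -
    note \<mu> = VD(1)[OF that]
    have "l2inner P \<mu> (R \<eta>) = l2inner P \<mu> f"
      using eq L2_measurable[OF \<mu>] L2_measurable[OF RL2[OF L2(1)]] L2_measurable[OF L2(3)]
      by (intro l2inner_cong_AE) (auto simp: l2eq_def)
    then have "l2inner P \<mu> (R \<rho>) = l2inner P \<mu> (\<lambda>s. f s - R \<sigma> s)"
      unfolding \<rho>_def using l2inner_operator_diff[OF R \<mu> L2(1,2)] l2inner_diff_right[OF L2(3) RL2[OF L2(2)] \<mu>] by simp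
    then show ?thesis
      unfolding e_def using l2inner_operator_diff[OF R \<mu> \<rho> VD(1)[OF \<rho>h(1)]] \<rho>h(2)[OF that] by simp
  qed
  define z where "z = (\<lambda>s. \<rho> s - v s)"
  have z: "z \<in> L2 P" unfolding z_def using \<rho> VD(1)[OF v] by (rule L2_diff)
  have w: "(\<lambda>s. \<rho>h s - v s) \<in> V" using \<rho>h(1) v by (rule VD(5))
  have "e = (\<lambda>s. z s - (\<rho>h s - v s))" by (simp add: e_def z_def)
  then have "l2inner P e (R e) = l2inner P z (R e) - l2inner P (\<lambda>s. \<rho>h s - v s) (R e)"
    using l2inner_diff_left[OF z VD(1)[OF w] RL2[OF e]] by simp
  then have "l2inner P e (R e) = l2inner P z (R e)" using orth[OF w] by simp
  moreover have "c * (l2norm P e)\<^sup>2 \<le> cmod (l2inner P e (R e))"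
    using coer(1) e by (simp add: coercive_operator_def)
  moreover have "cmod (l2inner P z (R e)) \<le> C * l2norm P z * l2norm P e"
    using cont(1) z e by (simp add: continuous_operator_def)
  ultimately have *: "c * (l2norm P e)\<^sup>2 \<le> C * l2norm P z * l2norm P e" by simp
  have "l2norm P e \<le> C / c * l2norm P z"
  proof (cases "l2norm P e = 0")
    case True
    then show ?thesis using cont(2) coer(2) l2norm_nonneg[of P z] by simp
  next
    case False
    then have "l2norm P e > 0" using l2norm_nonneg[of P e] by simp
    then have "c * l2norm P e \<le> C * l2norm P z"
      using * by (simp add: power2_eq_square mult.assoc[symmetric])
    then show ?thesis using coer(2) by (simp add: field_simps)
  qed
  moreover have "(\<lambda>s. \<eta> s - asymptotic_galerkin P R f V \<sigma> s) = e"
    by (simp add: e_def \<rho>_def \<rho>h_def asymptotic_galerkin_def diff_diff_eq)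
  ultimately show ?thesis by (simp only: z_def \<rho>_def)
qed

section \<open>The remainder of the asymptotic expansion\<close>

text \<open>
  For \<open>l \<le> -1\<close> the exponent is \<open>\<vartheta>(p,q,r,l) = (2 (l + 1) - 2 p - 3 q - r) / 3\<close>: the case distinction in
  \<open>\<vartheta>\<close> contributes nothing, since \<open>1 + l - 2 r - p \<le> 0\<close>.
\<close>

lemma finite_indices_beta: "finite (indices_beta \<beta>)"
proof (rule finite_subset)
  show "indices_beta \<beta> \<subseteq> {..\<beta>} \<times> {..\<beta>} \<times> {..\<beta>} \<times> {- int \<beta> - 1..- 1}"
  proof
    fix i :: index assume i: "i \<in> indices_beta \<beta>"
    obtain p q r l where pqrl: "i = (p, q, r, l)" by (cases i) auto
    have l: "l \<le> -1" and th: "theta (p, q, r, l) > - real \<beta> / 3"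
      using i by (auto simp: indices_beta_def indices_def pqrl)
    have "theta (p, q, r, l) = base_exponent (p, q, r, l)"
      using l by (auto simp: theta_def Let_def)
    with l th have "- (1 + 2 * real p + 3 * real q + real r + real_of_int l) / 3 + real_of_int (l + 1) > - real \<beta> / 3"
      by (simp add: base_exponent_def)
    then have "real_of_int (2 * int p + 3 * int q + int r - 2 * (l + 1)) < real_of_int (int \<beta>)"
      by (simp add: field_simps)
    then have "2 * int p + 3 * int q + int r - 2 * (l + 1) < int \<beta>" by (simp only: of_int_less_iff)
    then show "i \<in> {..\<beta>} \<times> {..\<beta>} \<times> {..\<beta>} \<times> {- int \<beta> - 1..- 1}"
      using l by (simp add: pqrl)
  qed
qed simp

lemma base_exponent_le:
  assumes "i \<in> indices" "i \<notin> indices_beta \<beta>"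
  shows "base_exponent i \<le> - real \<beta> / 3"
proof -
  obtain p q r l where pqrl: "i = (p, q, r, l)" by (cases i) auto
  have "base_exponent i \<le> theta i" by (simp add: pqrl theta_def Let_def)
  then show ?thesis using assms by (simp add: indices_beta_def)
qed

lemma vderiv_periodic:
  assumes "periodic T f" "\<And>s. f differentiable (at s)"
  shows "periodic T (vderiv f)"
  unfolding periodic_def
proof
  fix s
  have "(f has_vector_derivative vderiv f (s + T)) (at (s + T))"
    using assms(2) by (simp add: vderiv_def vector_derivative_works[symmetric])
  then have "((f \<circ> (\<lambda>s. s + T)) has_vector_derivative 1 *\<^sub>R vderiv f (s + T)) (at s)"
    by (intro vector_diff_chain_at) (auto intro!: derivative_eq_intros)
  moreover have "f \<circ> (\<lambda>s. s + T) = f" using assms(1) by (auto simp: periodic_def)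
  ultimately have "(f has_vector_derivative vderiv f (s + T)) (at s)" by simp
  then show "vderiv f (s + T) = vderiv f s" by (simp add: vderiv_def vector_derivative_at)
qed

lemma Ds_funpow_partials: "(Ds ^^ n) a \<in> partials a"
  by (induction n) (auto intro: partials.intros)

lemma smooth2_Ds:
  assumes "smooth2 a" "k > 0"
  shows "((\<lambda>s. (Ds ^^ n) a s k) has_vector_derivative (Ds ^^ Suc n) a s k) (at s)"
proof -
  have "(\<lambda>s. (Ds ^^ n) a s k) differentiable (at s)"
    using assms Ds_funpow_partials[of n a] unfolding smooth2_def by blast
  then show ?thesis by (simp add: Ds_def vderiv_def vector_derivative_works[symmetric])
qed

lemma hoermander_periodic:
  assumes "a \<in> hoermander P \<mu> \<rho> \<delta>" "k > 0"
  shows "periodic (2 * P) (\<lambda>s. (Ds ^^ n) a s k)"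
proof (induction n)
  case 0
  then show ?case using assms by (simp add: hoermander_def)
next
  case (Suc n)
  have sm: "smooth2 a" using assms by (simp add: hoermander_def)
  have "periodic (2 * P) (vderiv (\<lambda>s. (Ds ^^ n) a s k))"
    by (rule vderiv_periodic[OF Suc differentiableI_vector[OF smooth2_Ds[OF sm assms(2)]]])
  moreover have "vderiv (\<lambda>s. (Ds ^^ n) a s k) = (\<lambda>s. (Ds ^^ Suc n) a s k)"
    by (simp add: Ds_def)
  ultimately show ?case by simp
qed

lemma periodic_value_in_period:
  fixes f :: "real \<Rightarrow> 'a"
  assumes "periodic T f" "T > 0"
  shows "\<exists>s'\<in>{0..T}. f s = f s'"
proof -
  define m where "m = \<lfloor>s / T\<rfloor>"
  define s' where "s' = s + of_int (- m) * T"
  have "of_int m \<le> s / T" "s / T \<le> of_int m + 1" unfolding m_def by linarith+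
  then have "s' \<in> {0..T}" using assms(2) by (auto simp: s'_def field_simps)
  moreover have "f s' = f s" unfolding s'_def by (rule periodic_add_of_int[OF assms(1)])
  ultimately show ?thesis by (intro bexI[of _ s']) auto
qed

text \<open>
  The defining estimates concern one period; periodicity of all derivatives carries them to any
  subset of the line.
\<close>

lemma hoermander_symbol_bound:
  assumes a: "a \<in> hoermander P \<mu> \<rho> \<delta>" and "P > 0" "\<delta> \<ge> 0" "k\<^sub>0 \<ge> 1"
  shows "\<exists>A\<ge>0. \<forall>k\<ge>k\<^sub>0. symbol_bound n S (\<lambda>_. 1) (A * k powr (\<mu> + \<delta> * real n)) (\<lambda>s. a s k)"
proof -
  have sm: "smooth2 a" using a by (simp add: hoermander_def)
  have "\<exists>C. \<forall>s\<in>{0..2 * P}. \<forall>k\<ge>k\<^sub>0. cmod ((Ds ^^ j) a s k) \<le> C * k powr (\<mu> + \<delta> * real j)" for j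
  proof -
    have "\<forall>n m. \<forall>\<kappa>>0. \<exists>C. \<forall>s\<in>{0..2 * P}. \<forall>k\<ge>\<kappa>.
        cmod ((Ds ^^ n) ((Dk ^^ m) a) s k) \<le> C * k powr (\<mu> + \<delta> * real n - \<rho> * real m)"
      using a by (simp add: hoermander_def)
    from this[rule_format, of k\<^sub>0 j 0] assms(4) show ?thesis by simp
  qed
  then have "\<exists>C. \<forall>j. \<forall>s\<in>{0..2 * P}. \<forall>k\<ge>k\<^sub>0. cmod ((Ds ^^ j) a s k) \<le> C j * k powr (\<mu> + \<delta> * real j)"
    by (intro choice allI)
  then obtain C where C: "\<And>j s k. s \<in> {0..2 * P} \<Longrightarrow> k \<ge> k\<^sub>0 \<Longrightarrow>
      cmod ((Ds ^^ j) a s k) \<le> C j * k powr (\<mu> + \<delta> * real j)" by blast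
  define A where "A = (\<Sum>j\<le>n. \<bar>C j\<bar>)"
  have "symbol_bound n S (\<lambda>_. 1) (A * k powr (\<mu> + \<delta> * real n)) (\<lambda>s. (Ds ^^ 0) a s k)" if k: "k \<ge> k\<^sub>0" for k
  proof (rule symbol_bound_const_weight[where h = "\<lambda>j s. (Ds ^^ j) a s k"])
    fix j s
    show "((\<lambda>s. (Ds ^^ j) a s k) has_vector_derivative (Ds ^^ Suc j) a s k) (at s within S)"
      using smooth2_Ds[OF sm, of k j s] k assms(4) has_vector_derivative_at_within by force
    assume j: "j \<le> n"
    obtain s' where s': "s' \<in> {0..2 * P}" "(Ds ^^ j) a s k = (Ds ^^ j) a s' k"
      using periodic_value_in_period[OF hoermander_periodic[OF a, of k j], of s] k assms(2,4) by auto
    have "cmod ((Ds ^^ j) a s k) \<le> C j * k powr (\<mu> + \<delta> * real j)"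
      using C[OF s'(1) k] s'(2) by simp
    also have "\<dots> \<le> \<bar>C j\<bar> * k powr (\<mu> + \<delta> * real n)"
      using j k assms(3,4) by (intro mult_mono powr_mono add_left_mono mult_left_mono) auto
    also have "\<dots> \<le> A * k powr (\<mu> + \<delta> * real n)"
      using j unfolding A_def by (intro mult_right_mono member_le_sum) auto
    finally show "cmod ((Ds ^^ j) a s k) \<le> A * k powr (\<mu> + \<delta> * real n)" .
  qed
  moreover have "A \<ge> 0" unfolding A_def by (intro sum_nonneg) auto
  ultimately show ?thesis by auto
qed

text \<open>
  Subtract finitely many terms so that the rest lies in \<open>S^(-M)\<close> with \<open>M\<close> so large that \<open>n\<close> derivatives,
  costing \<open>k^(1/3)\<close> each, leave it smaller than \<open>k^(-\<beta>/3)\<close>.  The finitely many terms that were subtracted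
  but do not belong to \<open>\<sigma>\<^sub>\<beta>\<close> have exponents at most \<open>-\<beta>/3\<close> by the definition of \<open>\<F>\<^sub>\<beta>\<close>.
\<close>

lemma remainder_symbol_bound:
  assumes exp: "has_expansion P \<eta> A" and "P > 0" "k\<^sub>0 \<ge> 1"
    and weight: "W \<ge> 1" "\<And>k. k \<ge> k\<^sub>0 \<Longrightarrow> symbol_bound n S (w k) W (w k)"
    and terms: "\<And>i. i \<in> indices \<Longrightarrow> \<exists>C\<ge>0. \<forall>k\<ge>k\<^sub>0. symbol_bound n S (w k) (C * k powr base_exponent i) (\<lambda>s. A i s k)"
  shows "\<exists>C>0. \<forall>k\<ge>k\<^sub>0. symbol_bound n S (w k) (C * k powr (- real \<beta> / 3))
    (\<lambda>s. \<eta> s k - (\<Sum>i\<in>indices_beta \<beta>. A i s k))"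
proof -
  \<comment> \<open>The summand 1 only ensures that \<open>M\<close> is positive.\<close>
  define M where "M = real \<beta> / 3 + real n / 3 + 1"
  have "M > 0" by (simp add: M_def)
  obtain FM where FM: "finite FM" "FM \<subseteq> indices" "\<And>F. finite F \<Longrightarrow> FM \<subseteq> F \<Longrightarrow> F \<subseteq> indices \<Longrightarrow>
      (\<lambda>s k. \<eta> s k - (\<Sum>i\<in>F. A i s k)) \<in> hoermander P (- M) (2/3) (1/3)"
  proof -
    have "\<forall>M>0. \<exists>FM. finite FM \<and> FM \<subseteq> indices \<and> (\<forall>F. finite F \<and> FM \<subseteq> F \<and> F \<subseteq> indices \<longrightarrow>
        (\<lambda>s k. \<eta> s k - (\<Sum>i\<in>F. A i s k)) \<in> hoermander P (- M) (2/3) (1/3))"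
      using exp unfolding has_expansion_def by (rule conjunct2)
    from this[rule_format, OF \<open>M > 0\<close>] show thesis using that by (elim exE conjE) simp
  qed
  let ?G = "FM - indices_beta \<beta>"
  define r where "r = (\<lambda>s k. \<eta> s k - (\<Sum>i\<in>indices_beta \<beta> \<union> FM. A i s k))"
  have "r \<in> hoermander P (- M) (2/3) (1/3)"
    unfolding r_def
  proof (rule FM(3))
    show "indices_beta \<beta> \<union> FM \<subseteq> indices" using FM(2) by (auto simp: indices_beta_def)
  qed (use FM(1) finite_indices_beta in auto)
  then obtain A0 where A0: "A0 \<ge> 0" "\<And>k. k \<ge> k\<^sub>0 \<Longrightarrow>
      symbol_bound n S (\<lambda>_. 1) (A0 * k powr (- M + 1 / 3 * real n)) (\<lambda>s. r s k)"
    using hoermander_symbol_bound[of r P "- M" "2/3" "1/3" k\<^sub>0 n S] assms(2,3) by force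
  have "\<exists>C. \<forall>i\<in>indices. C i \<ge> 0 \<and> (\<forall>k\<ge>k\<^sub>0. symbol_bound n S (w k) (C i * k powr base_exponent i) (\<lambda>s. A i s k))"
    using terms by (intro bchoice) blast
  then obtain C where C: "\<And>i. i \<in> indices \<Longrightarrow> C i \<ge> 0" "\<And>i k. i \<in> indices \<Longrightarrow> k \<ge> k\<^sub>0 \<Longrightarrow>
      symbol_bound n S (w k) (C i * k powr base_exponent i) (\<lambda>s. A i s k)"
    by blast
  define D where "D = (2 ^ n * W) ^ n * A0 + (\<Sum>i\<in>?G. C i) + 1"
  have "symbol_bound n S (w k) (D * k powr (- real \<beta> / 3))
      (\<lambda>s. \<eta> s k - (\<Sum>i\<in>indices_beta \<beta>. A i s k))" if k: "k \<ge> k\<^sub>0" for k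
  proof -
    let ?b = "k powr (- real \<beta> / 3)"
    have "A0 * k powr (- M + 1 / 3 * real n) \<le> A0 * ?b"
      using A0(1) k assms(3) by (intro mult_left_mono powr_mono) (auto simp: M_def)
    then have "symbol_bound n S (\<lambda>_. 1) (A0 * ?b) (\<lambda>s. r s k)"
      by (rule symbol_bound_mono[OF A0(2)[OF k]])
    then have "symbol_bound n S (w k) ((2 ^ n * W) ^ n * (A0 * ?b)) (\<lambda>s. r s k)"
      by (intro symbol_bound_change_weight weight(2)[OF k] weight(1) mult_nonneg_nonneg A0(1)) auto
    moreover have "symbol_bound n S (w k) (\<Sum>i\<in>?G. C i * ?b) (\<lambda>s. \<Sum>i\<in>?G. A i s k)"
    proof (intro symbol_bound_sum)
      fix i assume i: "i \<in> ?G"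
      then have ii: "i \<in> indices" using FM(2) by auto
      have "C i * k powr base_exponent i \<le> C i * ?b"
        using C(1)[OF ii] base_exponent_le[OF ii, of \<beta>] i k assms(3) by (intro mult_left_mono powr_mono) auto
      then show "symbol_bound n S (w k) (C i * ?b) (\<lambda>s. A i s k)"
        by (rule symbol_bound_mono[OF C(2)[OF ii k]])
    qed (use FM in auto)
    ultimately have "symbol_bound n S (w k) ((2 ^ n * W) ^ n * (A0 * ?b) + (\<Sum>i\<in>?G. C i * ?b))
        (\<lambda>s. r s k + (\<Sum>i\<in>?G. A i s k))"
      by (rule symbol_bound_add)
    then have "symbol_bound n S (w k) ((2 ^ n * W) ^ n * (A0 * ?b) + (\<Sum>i\<in>?G. C i * ?b))
        (\<lambda>s. \<eta> s k - (\<Sum>i\<in>indices_beta \<beta>. A i s k))"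
    proof (rule symbol_bound_cong)
      fix s
      have "(\<Sum>i\<in>indices_beta \<beta> \<union> ?G. A i s k) = (\<Sum>i\<in>indices_beta \<beta>. A i s k) + (\<Sum>i\<in>?G. A i s k)"
        using FM(1) finite_indices_beta by (intro sum.union_disjoint) auto
      then show "r s k + (\<Sum>i\<in>?G. A i s k) = \<eta> s k - (\<Sum>i\<in>indices_beta \<beta>. A i s k)"
        by (simp add: r_def)
    qed
    then show ?thesis
    proof (rule symbol_bound_mono)
      have "D * ?b = (2 ^ n * W) ^ n * (A0 * ?b) + (\<Sum>i\<in>?G. C i * ?b) + ?b"
        by (simp add: D_def distrib_right sum_distrib_right mult.assoc)
      then show "(2 ^ n * W) ^ n * (A0 * ?b) + (\<Sum>i\<in>?G. C i * ?b) \<le> D * ?b" by simp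
    qed
  qed
  moreover have "D > 0"
  proof -
    have "(\<Sum>i\<in>?G. C i) \<ge> 0" using C(1) FM(2) by (intro sum_nonneg) blast
    moreover have "(2 ^ n * W) ^ n * A0 \<ge> 0" using A0(1) weight(1) by simp
    ultimately show ?thesis unfolding D_def by linarith
  qed
  ultimately show ?thesis by blast
qed

text \<open>
  Common part of the analysis away from and near the shadow boundary.  The last hypothesis says that
  \<open>s \<mapsto> k^(1/3) Z(s)\<close> transports the field with weight \<open>w k\<close> to \<open>v\<close> times the field with weight \<open>w'\<close> in the
  variable of the profile; \<open>v\<close> is independent of \<open>k\<close>.
\<close>

lemma expansion_term_symbol_bound:
  assumes b: "smooth (b i)" and Z: "smooth Z" and i: "i = (p, q, r, l)"
    and T: "compact T" "S \<subseteq> T" and "k\<^sub>0 \<ge> 1"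
    and weight: "W \<ge> 1" "\<And>k. k \<ge> k\<^sub>0 \<Longrightarrow> symbol_bound n S (w k) W (w k)"
    and \<Psi>: "B \<ge> 0" "symbol_bound n UNIV w' B ((vderiv ^^ p) (\<Psi> r l))"
    and v: "V \<ge> 1" "\<And>k. k \<ge> k\<^sub>0 \<Longrightarrow> symbol_bound n S (w k) V v"
      "\<And>k s. k \<ge> k\<^sub>0 \<Longrightarrow> s \<in> S \<Longrightarrow> w k s * (k powr (1/3) * vderiv Z s) = v s * w' (k powr (1/3) * Z s)"
  shows "\<exists>C\<ge>0. \<forall>k\<ge>k\<^sub>0. symbol_bound n S (w k) (C * k powr base_exponent i) (\<lambda>s. expansion_term b Z \<Psi> i s k)"
proof -
  obtain A where A: "A \<ge> 0" "symbol_bound n T (\<lambda>_. 1) A (b i)"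
    using smooth_symbol_bound[OF b T(1)] by blast
  define C where "C = 2 ^ n * ((2 ^ n * W) ^ n * A) * ((2 ^ n * V) ^ n * B)"
  have "symbol_bound n S (w k) (C * k powr base_exponent i) (\<lambda>s. expansion_term b Z \<Psi> i s k)" if k: "k \<ge> k\<^sub>0" for k
  proof -
    have "symbol_bound n S (w k) ((2 ^ n * V) ^ n * B) (\<lambda>s. (vderiv ^^ p) (\<Psi> r l) (k powr (1/3) * Z s))"
    proof (rule symbol_bound_compose[where w\<^sub>2 = w' and T = UNIV and v = v])
      fix s
      have "(Z has_real_derivative vderiv Z s) (at s within S)"
        using smooth_has_vector_derivative[OF Z, of 0] by (simp add: has_real_derivative_iff_has_vector_derivative)
      then show "((\<lambda>s. k powr (1/3) * Z s) has_vector_derivative k powr (1/3) * vderiv Z s) (at s within S)"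
        unfolding has_real_derivative_iff_has_vector_derivative[symmetric] by (rule DERIV_cmult)
    qed (use \<Psi> v k in auto)
    moreover have "symbol_bound n S (w k) ((2 ^ n * W) ^ n * A) (b i)"
      using symbol_bound_change_weight[OF symbol_bound_subset[OF A(2) T(2)] weight(2)[OF k] weight(1) A(1)] .
    ultimately have "symbol_bound n S (w k) C (\<lambda>s. b i s * (vderiv ^^ p) (\<Psi> r l) (k powr (1/3) * Z s))"
      unfolding C_def using A weight \<Psi> v by (intro symbol_bound_mult) auto
    then have "symbol_bound n S (w k) (\<bar>k powr base_exponent i\<bar> * C)
        (\<lambda>s. k powr base_exponent i *\<^sub>R (b i s * (vderiv ^^ p) (\<Psi> r l) (k powr (1/3) * Z s)))"
      by (rule symbol_bound_scaleR)
    then show ?thesis by (simp add: i expansion_term_def scaleR_conv_of_real mult_ac)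
  qed
  moreover have "C \<ge> 0" unfolding C_def using A weight \<Psi> v by simp
  ultimately show ?thesis by blast
qed

text \<open>
  The weights are \<open>s - t\<^sub>j\<close> on the curve and \<open>\<tau>\<close> in the profile variable.
\<close>

lemma remainder_symbol_bound_away:
  assumes data: "expansion_data P t b Z \<Psi> a" and exp: "has_expansion P \<eta> (expansion_term b Z \<Psi>)"
    and "P > 0" "k\<^sub>0 \<ge> 1" and j: "j \<in> {1, 2}"
    and T: "compact T" "\<And>s. s \<in> T \<Longrightarrow> s \<noteq> t j \<Longrightarrow> Z s \<noteq> 0"
  shows "\<exists>C>0. \<forall>k\<ge>k\<^sub>0. symbol_bound n (T - {t j}) (\<lambda>s. s - t j) (C * k powr (- real \<beta> / 3))
    (\<lambda>s. \<eta> s k - (\<Sum>i\<in>indices_beta \<beta>. expansion_term b Z \<Psi> i s k))"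
proof -
  have Z: "smooth Z" "Z (t j) = 0" "vderiv Z (t j) \<noteq> 0"
    using data j unfolding expansion_data_def by auto
  obtain B where B: "B \<ge> 1" "symbol_bound n (T - {t j}) (\<lambda>s. s - t j) B (\<lambda>s. (s - t j) * vderiv Z s / Z s)"
    using simple_zero_logarithmic_derivative[OF Z T] by blast
  obtain W where W: "\<And>s. s \<in> T \<Longrightarrow> \<bar>s\<bar> \<le> W"
    using compact_imp_bounded[OF T(1)] by (auto simp: bounded_iff)
  have w: "symbol_bound n (T - {t j}) (\<lambda>s. s - t j) (\<bar>W\<bar> + \<bar>t j\<bar> + 1) (\<lambda>s. s - t j)"
    using W by (intro symbol_bound_weight_affine) fastforce
  show ?thesis
  proof (rule remainder_symbol_bound[where w = "\<lambda>_ s. s - t j", OF exp assms(3,4) _ w])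
    fix i assume i: "i \<in> indices"
    obtain p q r l where pqrl: "i = (p, q, r, l)" by (cases i) auto
    have l: "l \<le> -1" using i by (simp add: pqrl indices_def)
    have b: "smooth (b i)" using data i by (simp add: expansion_data_def)
    have \<Psi>: "smooth (\<Psi> r l)" "symbol_expansion (\<Psi> r l) (1 + l - 2 * int r) (a r l)" "rapidly_decreasing_at_bot (\<Psi> r l)"
      using data l by (auto simp: expansion_data_def)
    obtain A where A: "A \<ge> 0" "symbol_bound n UNIV (\<lambda>\<tau>. \<tau>) A ((vderiv ^^ p) (\<Psi> r l))"
    proof -
      have "\<exists>C. \<forall>\<tau>. \<bar>\<tau>\<bar> ^ m * cmod ((vderiv ^^ m) ((vderiv ^^ p) (\<Psi> r l)) \<tau>) \<le> C" for m
        using profile_derivative_bounds[OF \<Psi>(1,2) _ \<Psi>(3), of m "m + p"] l by (simp add: funpow_add)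
      then show thesis
        using that symbol_bound_euler_weight[OF smooth_funpow_vderiv[OF \<Psi>(1)]] by blast
    qed
    show "\<exists>C\<ge>0. \<forall>k\<ge>k\<^sub>0. symbol_bound n (T - {t j}) (\<lambda>s. s - t j) (C * k powr base_exponent i)
        (\<lambda>s. expansion_term b Z \<Psi> i s k)"
    proof (rule expansion_term_symbol_bound[where b = b and i = i and \<Psi> = \<Psi> and w = "\<lambda>_ s. s - t j" and w' = "\<lambda>\<tau>. \<tau>",
          OF b Z(1) pqrl T(1) _ assms(4) _ w A B])
      fix k s assume "s \<in> T - {t j}"
      then show "(s - t j) * (k powr (1/3) * vderiv Z s) = (s - t j) * vderiv Z s / Z s * (k powr (1/3) * Z s)"
        using T(2)[of s] by simp
    qed auto
  qed simp
qed

text \<open>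
  The weights are \<open>k^(-1/3)\<close> on the curve and \<open>1\<close> in the profile variable.
\<close>

lemma remainder_symbol_bound_near:
  assumes data: "expansion_data P t b Z \<Psi> a" and exp: "has_expansion P \<eta> (expansion_term b Z \<Psi>)"
    and "P > 0" "k\<^sub>0 \<ge> 1" and T: "compact T"
  shows "\<exists>C>0. \<forall>k\<ge>k\<^sub>0. symbol_bound n T (\<lambda>_. k powr (-1/3)) (C * k powr (- real \<beta> / 3))
    (\<lambda>s. \<eta> s k - (\<Sum>i\<in>indices_beta \<beta>. expansion_term b Z \<Psi> i s k))"
proof -
  have Z: "smooth Z" using data unfolding expansion_data_def by auto
  have w: "symbol_bound n T (\<lambda>_. k powr (-1/3)) 1 (\<lambda>_. k powr (-1/3))" if "k \<ge> k\<^sub>0" for k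
  proof -
    have "k powr (-1/3) \<le> k powr 0" using that assms(4) by (intro powr_mono) auto
    then show ?thesis using that assms(4) by (intro symbol_bound_const) auto
  qed
  obtain V where V: "V \<ge> 0" "symbol_bound n T (\<lambda>_. 1) V (vderiv Z)"
    using smooth_symbol_bound[OF smooth_funpow_vderiv[OF Z, of 1] T] by auto
  have V': "symbol_bound n T (\<lambda>_. k powr (-1/3)) ((2 ^ n) ^ n * V + 1) (vderiv Z)" if "k \<ge> k\<^sub>0" for k
    using symbol_bound_change_weight[OF V(2) w[OF that] _ V(1)] by (auto intro: symbol_bound_mono)
  show ?thesis
  proof (rule remainder_symbol_bound[where w = "\<lambda>k _. k powr (-1/3)", OF exp assms(3,4) _ w])
    fix i assume i: "i \<in> indices"
    obtain p q r l where pqrl: "i = (p, q, r, l)" by (cases i) auto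
    have l: "l \<le> -1" using i by (simp add: pqrl indices_def)
    have b: "smooth (b i)" using data i by (simp add: expansion_data_def)
    have \<Psi>: "smooth (\<Psi> r l)" "symbol_expansion (\<Psi> r l) (1 + l - 2 * int r) (a r l)" "rapidly_decreasing_at_bot (\<Psi> r l)"
      using data l by (auto simp: expansion_data_def)
    obtain A where A: "A \<ge> 0" "symbol_bound n UNIV (\<lambda>_. 1) A ((vderiv ^^ p) (\<Psi> r l))"
    proof -
      have "\<exists>C. \<forall>\<tau>. cmod ((vderiv ^^ m) ((vderiv ^^ p) (\<Psi> r l)) \<tau>) \<le> C" for m
        using profile_derivative_bounds[OF \<Psi>(1,2) _ \<Psi>(3), of 0 "m + p"] l by (simp add: funpow_add)
      then obtain C where C: "\<And>m \<tau>. cmod ((vderiv ^^ m) ((vderiv ^^ p) (\<Psi> r l)) \<tau>) \<le> C m" by metis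
      have "symbol_bound n UNIV (\<lambda>_. 1) (\<Sum>m\<le>n. \<bar>C m\<bar>) ((vderiv ^^ 0) ((vderiv ^^ p) (\<Psi> r l)))"
      proof (rule symbol_bound_const_weight)
        fix m \<tau> assume "m \<le> n"
        have "cmod ((vderiv ^^ m) ((vderiv ^^ p) (\<Psi> r l)) \<tau>) \<le> \<bar>C m\<bar>" using C[of m \<tau>] by simp
        also have "\<dots> \<le> (\<Sum>m\<le>n. \<bar>C m\<bar>)" using \<open>m \<le> n\<close> by (intro member_le_sum) auto
        finally show "cmod ((vderiv ^^ m) ((vderiv ^^ p) (\<Psi> r l)) \<tau>) \<le> (\<Sum>m\<le>n. \<bar>C m\<bar>)" .
      qed (rule smooth_has_vector_derivative[OF smooth_funpow_vderiv[OF \<Psi>(1)]])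
      then show thesis using that[of "\<Sum>m\<le>n. \<bar>C m\<bar>"] by (simp add: sum_nonneg)
    qed
    show "\<exists>C\<ge>0. \<forall>k\<ge>k\<^sub>0. symbol_bound n T (\<lambda>_. k powr (-1/3)) (C * k powr base_exponent i)
        (\<lambda>s. expansion_term b Z \<Psi> i s k)"
    proof (rule expansion_term_symbol_bound[where b = b and i = i and \<Psi> = \<Psi> and w = "\<lambda>k _. k powr (-1/3)" and w' = "\<lambda>_. 1",
          OF b Z(1) pqrl T(1) _ assms(4) _ w A _ V'])
      fix k s assume "k \<ge> k\<^sub>0"
      then have "k powr (-1/3) * k powr (1/3) = 1" using assms(4) by (simp add: powr_add[symmetric])
      then show "k powr (-1/3) * (k powr (1/3) * vderiv Z s) = vderiv Z s * 1"
        by (simp add: mult.assoc[symmetric])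
    qed (use V in auto)
  qed auto
qed

section \<open>Approximation after a change of variables\<close>

lemma increasing_self_map_interval:
  fixes \<phi> :: "real \<Rightarrow> real"
  assumes "a < b" "\<phi> a = a" "\<phi> b = b" and mono: "strict_mono_on {a..b} \<phi>" and cont: "continuous_on {a..b} \<phi>"
  shows "bij_betw \<phi> {a..b} {a..b}" "continuous_on {a..b} (inv_into {a..b} \<phi>)"
proof -
  have inj: "inj_on \<phi> {a..b}" using mono by (rule strict_mono_on_imp_inj_on)
  have "\<phi> ` {a..b} = {a..b}"
  proof
    show "\<phi> ` {a..b} \<subseteq> {a..b}"
      using strict_mono_on_leD[OF mono] assms(1-3) by force
    show "{a..b} \<subseteq> \<phi> ` {a..b}"
    proof
      fix y assume "y \<in> {a..b}"
      then obtain x where "a \<le> x" "x \<le> b" "\<phi> x = y"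
        using IVT'[of \<phi> a y b] assms(1-3) cont by auto
      then show "y \<in> \<phi> ` {a..b}" by auto
    qed
  qed
  then show bij: "bij_betw \<phi> {a..b} {a..b}" using inj by (simp add: bij_betw_def)
  have "continuous_on (\<phi> ` {a..b}) (inv_into {a..b} \<phi>)"
    by (rule continuous_on_inv[OF cont]) (auto simp: inv_into_f_f[OF inj])
  then show "continuous_on {a..b} (inv_into {a..b} \<phi>)" using bij by (simp add: bij_betw_def)
qed

abbreviation chart_error ::
    "(real \<Rightarrow> complex) \<Rightarrow> real \<Rightarrow> real \<Rightarrow> (real \<Rightarrow> real) \<Rightarrow> complex poly \<Rightarrow> real" where
  "chart_error F a b \<phi> p \<equiv>
     integral {a..b} (\<lambda>s. (cmod (F s - poly p (of_real (inv_into {a..b} \<phi> s))))\<^sup>2)"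

text \<open>
  Approximate \<open>F \<circ> \<phi>\<close>, rescaled to \<open>[-1, 1]\<close>, and transport the polynomial back; the Jacobian
  contributes the factor \<open>D\<close>.
\<close>

lemma polynomial_approximation_change_of_variables:
  fixes F :: "real \<Rightarrow> complex"
  assumes ab: "a < b" and \<phi>: "\<phi> a = a" "\<phi> b = b" "strict_mono_on {a..b} \<phi>"
    and deriv: "\<And>s. s \<in> {a..b} \<Longrightarrow> (\<phi> has_real_derivative \<phi>' s) (at s within {a..b})"
    and D: "\<And>s. s \<in> {a..b} \<Longrightarrow> 0 \<le> \<phi>' s \<and> \<phi>' s \<le> D"
    and F: "continuous_on {a..b} F" and sb: "symbol_bound n {a..b} (\<lambda>_. c) A (\<lambda>s. F (\<phi> s))"
    and "c > 0" "A > 0" "n \<le> d + 1" "d \<ge> 1"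
  shows "\<exists>p. degree p \<le> d \<and> chart_error F a b \<phi> p
    \<le> 3 * D * (b - a) * ((2 ^ n) ^ n * A * (real n * (b - a) / (c * real d)) ^ n)\<^sup>2"
proof -
  define h where "h = (b - a) / 2"
  define m where "m = (a + b) / 2"
  have h: "h > 0" using ab by (simp add: h_def)
  define E where "E = (\<lambda>x. m + h * x)"
  have E: "E x \<in> {a..b}" if "x \<in> {-1..1}" for x
  proof -
    have "h * (-1) \<le> h * x" "h * x \<le> h * 1" using that h mult_left_mono[of "-1" x h] mult_left_mono[of x 1 h] by auto
    then show ?thesis by (auto simp: E_def m_def h_def field_simps)
  qed
  have E': "(E has_real_derivative h) (at x within S)" for x S
    unfolding E_def by (auto intro!: derivative_eq_intros)
  have cont_\<phi>: "continuous_on {a..b} \<phi>"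
    using deriv DERIV_continuous continuous_on_eq_continuous_within by blast
  note inv = increasing_self_map_interval[OF ab \<phi> cont_\<phi>]
  define g where "g = (\<lambda>x. F (\<phi> (E x)))"
  have g: "symbol_bound n {-1..1} (\<lambda>_. c / h) ((2 ^ n * 1) ^ n * A) g"
    unfolding g_def
  proof (rule symbol_bound_compose[where E = E and E' = "\<lambda>_. h" and T = "{a..b}" and w\<^sub>2 = "\<lambda>_. c"
        and v = "\<lambda>_. 1" and g = "\<lambda>s. F (\<phi> s)", OF _ E _ _ _ _ sb])
    show "symbol_bound n {-1..1} (\<lambda>_. c / h) 1 (\<lambda>_. 1::real)" by (rule symbol_bound_const) simp
  qed (use E' h assms in \<open>auto simp: has_real_derivative_iff_has_vector_derivative\<close>)
  have "\<exists>q. degree q \<le> d \<and> mean_square (\<lambda>x. g x - poly q (of_real x))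
    \<le> 3 * ((2 ^ n * 1) ^ n * A * (2 * real n / (c / h * real d)) ^ n)\<^sup>2"
    using jackson_symbol_bound[OF g _ _ assms(11,12)] h assms(9,10) by simp
  then obtain q where q: "degree q \<le> d" "mean_square (\<lambda>x. g x - poly q (of_real x))
    \<le> 3 * ((2 ^ n * 1) ^ n * A * (2 * real n / (c / h * real d)) ^ n)\<^sup>2" by blast
  define p where "p = pcompose q [:of_real (- m / h), of_real (1 / h):]"
  have "degree p \<le> degree q * 1"
    unfolding p_def by (rule order.trans[OF degree_pcompose_le]) (auto intro!: mult_left_mono)
  then have p: "degree p \<le> d" using q(1) by simp
  have pE: "poly p (of_real (E x)) = poly q (of_real x)" for x
  proof -
    have "complex_of_real (- m / h) + complex_of_real (E x) * complex_of_real (1 / h) = of_real x"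
      unfolding of_real_mult[symmetric] of_real_add[symmetric] using h by (simp add: E_def field_simps)
    then show ?thesis unfolding p_def poly_pcompose by simp
  qed
  define G where "G = (\<lambda>s. (cmod (F s - poly p (of_real (inv_into {a..b} \<phi> s))))\<^sup>2)"
  have "continuous_on {a..b} G" unfolding G_def using F inv(2) by (intro continuous_intros)
  have "((\<lambda>x. (\<phi>' (E x) * h) *\<^sub>R G (\<phi> (E x))) has_integral integral {\<phi> (E (-1))..\<phi> (E 1)} G) {-1..1}"
  proof (rule has_integral_substitution_strong[where s = "{}" and c = a and d = b and g = "\<lambda>x. \<phi> (E x)"])
    have Eab: "E (-1) = a" "E 1 = b" by (simp_all add: E_def m_def h_def field_simps)
    show "\<phi> (E (-1)) \<le> \<phi> (E 1)" using Eab \<phi> ab by simp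
    show "(\<lambda>x. \<phi> (E x)) ` {-1..1} \<subseteq> {a..b}" using E inv(1) by (auto simp: bij_betw_def)
    show "continuous_on {-1..1} (\<lambda>x. \<phi> (E x))"
      by (rule continuous_on_compose2[OF cont_\<phi>]) (use E in \<open>auto simp: E_def intro!: continuous_intros\<close>)
    fix x :: real assume "x \<in> {-1..1} - {}"
    then have "(\<phi> has_real_derivative \<phi>' (E x)) (at (E x) within E ` {-1..1})"
      using deriv[OF E[of x]] E DERIV_subset by blast
    then show "((\<lambda>x. \<phi> (E x)) has_real_derivative \<phi>' (E x) * h) (at x within {-1..1})"
      using DERIV_image_chain[OF _ E'[of x "{-1..1}"]] by (simp add: o_def)
  qed (use \<open>continuous_on {a..b} G\<close> in auto)
  moreover have "\<phi> (E (-1)) = a" "\<phi> (E 1) = b" using \<phi> by (simp_all add: E_def m_def h_def field_simps)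
  moreover have "G (\<phi> (E x)) = (cmod (g x - poly q (of_real x)))\<^sup>2" if "x \<in> {-1..1}" for x
    using inv_into_f_f[OF bij_betw_imp_inj_on[OF inv(1)] E[OF that]] by (simp add: G_def g_def pE)
  ultimately have "((\<lambda>x. \<phi>' (E x) * h * (cmod (g x - poly q (of_real x)))\<^sup>2) has_integral integral {a..b} G) {-1..1}"
    by (auto intro: has_integral_eq[rotated])
  moreover have "((\<lambda>x. D * h * (cmod (g x - poly q (of_real x)))\<^sup>2) has_integral
      D * h * mean_square (\<lambda>x. g x - poly q (of_real x))) {-1..1}"
    using symbol_bound_continuous[OF g]
    by (intro has_integral_mult_right integrable_integral integrable_continuous_interval continuous_intros)
  ultimately have "integral {a..b} G \<le> D * h * mean_square (\<lambda>x. g x - poly q (of_real x))"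
    by (rule has_integral_le) (use D E h in \<open>auto intro!: mult_right_mono\<close>)
  also have "\<dots> \<le> D * h * (3 * ((2 ^ n * 1) ^ n * A * (2 * real n / (c / h * real d)) ^ n)\<^sup>2)"
    using D[of a] ab h by (intro mult_left_mono q(2)) auto
  also have "2 * real n / (c / h * real d) = real n * (2 * h) / (c * real d)"
    by simp
  also have "2 * h = b - a" by (simp add: h_def)
  also have "D * h * (3 * ((2 ^ n * 1) ^ n * A * (real n * (b - a) / (c * real d)) ^ n)\<^sup>2)
      \<le> 3 * D * (b - a) * ((2 ^ n) ^ n * A * (real n * (b - a) / (c * real d)) ^ n)\<^sup>2"
    using D[of a] ab by (simp add: h_def)
  finally show ?thesis using p by (auto simp: G_def)
qed

text \<open>
  For \<open>\<phi>(s) = \<tau> + (A + B s) exp(\<kappa> (c + e s))\<close> the function bounded here is \<open>\<kappa>^(-1) \<phi>' / (\<phi> - \<tau>)\<close>.  The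
  bound is uniform in all the parameters, which depend on the wave number.
\<close>

lemma logarithmic_derivative_symbol_bound:
  assumes "m > 0" "M \<ge> 0" "\<kappa>\<^sub>0 > 0"
  shows "\<exists>V\<ge>1. \<forall>\<kappa>\<ge>\<kappa>\<^sub>0. \<forall>S A B e. (\<forall>s\<in>S. m \<le> \<bar>A + B * s\<bar> \<and> \<bar>A + B * s\<bar> \<le> M) \<longrightarrow> \<bar>B\<bar> \<le> M \<longrightarrow> \<bar>e\<bar> \<le> M \<longrightarrow>
    symbol_bound n S (\<lambda>_. 1 / \<kappa>) V (\<lambda>s. B / (A + B * s) / \<kappa> + e)"
proof -
  define M' where "M' = M + M / \<kappa>\<^sub>0"
  have M': "M' \<ge> 0" using assms by (simp add: M'_def)
  obtain U where U: "U \<ge> 0" "\<And>S w f. symbol_bound n S w M' f \<Longrightarrow> (\<forall>x\<in>S. \<bar>f x\<bar> \<ge> m) \<Longrightarrow>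
      symbol_bound n S w U (\<lambda>x. inverse (f x :: real))"
    using symbol_bound_inverse[OF assms(1) M', of n] by blast
  define V where "V = M' * U + M + 1"
  have "symbol_bound n S (\<lambda>_. 1 / \<kappa>) V (\<lambda>s. B / (A + B * s) / \<kappa> + e)"
    if \<kappa>: "\<kappa> \<ge> \<kappa>\<^sub>0" and AB: "\<forall>s\<in>S. m \<le> \<bar>A + B * s\<bar> \<and> \<bar>A + B * s\<bar> \<le> M" and B: "\<bar>B\<bar> \<le> M" and e: "\<bar>e\<bar> \<le> M"
    for \<kappa> S A B e
  proof -
    have B\<kappa>: "\<bar>B / \<kappa>\<bar> \<le> M / \<kappa>\<^sub>0"
      using B \<kappa> assms by (simp add: abs_divide frac_le)
    have affine: "symbol_bound n S (\<lambda>_. 1 / \<kappa>) M' (\<lambda>s. A + B * s)"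
    proof (cases n)
      case 0
      then show ?thesis using AB assms by (auto simp: M'_def intro!: continuous_intros add_increasing2)
    next
      case (Suc n')
      have "symbol_bound n' S (\<lambda>_. 1 / \<kappa>) M' (\<lambda>s. (1 / \<kappa>) *\<^sub>R B)"
        using B\<kappa> assms by (intro symbol_bound_const) (simp add: M'_def)
      then show ?thesis unfolding Suc
      proof (rule symbol_bound_SucI)
        fix s assume "s \<in> S"
        then show "norm (A + B * s) \<le> M'" using AB assms by (auto simp: M'_def intro!: add_increasing2)
        show "((\<lambda>s. A + B * s) has_vector_derivative B) (at s within S)"
          unfolding has_real_derivative_iff_has_vector_derivative[symmetric]
          by (auto intro!: derivative_eq_intros)
      qed
    qed
    have "symbol_bound n S (\<lambda>_. 1 / \<kappa>) (\<bar>B / \<kappa>\<bar> * U + M) (\<lambda>s. (B / \<kappa>) *\<^sub>R inverse (A + B * s) + e)"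
      using U(2)[OF affine] AB e by (intro symbol_bound_add symbol_bound_scaleR symbol_bound_const) auto
    then have "symbol_bound n S (\<lambda>_. 1 / \<kappa>) (\<bar>B / \<kappa>\<bar> * U + M) (\<lambda>s. B / (A + B * s) / \<kappa> + e)"
      by (rule symbol_bound_cong) (simp add: divide_inverse)
    moreover have "\<bar>B / \<kappa>\<bar> * U \<le> M' * U"
      using B\<kappa> assms U(1) by (intro mult_right_mono) (auto simp: M'_def)
    ultimately show ?thesis by (elim symbol_bound_mono) (simp add: V_def)
  qed
  moreover have "V \<ge> 1" using U(1) M' assms(2) by (simp add: V_def)
  ultimately show ?thesis by blast
qed

lemma square_powr_half:
  assumes "\<kappa> > 0"
  shows "(\<kappa> powr (real n + 1 / 2))\<^sup>2 = \<kappa> * (\<kappa> ^ n)\<^sup>2"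
proof -
  have "(\<kappa> powr (real n + 1 / 2))\<^sup>2 = \<kappa> powr (real (Suc (2 * n)))"
    by (simp add: power2_eq_square powr_add[symmetric] algebra_simps)
  also have "\<dots> = \<kappa> ^ Suc (2 * n)" using assms by (simp only: powr_realpow)
  finally show ?thesis by (simp add: power_even_eq[symmetric] mult.commute power_mult[symmetric])
qed

text \<open>
  The functions of \<open>\<phi>^(-1)(s)\<close> that are polynomials of degree \<open>d\<close> approximate \<open>F\<close> at the rate \<open>d^(-n)\<close>.  The
  dependence on the wave number is collected in \<open>Q\<close>, so that \<open>K\<close> can be a constant.
\<close>

definition chart_approximable ::
    "nat \<Rightarrow> (real \<Rightarrow> complex) \<Rightarrow> real \<Rightarrow> real \<Rightarrow> (real \<Rightarrow> real) \<Rightarrow> real \<Rightarrow> real \<Rightarrow> bool" where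
  "chart_approximable n F a b \<phi> K Q \<longleftrightarrow> a < b \<and> continuous_on {a..b} (inv_into {a..b} \<phi>) \<and>
     (\<forall>d\<ge>1. n \<le> d + 1 \<longrightarrow> (\<exists>p. degree p \<le> d \<and>
        chart_error F a b \<phi> p \<le> K * (Q / real d ^ n)\<^sup>2))"

text \<open>
  The form of \<open>\<phi>\<close> covers the four transition regions: \<open>x0\<close> and \<open>x1\<close> are the signed distances from
  \<open>\<tau>\<close>, up to the powers \<open>k^(-y0/3)\<close> and \<open>k^(-y1/3)\<close>, at the two ends, and \<open>\<kappa>\<close> is \<open>ln k\<close>.  To the right of
  \<open>\<tau>\<close> both factors of \<open>\<phi> - \<tau>\<close> grow in absolute value, to the left both decay; in either case \<open>\<phi>\<close>
  increases.
\<close>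

lemma exponential_chart_approximation:
  fixes F :: "real \<Rightarrow> complex" and \<phi> :: "real \<Rightarrow> real"
  assumes l: "l > 0" "l \<le> b - a" "b - a \<le> M" and m: "m > 0"
    and \<phi>: "\<And>s. \<phi> s = \<tau> + (x0 + (x1 - x0) * ((s - a) / (b - a))) * exp (- (\<kappa> / 3) * (y0 + (y1 - y0) * ((s - a) / (b - a))))"
    and ends: "\<phi> a = a" "\<phi> b = b"
    and sgn: "(m \<le> x0 \<and> y0 = 1 \<and> y1 = 0) \<or> (x1 \<le> - m \<and> y0 = 0 \<and> y1 = 1)"
    and x: "x0 \<le> x1" "\<bar>x0\<bar> \<le> M" "\<bar>x1\<bar> \<le> M"
    and \<kappa>: "\<kappa>\<^sub>0 > 0" "\<kappa>\<^sub>0 \<le> \<kappa>"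
    and M1: "M1 = M + 2 * M / l + 1 / (3 * l)"
    and V: "V \<ge> 1" "\<And>\<kappa> S A B e. \<kappa> \<ge> \<kappa>\<^sub>0 \<Longrightarrow> (\<forall>s\<in>S. m \<le> \<bar>A + B * s\<bar> \<and> \<bar>A + B * s\<bar> \<le> M1) \<Longrightarrow>
      \<bar>B\<bar> \<le> M1 \<Longrightarrow> \<bar>e\<bar> \<le> M1 \<Longrightarrow> symbol_bound n S (\<lambda>_. 1 / \<kappa>) V (\<lambda>s. B / (A + B * s) / \<kappa> + e)"
    and F: "symbol_bound n {a..b} (\<lambda>s. s - \<tau>) A F" "A > 0"
  shows "chart_approximable n F a b \<phi>
    (3 * (M1 / \<kappa>\<^sub>0 + M1\<^sup>2) * M * ((2 ^ n) ^ n * (2 ^ n * V) ^ n * (real n * M) ^ n)\<^sup>2)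
    (A * \<kappa> powr (real n + 1 / 2))"
proof -
  define B where "B = (x1 - x0) / (b - a)"
  define X where "X s = x0 + (x1 - x0) * ((s - a) / (b - a))" for s
  define e where "e = (y0 - y1) / (3 * (b - a))"
  define g where "g s = exp (- (\<kappa> / 3) * (y0 + (y1 - y0) * ((s - a) / (b - a))))" for s
  have ba: "b - a > 0" "a < b" using l by auto
  have M: "M > 0" using l by simp
  have \<kappa>0: "\<kappa> > 0" using \<kappa> by simp
  have \<phi>X: "\<phi> s = \<tau> + X s * g s" for s by (simp add: \<phi> X_def g_def)
  have X_affine: "X s = (x0 - B * a) + B * s" for s
    by (simp add: X_def B_def algebra_simps diff_divide_distrib)
  have B: "0 \<le> B" "\<bar>B\<bar> \<le> 2 * M / l"
  proof -
    show "0 \<le> B" using x(1) ba by (simp add: B_def)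
    moreover have "B \<le> 2 * M / l" unfolding B_def using x l by (intro frac_le) auto
    ultimately show "\<bar>B\<bar> \<le> 2 * M / l" by simp
  qed
  have e: "\<bar>e\<bar> \<le> 1 / (3 * l)"
  proof -
    have "\<bar>e\<bar> = 1 / (3 * (b - a))" using sgn ba by (auto simp: e_def abs_divide)
    also have "\<dots> \<le> 1 / (3 * l)" using l by (intro divide_left_mono) auto
    finally show ?thesis .
  qed
  have u: "0 \<le> (s - a) / (b - a)" "(s - a) / (b - a) \<le> 1" if "s \<in> {a..b}" for s
    using that ba by (auto simp: divide_simps)
  have X: "x0 \<le> X s" "X s \<le> x1" if "s \<in> {a..b}" for s
  proof -
    have "0 \<le> (x1 - x0) * ((s - a) / (b - a))"
      by (rule mult_nonneg_nonneg[OF _ u(1)[OF that]]) (use x(1) in simp)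
    moreover have "(x1 - x0) * ((s - a) / (b - a)) \<le> (x1 - x0) * 1"
      by (rule mult_left_mono[OF u(2)[OF that]]) (use x(1) in simp)
    ultimately show "x0 \<le> X s" "X s \<le> x1" unfolding X_def mult_1_right by linarith+
  qed
  have g: "0 < g s" "g s \<le> 1" if "s \<in> {a..b}" for s
  proof -
    define w where "w = (s - a) / (b - a)"
    have "0 \<le> w" "w \<le> 1" using u[OF that] by (simp_all add: w_def)
    then have "0 \<le> y0 + (y1 - y0) * w" using sgn by auto
    then have "0 \<le> y0 + (y1 - y0) * ((s - a) / (b - a))" by (simp only: w_def)
    then have "0 \<le> \<kappa> / 3 * (y0 + (y1 - y0) * ((s - a) / (b - a)))" using \<kappa>0 by simp
    then show "0 < g s" "g s \<le> 1" unfolding g_def by auto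
  qed
  have Xm: "m \<le> \<bar>X s\<bar> \<and> \<bar>X s\<bar> \<le> M" and Xe: "X s * e > 0" if "s \<in> {a..b}" for s
  proof -
    show "m \<le> \<bar>X s\<bar> \<and> \<bar>X s\<bar> \<le> M" using X[OF that] sgn x m by auto
    show "X s * e > 0"
      using sgn
    proof
      assume "m \<le> x0 \<and> y0 = 1 \<and> y1 = 0"
      then have "X s > 0" "e > 0" using X[OF that] m ba by (auto simp: e_def)
      then show ?thesis by simp
    next
      assume "x1 \<le> - m \<and> y0 = 0 \<and> y1 = 1"
      then have "X s < 0" "e < 0" using X[OF that] m ba by (auto simp: e_def)
      then show ?thesis by (rule mult_neg_neg)
    qed
  qed
  define \<phi>' where "\<phi>' s = (B + X s * (\<kappa> * e)) * g s" for s
  have deriv: "(\<phi> has_real_derivative \<phi>' s) (at s)" for s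
  proof -
    have "(X has_real_derivative B) (at s)"
      unfolding X_affine[abs_def] by (rule DERIV_cong[OF DERIV_add[OF DERIV_const DERIV_cmult_Id]]) simp
    moreover have "(g has_real_derivative (\<kappa> * e) * g s) (at s)"
    proof -
      have "((\<lambda>s. - (\<kappa> / 3) * (y0 + (y1 - y0) * ((s - a) / (b - a)))) has_real_derivative
          - (\<kappa> / 3) * ((y1 - y0) * (1 / (b - a)))) (at s)"
        by (rule DERIV_cong[OF DERIV_cmult[OF DERIV_add[OF DERIV_const
              DERIV_cmult[OF DERIV_cdivide[OF DERIV_diff[OF DERIV_ident DERIV_const]]]]]]) simp
      also have "- (\<kappa> / 3) * ((y1 - y0) * (1 / (b - a))) = \<kappa> * e"
        using ba by (simp add: e_def field_simps)
      finally show ?thesis unfolding g_def by (rule DERIV_fun_exp[THEN DERIV_cong]) simp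
    qed
    ultimately have "((\<lambda>s. \<tau> + X s * g s) has_real_derivative \<phi>' s) (at s)"
      unfolding \<phi>'_def by (rule DERIV_cong[OF DERIV_add[OF DERIV_const DERIV_mult]]) (simp_all add: algebra_simps)
    then show ?thesis by (simp add: \<phi>X[abs_def])
  qed
  have \<phi>'_pos: "0 < \<phi>' s" if "s \<in> {a..b}" for s
  proof -
    have "0 < \<kappa> * (X s * e)" using Xe[OF that] \<kappa>0 by simp
    then have "0 < B + X s * (\<kappa> * e)" using B(1) by (simp add: mult_ac)
    then show ?thesis using g[OF that] by (simp add: \<phi>'_def)
  qed
  have M1': "M \<le> M1" "2 * M / l \<le> M1" "1 / (3 * l) \<le> M1" "M1 \<ge> 0"
    using M l by (auto simp: M1)
  have \<phi>'_le: "\<phi>' s \<le> \<kappa> * (M1 / \<kappa>\<^sub>0 + M1\<^sup>2)" if "s \<in> {a..b}" for s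
  proof -
    have "X s * e \<le> \<bar>X s\<bar> * \<bar>e\<bar>" by (simp add: abs_mult[symmetric])
    also have "\<dots> \<le> M1 * M1" using Xm[OF that] e M1' by (intro mult_mono) auto
    finally have "\<kappa> * (X s * e) \<le> \<kappa> * M1\<^sup>2"
      using \<kappa>0 by (intro mult_left_mono) (auto simp: power2_eq_square)
    moreover have "B \<le> \<kappa> * (M1 / \<kappa>\<^sub>0)"
    proof -
      have "B \<le> 1 * M1" using B M1' by simp
      also have "\<dots> \<le> (\<kappa> / \<kappa>\<^sub>0) * M1" using \<kappa> M1' by (intro mult_right_mono) auto
      finally show ?thesis by simp
    qed
    ultimately have "B + X s * (\<kappa> * e) \<le> \<kappa> * (M1 / \<kappa>\<^sub>0 + M1\<^sup>2)" by (simp add: algebra_simps)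
    moreover have "\<phi>' s \<le> B + X s * (\<kappa> * e)"
      unfolding \<phi>'_def using g[OF that] \<phi>'_pos[OF that]
      by (intro mult_right_le_one_le) (auto simp: \<phi>'_def zero_less_mult_iff)
    ultimately show ?thesis by simp
  qed
  have mono: "strict_mono_on {a..b} \<phi>"
  proof (rule strict_mono_onI)
    fix r s assume rs: "r \<in> {a..b}" "s \<in> {a..b}" "r < s"
    show "\<phi> r < \<phi> s"
      by (rule DERIV_pos_imp_increasing[OF rs(3)]) (use rs deriv \<phi>'_pos in \<open>auto intro!: exI\<close>)
  qed
  have cont: "continuous_on {a..b} \<phi>"
    using deriv by (meson DERIV_isCont continuous_at_imp_continuous_on)
  have maps: "\<phi> s \<in> {a..b}" if "s \<in> {a..b}" for s
    using increasing_self_map_interval(1)[OF ba(2) ends mono cont] that by (auto simp: bij_betw_def)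
  have "symbol_bound n {a..b} (\<lambda>_. 1 / \<kappa>) V (\<lambda>s. B / ((x0 - B * a) + B * s) / \<kappa> + e)"
    using Xm M1' B e \<kappa> unfolding X_affine by (intro V(2)) force+
  then have v: "symbol_bound n {a..b} (\<lambda>_. 1 / \<kappa>) V (\<lambda>s. B / X s / \<kappa> + e)"
    by (simp only: X_affine)
  have sb: "symbol_bound n {a..b} (\<lambda>_. 1 / \<kappa>) ((2 ^ n * V) ^ n * A) (\<lambda>s. F (\<phi> s))"
  proof (rule symbol_bound_compose[where E = \<phi> and E' = \<phi>' and T = "{a..b}" and w\<^sub>2 = "\<lambda>s. s - \<tau>", OF _ maps _ v V(1) _ F(1)])
    fix s assume s: "s \<in> {a..b}"
    show "(\<phi> has_vector_derivative \<phi>' s) (at s within {a..b})"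
      using deriv[of s] has_field_derivative_at_within by (auto simp: has_real_derivative_iff_has_vector_derivative[symmetric])
    have "X s \<noteq> 0" using Xm[OF s] m by auto
    then show "1 / \<kappa> * \<phi>' s = (B / X s / \<kappa> + e) * (\<phi> s - \<tau>)"
      using \<kappa>0 by (simp add: \<phi>X \<phi>'_def field_simps)
  qed (use F in auto)
  show ?thesis unfolding chart_approximable_def
  proof (intro conjI ba(2) increasing_self_map_interval(2)[OF ba(2) ends mono cont] allI impI)
    fix d :: nat assume d: "1 \<le> d" "n \<le> d + 1"
    have "\<exists>p. degree p \<le> d \<and> chart_error F a b \<phi> p
      \<le> 3 * (\<kappa> * (M1 / \<kappa>\<^sub>0 + M1\<^sup>2)) * (b - a) *
         ((2 ^ n) ^ n * ((2 ^ n * V) ^ n * A) * (real n * (b - a) / (1 / \<kappa> * real d)) ^ n)\<^sup>2"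
    proof (rule polynomial_approximation_change_of_variables[OF ba(2) ends mono _ _ _ sb])
      show "(\<phi> has_real_derivative \<phi>' s) (at s within {a..b})" for s
        using deriv has_field_derivative_at_within by blast
      show "0 \<le> \<phi>' s \<and> \<phi>' s \<le> \<kappa> * (M1 / \<kappa>\<^sub>0 + M1\<^sup>2)" if "s \<in> {a..b}" for s
        using \<phi>'_pos[OF that] \<phi>'_le[OF that] by simp
    qed (use symbol_bound_continuous[OF F(1)] \<kappa>0 V(1) F(2) d in auto)
    then obtain p where p: "degree p \<le> d" "chart_error F a b \<phi> p
      \<le> 3 * (\<kappa> * (M1 / \<kappa>\<^sub>0 + M1\<^sup>2)) * (b - a) *
         ((2 ^ n) ^ n * ((2 ^ n * V) ^ n * A) * (real n * (b - a) / (1 / \<kappa> * real d)) ^ n)\<^sup>2" by blast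
    note p(2)
    also have "3 * (\<kappa> * (M1 / \<kappa>\<^sub>0 + M1\<^sup>2)) * (b - a) *
         ((2 ^ n) ^ n * ((2 ^ n * V) ^ n * A) * (real n * (b - a) / (1 / \<kappa> * real d)) ^ n)\<^sup>2
       \<le> 3 * (\<kappa> * (M1 / \<kappa>\<^sub>0 + M1\<^sup>2)) * M *
         ((2 ^ n) ^ n * ((2 ^ n * V) ^ n * A) * (real n * M / (1 / \<kappa> * real d)) ^ n)\<^sup>2"
      using l(3) ba \<kappa>0 \<kappa>(1) M M1' V(1) F(2) d
      by (intro mult_mono power_mono divide_right_mono mult_nonneg_nonneg mult_left_mono) auto
    also have "\<dots> = 3 * (M1 / \<kappa>\<^sub>0 + M1\<^sup>2) * M * ((2 ^ n) ^ n * (2 ^ n * V) ^ n * (real n * M) ^ n)\<^sup>2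
        * (A * \<kappa> powr (real n + 1 / 2) / real d ^ n)\<^sup>2"
      by (simp add: power_mult_distrib power_divide square_powr_half[OF \<kappa>0] mult_ac)
    finally show "\<exists>p. degree p \<le> d \<and> chart_error F a b \<phi> p
      \<le> 3 * (M1 / \<kappa>\<^sub>0 + M1\<^sup>2) * M * ((2 ^ n) ^ n * (2 ^ n * V) ^ n * (real n * M) ^ n)\<^sup>2
        * (A * \<kappa> powr (real n + 1 / 2) / real d ^ n)\<^sup>2" using p(1) by blast
  qed
qed

text \<open>
  On an interval whose length is proportional to \<open>c\<close>, derivatives of size \<open>c^(-j)\<close> are harmless.  The
  powers of \<open>\<kappa>/\<kappa>\<^sub>0 \<ge> 1\<close> are inserted to give the bound the form it has on the transition regions.
\<close>

lemma identity_chart_approximation: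
  fixes F :: "real \<Rightarrow> complex"
  assumes "a < b" "c > 0" "b - a = L * c" "c \<le> 1" "\<And>s. \<phi> s = s"
    and F: "symbol_bound n {a..b} (\<lambda>_. c) A F" "A > 0"
    and \<kappa>: "\<kappa>\<^sub>0 > 0" "\<kappa>\<^sub>0 \<le> \<kappa>"
  shows "chart_approximable n F a b \<phi>
    (3 * L * ((2 ^ n) ^ n * (real n * L) ^ n / \<kappa>\<^sub>0 powr (real n + 1 / 2))\<^sup>2) (A * \<kappa> powr (real n + 1 / 2))"
proof -
  have "\<phi> = (\<lambda>s. s)" using assms(5) by auto
  have L: "L > 0" using assms(1-3) by (metis diff_gt_0_iff_gt zero_less_mult_pos2)
  have mono: "strict_mono_on {a..b} (\<lambda>s. s :: real)" by (auto simp: strict_mono_on_def)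
  show ?thesis unfolding chart_approximable_def
  proof (intro conjI assms(1) allI impI)
    show "continuous_on {a..b} (inv_into {a..b} \<phi>)"
      unfolding \<open>\<phi> = _\<close> using increasing_self_map_interval(2)[OF assms(1) _ _ mono] by simp
    fix d :: nat assume d: "1 \<le> d" "n \<le> d + 1"
    have "\<exists>p. degree p \<le> d \<and> chart_error F a b \<phi> p
      \<le> 3 * 1 * (b - a) * ((2 ^ n) ^ n * A * (real n * (b - a) / (c * real d)) ^ n)\<^sup>2"
      unfolding \<open>\<phi> = _\<close>
      by (rule polynomial_approximation_change_of_variables[where \<phi>' = "\<lambda>_. 1"])
        (use assms d symbol_bound_continuous[OF F(1)] in \<open>auto simp: strict_mono_on_def\<close>)
    then obtain p where p: "degree p \<le> d" "chart_error F a b \<phi> p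
      \<le> 3 * 1 * (b - a) * ((2 ^ n) ^ n * A * (real n * (b - a) / (c * real d)) ^ n)\<^sup>2" by blast
    note p(2)
    also have "real n * (b - a) / (c * real d) = real n * L / real d"
      using assms(2,3) by simp
    also have "3 * 1 * (b - a) * ((2 ^ n) ^ n * A * (real n * L / real d) ^ n)\<^sup>2
        \<le> 3 * L * ((2 ^ n) ^ n * A * (real n * L / real d) ^ n)\<^sup>2"
      using assms(3,4) L by (intro mult_right_mono) auto
    also have "\<dots> \<le> 3 * L * ((2 ^ n) ^ n * A * (real n * L / real d) ^ n * (\<kappa> powr (real n + 1 / 2) / \<kappa>\<^sub>0 powr (real n + 1 / 2)))\<^sup>2"
    proof (intro mult_left_mono power_mono)
      have "1 \<le> \<kappa> powr (real n + 1 / 2) / \<kappa>\<^sub>0 powr (real n + 1 / 2)"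
        using \<kappa> powr_mono2[of "real n + 1 / 2" \<kappa>\<^sub>0 \<kappa>] by simp
      moreover have "0 \<le> (2 ^ n) ^ n * A * (real n * L / real d) ^ n" using F(2) L by simp
      ultimately show "(2 ^ n) ^ n * A * (real n * L / real d) ^ n \<le>
          (2 ^ n) ^ n * A * (real n * L / real d) ^ n * (\<kappa> powr (real n + 1 / 2) / \<kappa>\<^sub>0 powr (real n + 1 / 2))"
        using mult_left_mono by fastforce
    qed (use L F(2) in auto)
    also have "\<dots> = 3 * L * ((2 ^ n) ^ n * (real n * L) ^ n / \<kappa>\<^sub>0 powr (real n + 1 / 2))\<^sup>2
        * (A * \<kappa> powr (real n + 1 / 2) / real d ^ n)\<^sup>2"
      by (simp add: power_mult_distrib power_divide mult_ac)
    finally show "\<exists>p. degree p \<le> d \<and> chart_error F a b \<phi> p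
      \<le> 3 * L * ((2 ^ n) ^ n * (real n * L) ^ n / \<kappa>\<^sub>0 powr (real n + 1 / 2))\<^sup>2
        * (A * \<kappa> powr (real n + 1 / 2) / real d ^ n)\<^sup>2" using p(1) by blast
  qed
qed

section \<open>The six regions\<close>

text \<open>
  The region starts next to the shadow boundary point \<open>\<tau>\<close> and extends to the right (regions 1, 4).
\<close>

definition outward_chart :: "real \<Rightarrow> real \<Rightarrow> real \<Rightarrow> real \<Rightarrow> real \<Rightarrow> real \<Rightarrow> (real \<Rightarrow> real) \<Rightarrow> bool" where
  "outward_chart k \<tau> x x' a b \<phi> \<longleftrightarrow> a = \<tau> + x * k powr (-1/3) \<and> b = \<tau> + x' \<and>
     (\<forall>s. \<phi> s = \<tau> + (x + (x' - x) * ((s - a) / (b - a))) * k powr (- (1/3) * ((b - s) / (b - a))))"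

text \<open>
  The region approaches the shadow boundary point \<open>\<tau>\<close> from the left (regions 2, 3).
\<close>

definition inward_chart :: "real \<Rightarrow> real \<Rightarrow> real \<Rightarrow> real \<Rightarrow> real \<Rightarrow> real \<Rightarrow> (real \<Rightarrow> real) \<Rightarrow> bool" where
  "inward_chart k \<tau> x x' a b \<phi> \<longleftrightarrow> a = \<tau> - x' \<and> b = \<tau> - x * k powr (-1/3) \<and>
     (\<forall>s. \<phi> s = \<tau> - (x' + (x - x') * ((s - a) / (b - a))) * k powr (- (1/3) * ((s - a) / (b - a))))"

text \<open>
  The region contains the shadow boundary point \<open>\<tau>\<close> (regions 5, 6).
\<close>

definition core_chart :: "real \<Rightarrow> real \<Rightarrow> real \<Rightarrow> real \<Rightarrow> real \<Rightarrow> real \<Rightarrow> (real \<Rightarrow> real) \<Rightarrow> bool" where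
  "core_chart k \<tau> x x' a b \<phi> \<longleftrightarrow> a = \<tau> - x * k powr (-1/3) \<and> b = \<tau> + x' * k powr (-1/3) \<and> (\<forall>s. \<phi> s = s)"

lemma transition_chart_approximation:
  assumes x: "0 < x" "x \<le> x'" and k0: "k\<^sub>0 > 1" and C: "C > 0"
    and sb: "\<And>k. k \<ge> k\<^sub>0 \<Longrightarrow> symbol_bound n T (\<lambda>s. s - \<tau>) (C * k powr \<mu>) (F k)"
  shows "\<exists>K\<ge>0. \<forall>k\<ge>k\<^sub>0. \<forall>a b \<phi>. {a..b} \<subseteq> T \<longrightarrow>
    outward_chart k \<tau> x x' a b \<phi> \<or> inward_chart k \<tau> x x' a b \<phi> \<longrightarrow>
    chart_approximable n (F k) a b \<phi> K (k powr \<mu> * ln k powr (real n + 1 / 2))"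
proof -
  \<comment> \<open>The regions do not shrink as \<open>k\<close> grows: \<open>l\<close> is a lower bound for their lengths.\<close>
  define l where "l = x' * (1 - k\<^sub>0 powr (-1/3))"
  have "k\<^sub>0 powr (-1/3) < k\<^sub>0 powr 0" using k0 by (intro powr_less_mono) auto
  then have l: "l > 0" using x k0 by (auto simp: l_def)
  define M1 where "M1 = x' + 2 * x' / l + 1 / (3 * l)"
  have "M1 \<ge> 0" using x l by (simp add: M1_def)
  obtain V where V: "V \<ge> 1" "\<And>\<kappa> S A B e. \<kappa> \<ge> ln k\<^sub>0 \<Longrightarrow> (\<forall>s\<in>S. x \<le> \<bar>A + B * s\<bar> \<and> \<bar>A + B * s\<bar> \<le> M1) \<Longrightarrow>
      \<bar>B\<bar> \<le> M1 \<Longrightarrow> \<bar>e\<bar> \<le> M1 \<Longrightarrow> symbol_bound n S (\<lambda>_. 1 / \<kappa>) V (\<lambda>s. B / (A + B * s) / \<kappa> + e)"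
    using logarithmic_derivative_symbol_bound[OF x(1) \<open>M1 \<ge> 0\<close>, of "ln k\<^sub>0" n] k0 by auto
  define K where "K = 3 * (M1 / ln k\<^sub>0 + M1\<^sup>2) * x' * ((2 ^ n) ^ n * (2 ^ n * V) ^ n * (real n * x') ^ n)\<^sup>2"
  have chart: "chart_approximable n (F k) a b \<phi> K (C * k powr \<mu> * ln k powr (real n + 1 / 2))"
    if k: "k \<ge> k\<^sub>0" and T: "{a..b} \<subseteq> T"
      and ba: "b - a = x' - x * k powr (-1/3)" and ends: "\<phi> a = a" "\<phi> b = b"
      and \<phi>: "\<And>s. \<phi> s = \<tau> + (xa + (xb - xa) * ((s - a) / (b - a))) * exp (- (ln k / 3) * (ya + (yb - ya) * ((s - a) / (b - a))))"
      and sgn: "xa = x \<and> xb = x' \<and> ya = 1 \<and> yb = 0 \<or> xa = - x' \<and> xb = - x \<and> ya = 0 \<and> yb = 1"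
    for k a b \<phi> xa xb ya yb
  proof -
    have "k powr (-1/3) \<le> k\<^sub>0 powr (-1/3)" using k k0 by (intro powr_mono2') auto
    then have "x * k powr (-1/3) \<le> x' * k\<^sub>0 powr (-1/3)" using x by (intro mult_mono) auto
    then have l': "l \<le> b - a" by (simp add: l_def ba algebra_simps)
    show ?thesis unfolding K_def
    proof (rule exponential_chart_approximation[where m = x and V = V and l = l, OF l l' _ x(1) \<phi> ends])
      show "symbol_bound n {a..b} (\<lambda>s. s - \<tau>) (C * k powr \<mu>) (F k)"
        by (rule symbol_bound_subset[OF sb[OF k] T])
      show "b - a \<le> x'" using x by (simp add: ba)
    qed (use x k k0 C V sgn M1_def in auto)
  qed
  have K: "K \<ge> 0" using x k0 V(1) \<open>M1 \<ge> 0\<close> by (simp add: K_def)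
  have "chart_approximable n (F k) a b \<phi> (K * C\<^sup>2) (k powr \<mu> * ln k powr (real n + 1 / 2))"
    if k: "k \<ge> k\<^sub>0" and T: "{a..b} \<subseteq> T"
      and ch: "outward_chart k \<tau> x x' a b \<phi> \<or> inward_chart k \<tau> x x' a b \<phi>" for k a b \<phi>
  proof -
    have "k powr (-1/3) < k powr 0" using k k0 by (intro powr_less_mono) auto
    then have "x * k powr (-1/3) < x' * 1" using x k k0 by (intro mult_le_less_imp_less) auto
    then have pos: "x * k powr (-1/3) < x'" by simp
    have "chart_approximable n (F k) a b \<phi> K (C * k powr \<mu> * ln k powr (real n + 1 / 2))"
      using ch
    proof
      assume "outward_chart k \<tau> x x' a b \<phi>"
      then have a: "a = \<tau> + x * k powr (-1/3)" and b: "b = \<tau> + x'" and \<phi>: "\<And>s. \<phi> s =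
          \<tau> + (x + (x' - x) * ((s - a) / (b - a))) * k powr (- (1/3) * ((b - s) / (b - a)))"
        by (auto simp: outward_chart_def)
      have ab: "a < b" using pos by (simp add: a b)
      show ?thesis
      proof (rule chart[OF k T, where xa = x and xb = x' and ya = 1 and yb = 0])
        fix s
        have "(b - s) / (b - a) = 1 + (0 - 1) * ((s - a) / (b - a))" using ab by (simp add: field_simps)
        then show "\<phi> s = \<tau> + (x + (x' - x) * ((s - a) / (b - a))) *
            exp (- (ln k / 3) * (1 + (0 - 1) * ((s - a) / (b - a))))"
          using k k0 unfolding \<phi> by (simp add: powr_def mult_ac)
      next
        show "\<phi> a = a" "\<phi> b = b" using ab k k0 by (simp_all add: \<phi>) (simp_all add: a b)
      qed (use a b in auto)
    next
      assume "inward_chart k \<tau> x x' a b \<phi>"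
      then have a: "a = \<tau> - x'" and b: "b = \<tau> - x * k powr (-1/3)" and \<phi>: "\<And>s. \<phi> s =
          \<tau> - (x' + (x - x') * ((s - a) / (b - a))) * k powr (- (1/3) * ((s - a) / (b - a)))"
        by (auto simp: inward_chart_def)
      have ab: "a < b" using pos by (simp add: a b)
      show ?thesis
      proof (rule chart[OF k T, where xa = "- x'" and xb = "- x" and ya = 0 and yb = 1])
        fix s
        have "- x' + (- x - - x') * ((s - a) / (b - a)) = - (x' + (x - x') * ((s - a) / (b - a)))"
          by (simp add: algebra_simps diff_divide_distrib)
        moreover have "k powr (- (1/3) * ((s - a) / (b - a))) = exp (- (ln k / 3) * (0 + (1 - 0) * ((s - a) / (b - a))))"
          using k k0 by (simp add: powr_def mult_ac)
        ultimately show "\<phi> s = \<tau> + (- x' + (- x - - x') * ((s - a) / (b - a))) *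
            exp (- (ln k / 3) * (0 + (1 - 0) * ((s - a) / (b - a))))"
          by (simp only: \<phi>)
      next
        show "\<phi> a = a" "\<phi> b = b" using ab k k0 by (simp_all add: \<phi>) (simp_all add: a b)
      qed (use a b in auto)
    qed
    then show ?thesis by (simp add: chart_approximable_def power_mult_distrib power_divide mult_ac)
  qed
  then show ?thesis using K by (intro exI[of _ "K * C\<^sup>2"]) simp
qed

lemma core_chart_approximation:
  assumes x: "0 < x" "0 < x'" and k0: "k\<^sub>0 > 1" and C: "C > 0"
    and sb: "\<And>k. k \<ge> k\<^sub>0 \<Longrightarrow> symbol_bound n {\<tau> - x..\<tau> + x'} (\<lambda>_. k powr (-1/3)) (C * k powr \<mu>) (F k)"
  shows "\<exists>K\<ge>0. \<forall>k\<ge>k\<^sub>0. \<forall>a b \<phi>. core_chart k \<tau> x x' a b \<phi> \<longrightarrow>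
    chart_approximable n (F k) a b \<phi> K (k powr \<mu> * ln k powr (real n + 1 / 2))"
proof -
  define K where "K = 3 * (x + x') * ((2 ^ n) ^ n * (real n * (x + x')) ^ n / ln k\<^sub>0 powr (real n + 1 / 2))\<^sup>2"
  have "chart_approximable n (F k) a b \<phi> (K * C\<^sup>2) (k powr \<mu> * ln k powr (real n + 1 / 2))"
    if k: "k \<ge> k\<^sub>0" and ch: "core_chart k \<tau> x x' a b \<phi>" for k a b \<phi>
  proof -
    have a: "a = \<tau> - x * k powr (-1/3)" and b: "b = \<tau> + x' * k powr (-1/3)" and \<phi>: "\<And>s. \<phi> s = s"
      using ch by (auto simp: core_chart_def)
    have "k powr (-1/3) \<le> k powr 0" using k k0 by (intro powr_mono) auto
    then have c: "0 < k powr (-1/3)" "k powr (-1/3) \<le> 1" using k k0 by auto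
    have cx: "0 < x * k powr (-1/3)" "x * k powr (-1/3) \<le> x" "0 < x' * k powr (-1/3)" "x' * k powr (-1/3) \<le> x'"
      using c x by (auto simp: mult_le_cancel_left2)
    have "chart_approximable n (F k) a b \<phi> K (C * k powr \<mu> * ln k powr (real n + 1 / 2))"
      unfolding K_def
    proof (rule identity_chart_approximation[where c = "k powr (-1/3)" and \<phi> = \<phi>])
      show "symbol_bound n {a..b} (\<lambda>_. k powr (-1/3)) (C * k powr \<mu>) (F k)"
        by (rule symbol_bound_subset[OF sb[OF k]]) (use cx a b in auto)
      show "b - a = (x + x') * k powr (-1/3)" by (simp add: a b algebra_simps)
    qed (use x k k0 C c cx a b \<phi> in auto)
    then show ?thesis by (simp add: chart_approximable_def power_mult_distrib power_divide mult_ac)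
  qed
  then show ?thesis using x by (intro exI[of _ "K * C\<^sup>2"]) (simp add: K_def)
qed

text \<open>
  The sign of \<open>Z\<close> is prescribed on \<open>[0, 2P]\<close>, whereas the regions cover a period that may begin to the
  left of \<open>0\<close> or end to the right of \<open>2P\<close>; periodicity of \<open>Z\<close> fills the gap.
\<close>

lemma phase_zero_free:
  assumes data: "expansion_data P t b Z \<Psi> a" and t: "0 < t 1" "t 1 < t 2" "t 2 < 2 * P" "t 1 + t 2 = 2 * P"
  shows "s \<in> {t 2 - 2 * P<..<t 2} \<Longrightarrow> s \<noteq> t 1 \<Longrightarrow> Z s \<noteq> 0"
    and "s \<in> {t 1<..<t 1 + 2 * P} \<Longrightarrow> s \<noteq> t 2 \<Longrightarrow> Z s \<noteq> 0"
proof -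
  have Z: "\<And>s. Z (s + 2 * P) = Z s" "\<And>s. s \<in> {t 1<..<t 2} \<Longrightarrow> Z s > 0"
    "\<And>s. s \<in> {0..<t 1} \<union> {t 2<..2 * P} \<Longrightarrow> Z s < 0"
    using data by (auto simp: expansion_data_def periodic_def)
  show "Z s \<noteq> 0" if s: "s \<in> {t 2 - 2 * P<..<t 2}" "s \<noteq> t 1"
  proof -
    consider "s < 0" | "0 \<le> s" "s < t 1" | "t 1 < s" using s by fastforce
    then show ?thesis
    proof cases
      case 1
      then show ?thesis using Z(1)[of s] Z(3)[of "s + 2 * P"] s by auto
    next
      case 2
      then show ?thesis using Z(3)[of s] by auto
    next
      case 3
      then show ?thesis using Z(2)[of s] s by auto
    qed
  qed
  show "Z s \<noteq> 0" if s: "s \<in> {t 1<..<t 1 + 2 * P}" "s \<noteq> t 2"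
  proof -
    consider "s < t 2" | "t 2 < s" "s \<le> 2 * P" | "2 * P < s" using s by fastforce
    then show ?thesis
    proof cases
      case 1
      then show ?thesis using Z(2)[of s] s by auto
    next
      case 2
      then show ?thesis using Z(3)[of s] by auto
    next
      case 3
      then show ?thesis using Z(1)[of "s - 2 * P"] Z(3)[of "s - 2 * P"] s by auto
    qed
  qed
qed

lemma region_approximation:
  fixes \<beta> :: nat
  assumes data: "expansion_data P t b Z \<Psi> a" and exp: "has_expansion P \<eta> (expansion_term b Z \<Psi>)"
    and "P > 0" and k0: "k\<^sub>0 > 1" and t: "0 < t 1" "t 1 < t 2" "t 2 < 2 * P" "t 1 + t 2 = 2 * P"
    and rc: "region_constants P t \<xi> \<xi>' \<zeta> \<zeta>'" and j: "j \<in> {1..6}"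
  defines "F \<equiv> (\<lambda>k s. \<eta> s k - (\<Sum>i\<in>indices_beta \<beta>. expansion_term b Z \<Psi> i s k))"
  shows "\<exists>K\<ge>0. \<forall>k\<ge>k\<^sub>0. chart_approximable n (F k) (regions.lo t \<xi> \<xi>' \<zeta> \<zeta>' k j) (regions.hi t \<xi> \<xi>' \<zeta> \<zeta>' k j)
    (regions.\<phi> t \<xi> \<xi>' \<zeta> \<zeta>' k j) K (k powr (- real \<beta> / 3) * ln k powr (real n + 1 / 2))"
proof -
  let ?lo = "regions.lo t \<xi> \<xi>' \<zeta> \<zeta>'" and ?hi = "regions.hi t \<xi> \<xi>' \<zeta> \<zeta>'" and ?\<phi> = "regions.\<phi> t \<xi> \<xi>' \<zeta> \<zeta>'"
  note rdefs = regions.lo_def regions.hi_def regions.\<phi>_def regions.\<psi>_def regions.\<phi>c_def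
  have pos: "\<xi> 1 > 0" "\<xi> 2 > 0" "\<zeta> 1 > 0" "\<zeta> 2 > 0"
    and le: "\<xi> 1 \<le> \<xi>' 1" "\<xi> 2 \<le> \<xi>' 2" "\<zeta> 1 \<le> \<zeta>' 1" "\<zeta> 2 \<le> \<zeta>' 2"
    and eqs: "t 1 + \<xi>' 1 = t 2 - \<xi>' 2" "t 2 + \<zeta>' 2 = 2 * P + t 1 - \<zeta>' 1"
    using rc by (auto simp: region_constants_def)
  have away: "\<exists>C>0. \<forall>k\<ge>k\<^sub>0. symbol_bound n (T - {t i}) (\<lambda>s. s - t i) (C * k powr (- real \<beta> / 3)) (F k)"
    if "i \<in> {1, 2}" "compact T" "\<And>s. s \<in> T \<Longrightarrow> s \<noteq> t i \<Longrightarrow> Z s \<noteq> 0" for i T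
    unfolding F_def using remainder_symbol_bound_away[OF data exp \<open>P > 0\<close> _ that] k0 by simp
  have near: "\<exists>C>0. \<forall>k\<ge>k\<^sub>0. symbol_bound n T (\<lambda>_. k powr (-1/3)) (C * k powr (- real \<beta> / 3)) (F k)"
    if "compact T" for T
    unfolding F_def using remainder_symbol_bound_near[OF data exp \<open>P > 0\<close> _ that] k0 by simp
  note nz = phase_zero_free[OF data t]
  have small: "0 < x * k powr (-1/3)" if "0 < x" "k \<ge> k\<^sub>0" for x k :: real using that k0 by simp
  \<comment> \<open>A chart attached to a shadow boundary point \<open>t i\<close>, living on one side of it.\<close>
  have side: ?thesis
    if i: "i \<in> {1, 2}" and x: "0 < x" "x \<le> x'" and T: "compact T" "\<And>s. s \<in> T \<Longrightarrow> s \<noteq> t i \<Longrightarrow> Z s \<noteq> 0"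
      and sub: "\<And>k. 0 < x * k powr (-1/3) \<Longrightarrow> {?lo k j..?hi k j} \<subseteq> T - {t i}"
      and chart: "\<And>k. outward_chart k (t i) x x' (?lo k j) (?hi k j) (?\<phi> k j) \<or>
        inward_chart k (t i) x x' (?lo k j) (?hi k j) (?\<phi> k j)"
    for i x x' T
  proof -
    obtain C where C: "C > 0" "\<And>k. k \<ge> k\<^sub>0 \<Longrightarrow>
        symbol_bound n (T - {t i}) (\<lambda>s. s - t i) (C * k powr (- real \<beta> / 3)) (F k)"
      using away[OF i T] by blast
    show ?thesis using transition_chart_approximation[OF x k0 C] sub[OF small[OF x(1)]] chart by meson
  qed
  have core: ?thesis
    if x: "0 < x" "0 < x'" and chart: "\<And>k. core_chart k \<tau> x x' (?lo k j) (?hi k j) (?\<phi> k j)" for \<tau> x x'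
  proof -
    obtain C where C: "C > 0" "\<And>k. k \<ge> k\<^sub>0 \<Longrightarrow>
        symbol_bound n {\<tau> - x..\<tau> + x'} (\<lambda>_. k powr (-1/3)) (C * k powr (- real \<beta> / 3)) (F k)"
      using near[OF compact_Icc] by blast
    show ?thesis using core_chart_approximation[OF x k0 C] chart by meson
  qed
  consider "j = 1" | "j = 2" | "j = 3" | "j = 4" | "j = 5" | "j = 6" using j by force
  then show ?thesis
  proof cases
    case 1
    show ?thesis
      by (rule side[of 1 "\<xi> 1" "\<xi>' 1" "{t 1..t 1 + \<xi>' 1}"])
        (use nz(1) pos le eqs t in \<open>auto simp: 1 outward_chart_def rdefs\<close>)
  next
    case 2
    show ?thesis
      by (rule side[of 2 "\<xi> 2" "\<xi>' 2" "{t 2 - \<xi>' 2..t 2}"])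
        (use nz(2) pos le eqs t in \<open>auto simp: 2 inward_chart_def rdefs\<close>)
  next
    case 3
    show ?thesis
      by (rule side[of 1 "\<zeta> 1" "\<zeta>' 1" "{t 1 - \<zeta>' 1..t 1}"])
        (use nz(1) pos le eqs t in \<open>auto simp: 3 inward_chart_def rdefs\<close>)
  next
    case 4
    show ?thesis
      by (rule side[of 2 "\<zeta> 2" "\<zeta>' 2" "{t 2..t 2 + \<zeta>' 2}"])
        (use nz(2) pos le eqs t in \<open>auto simp: 4 outward_chart_def rdefs\<close>)
  next
    case 5
    show ?thesis by (rule core[of "\<zeta> 1" "\<xi> 1" "t 1"]) (use pos in \<open>auto simp: 5 core_chart_def rdefs\<close>)
  next
    case 6
    show ?thesis by (rule core[of "\<xi> 2" "\<zeta> 2" "t 2"]) (use pos in \<open>auto simp: 6 core_chart_def rdefs\<close>)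
  qed
qed

section \<open>The Galerkin space\<close>

text \<open>
  The \<open>T\<close>-periodic function that agrees with \<open>f\<close> on \<open>[a, a + T)\<close>.
\<close>

definition periodic_extension :: "real \<Rightarrow> real \<Rightarrow> (real \<Rightarrow> 'a) \<Rightarrow> real \<Rightarrow> 'a" where
  "periodic_extension a T f s = f (s - T * of_int \<lfloor>(s - a) / T\<rfloor>)"

lemma periodic_periodic_extension:
  assumes "T > 0"
  shows "periodic T (periodic_extension a T f)"
proof -
  have "\<lfloor>(s + T - a) / T\<rfloor> = \<lfloor>(s - a) / T\<rfloor> + 1" for s
  proof -
    have "(s + T - a) / T = (s - a) / T + 1" using assms by (simp add: field_simps)
    then show ?thesis by simp
  qed
  then show ?thesis by (simp add: periodic_def periodic_extension_def algebra_simps)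
qed

lemma periodic_extension_eq:
  assumes "s \<in> {a..<a + T}"
  shows "periodic_extension a T f s = f s"
proof -
  have "T > 0" using assms by simp
  then have "0 \<le> (s - a) / T" "(s - a) / T < 1" using assms by (auto simp: field_simps)
  then have "\<lfloor>(s - a) / T\<rfloor> = 0" by linarith
  then show ?thesis by (simp add: periodic_extension_def)
qed

lemma periodic_extension_measurable [measurable]:
  assumes [measurable]: "f \<in> borel_measurable borel"
  shows "periodic_extension a T f \<in> borel_measurable borel"
  unfolding periodic_extension_def[abs_def] by measurable

lemma L2_bounded:
  assumes [measurable]: "f \<in> borel_measurable borel" and "periodic (2 * P) f" "\<And>s. cmod (f s) \<le> M"
  shows "f \<in> L2 P"
proof -
  have "(\<integral>\<^sup>+s. ennreal ((cmod (f s))\<^sup>2) * indicator {0..2 * P} s \<partial>lborel)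
      \<le> (\<integral>\<^sup>+s. ennreal (M\<^sup>2) * indicator {0..2 * P} s \<partial>lborel)"
    using assms(3) by (intro nn_integral_mono mult_right_mono ennreal_leI power_mono) auto
  also have "\<dots> < \<infinity>" by (simp add: nn_integral_cmult_indicator ennreal_mult_less_top emeasure_lborel_Icc_eq)
  finally show ?thesis using assms by (simp add: L2_iff)
qed

lemma L2_continuous:
  assumes "continuous_on UNIV f" "periodic (2 * P) f" "P > 0"
  shows "f \<in> L2 P"
  unfolding L2_def
proof (intro CollectI conjI assms(2))
  show "f \<in> borel_measurable borel" using assms(1) by (rule borel_measurable_continuous_onI)
  show "set_integrable lborel {0..2 * P} (\<lambda>s. (cmod (f s))\<^sup>2)"
    using continuous_on_subset[OF assms(1)] by (intro borel_integrable_atLeastAtMost' continuous_intros) auto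
qed

text \<open>
  The set on which two periodic functions differ is periodic, so it is null on one period if it is
  null on another.
\<close>

lemma AE_periodic_transfer:
  fixes u v :: "real \<Rightarrow> complex"
  assumes [measurable]: "u \<in> borel_measurable borel" "v \<in> borel_measurable borel"
    and per: "periodic T u" "periodic T v" and "T > 0"
    and ae: "AE s in lborel. s \<in> {a..a + T} \<longrightarrow> u s = v s"
  shows "AE s in lborel. s \<in> {0..T} \<longrightarrow> u s = v s"
proof -
  define h where "h = (\<lambda>s. if u s = v s then 0 else 1 :: ennreal)"
  have h [measurable]: "h \<in> borel_measurable borel" unfolding h_def by measurable
  have "periodic T h" using per by (simp add: h_def periodic_def)
  have "(\<integral>\<^sup>+s. h s * indicator {0..T} s \<partial>lborel) = (\<integral>\<^sup>+s. h s * indicator {a..a + T} s \<partial>lborel)"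
    using nn_integral_periodic[OF h \<open>periodic T h\<close> \<open>T > 0\<close>] by simp
  also have "\<dots> = (\<integral>\<^sup>+s. 0 \<partial>(lborel :: real measure))"
  proof (rule nn_integral_cong_AE)
    show "AE s in lborel. h s * indicator {a..a + T} s = 0"
      using ae by eventually_elim (auto simp: h_def split: split_indicator)
  qed
  finally have "(\<integral>\<^sup>+s. h s * indicator {0..T} s \<partial>lborel) = 0" by simp
  then have "AE s in lborel. h s * indicator {0..T} s = 0"
    by (subst (asm) nn_integral_0_iff_AE) auto
  then show ?thesis by eventually_elim (auto simp: h_def split: split_indicator_asm if_splits)
qed

text \<open>
  Continuity of the inverse charts makes the elements of the Galerkin space measurable and bounded.
  The function \<open>W\<close> stands for the plane wave.
\<close>

locale piecewise_charts =
  fixes P T0 :: real and W :: "real \<Rightarrow> complex" and lo hi :: "nat \<Rightarrow> real" and \<phi> :: "nat \<Rightarrow> real \<Rightarrow> real"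
  assumes P: "P > 0" and W: "continuous_on UNIV W" "periodic (2 * P) W" "\<And>s. cmod (W s) = 1"
    and inv: "\<And>j. j \<in> {1..6} \<Longrightarrow> continuous_on {lo j..hi j} (inv_into {lo j..hi j} (\<phi> j))"
begin

definition piece :: "(nat \<Rightarrow> complex poly) \<Rightarrow> nat \<Rightarrow> real \<Rightarrow> complex" where
  "piece p j s = indicator {lo j..hi j} s * poly (p j) (of_real (inv_into {lo j..hi j} (\<phi> j) s))"

definition piecewise :: "(nat \<Rightarrow> complex poly) \<Rightarrow> real \<Rightarrow> complex" where
  "piecewise p s = W s * (\<Sum>j=1..6. piece p j s)"

definition element :: "(nat \<Rightarrow> complex poly) \<Rightarrow> real \<Rightarrow> complex" where
  "element p = periodic_extension T0 (2 * P) (piecewise p)"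

definition space :: "nat \<Rightarrow> (real \<Rightarrow> complex) set" where
  "space d = {f \<in> L2 P. \<exists>p. (\<forall>j\<in>{1..6}. degree (p j) \<le> d) \<and>
     (AE s in lborel. s \<in> {T0..T0 + 2 * P} \<longrightarrow> f s = piecewise p s)}"

lemma continuous_on_chart_poly:
  "j \<in> {1..6} \<Longrightarrow> continuous_on {lo j..hi j} (\<lambda>s. poly q (of_real (inv_into {lo j..hi j} (\<phi> j) s) :: complex))"
  using inv by (intro continuous_intros)

lemma piece_measurable:
  assumes "j \<in> {1..6}"
  shows "piece p j \<in> borel_measurable borel"
proof -
  have "piece p j = (\<lambda>s. indicator {lo j..hi j} s *\<^sub>R poly (p j) (of_real (inv_into {lo j..hi j} (\<phi> j) s)))"
    by (auto simp: piece_def[abs_def] split: split_indicator)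
  then show ?thesis
    using borel_measurable_continuous_on_indicator[OF _ continuous_on_chart_poly[OF assms]] by simp
qed

lemma piece_bounded:
  assumes "j \<in> {1..6}"
  shows "\<exists>M. \<forall>s. cmod (piece p j s) \<le> M"
proof -
  have "bounded ((\<lambda>s. poly (p j) (of_real (inv_into {lo j..hi j} (\<phi> j) s) :: complex)) ` {lo j..hi j})"
    by (intro compact_imp_bounded compact_continuous_image continuous_on_chart_poly assms compact_Icc)
  then obtain M where M: "\<forall>s\<in>{lo j..hi j}. cmod (poly (p j) (of_real (inv_into {lo j..hi j} (\<phi> j) s))) \<le> M"
    by (auto simp: bounded_iff)
  have "cmod (piece p j s) \<le> \<bar>M\<bar>" for s
  proof (cases "s \<in> {lo j..hi j}")
    case True
    then have "cmod (piece p j s) \<le> M" using M by (simp add: piece_def)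
    then show ?thesis by simp
  qed (simp add: piece_def)
  then show ?thesis by blast
qed

lemma piecewise_measurable: "piecewise p \<in> borel_measurable borel"
  unfolding piecewise_def[abs_def]
  using borel_measurable_continuous_onI[OF W(1)] piece_measurable
  by (intro borel_measurable_times borel_measurable_sum) auto

lemma piecewise_bounded: "\<exists>M. \<forall>s. cmod (piecewise p s) \<le> M"
proof -
  have "\<exists>M. \<forall>j\<in>{1..6}. \<forall>s. cmod (piece p j s) \<le> M j"
    using piece_bounded by (intro bchoice) blast
  then obtain M where M: "\<And>j s. j \<in> {1..6} \<Longrightarrow> cmod (piece p j s) \<le> M j" by blast
  have "cmod (piecewise p s) \<le> (\<Sum>j=1..6. M j)" for s
    unfolding piecewise_def norm_mult W(3) mult_1
    using order.trans[OF norm_sum sum_mono[OF M]] .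
  then show ?thesis by blast
qed

lemma element_L2: "element p \<in> L2 P"
proof -
  obtain M where "\<And>s. cmod (piecewise p s) \<le> M" using piecewise_bounded by blast
  then have "cmod (element p s) \<le> M" for s by (simp add: element_def periodic_extension_def)
  moreover have "element p \<in> borel_measurable borel"
    unfolding element_def by (intro periodic_extension_measurable piecewise_measurable)
  ultimately show ?thesis
    using periodic_periodic_extension[of "2 * P"] P by (intro L2_bounded) (auto simp: element_def)
qed

lemma element_AE: "AE s in lborel. s \<in> {T0..T0 + 2 * P} \<longrightarrow> element p s = piecewise p s"
  using AE_lborel_singleton[of "T0 + 2 * P"]
  by eventually_elim (auto simp: element_def intro!: periodic_extension_eq)

lemma element_in_space: "(\<And>j. j \<in> {1..6} \<Longrightarrow> degree (p j) \<le> d) \<Longrightarrow> element p \<in> space d"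
  unfolding space_def by (intro CollectI conjI element_L2 exI[of _ p] ballI element_AE)

lemma space_subspace: "l2_subspace P (space d)"
  unfolding l2_subspace_def
proof (intro conjI ballI allI)
  show "space d \<subseteq> L2 P" by (auto simp: space_def)
  show "(\<lambda>s. 0) \<in> space d"
    using L2_zero by (auto simp: space_def piecewise_def piece_def intro!: exI[of _ "\<lambda>_. 0"])
next
  fix u v assume "u \<in> space d" "v \<in> space d"
  then obtain p q where p: "u \<in> L2 P" "\<forall>j\<in>{1..6}. degree (p j) \<le> d"
      "AE s in lborel. s \<in> {T0..T0 + 2 * P} \<longrightarrow> u s = piecewise p s"
    and q: "v \<in> L2 P" "\<forall>j\<in>{1..6}. degree (q j) \<le> d"
      "AE s in lborel. s \<in> {T0..T0 + 2 * P} \<longrightarrow> v s = piecewise q s" by (auto simp: space_def)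
  have pq: "piecewise (\<lambda>j. p j + q j) s = piecewise p s + piecewise q s" for s
    by (simp add: piecewise_def piece_def distrib_left sum.distrib)
  have "AE s in lborel. s \<in> {T0..T0 + 2 * P} \<longrightarrow> u s + v s = piecewise (\<lambda>j. p j + q j) s"
    using p(3) q(3) by eventually_elim (simp add: pq)
  then show "(\<lambda>s. u s + v s) \<in> space d"
    using L2_add[OF p(1) q(1)] p(2) q(2) unfolding space_def
    by (intro CollectI conjI exI[of _ "\<lambda>j. p j + q j"]) (auto intro: degree_add_le)
next
  fix u c assume "u \<in> space d"
  then obtain p where p: "u \<in> L2 P" "\<forall>j\<in>{1..6}. degree (p j) \<le> d"
      "AE s in lborel. s \<in> {T0..T0 + 2 * P} \<longrightarrow> u s = piecewise p s" by (auto simp: space_def)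
  have cp: "piecewise (\<lambda>j. smult c (p j)) s = c * piecewise p s" for s
  proof -
    have "piece (\<lambda>j. smult c (p j)) j s = c * piece p j s" for j by (simp add: piece_def)
    then show ?thesis by (simp add: piecewise_def sum_distrib_left[symmetric])
  qed
  have "AE s in lborel. s \<in> {T0..T0 + 2 * P} \<longrightarrow> c * u s = piecewise (\<lambda>j. smult c (p j)) s"
    using p(3) by eventually_elim (simp add: cp)
  then show "(\<lambda>s. c * u s) \<in> space d"
    using L2_scale[OF p(1)] p(2) unfolding space_def
    by (intro CollectI conjI exI[of _ "\<lambda>j. smult c (p j)"]) (auto intro: order.trans[OF degree_smult_le])
qed

definition basis_element :: "nat \<times> nat \<Rightarrow> real \<Rightarrow> complex" where
  "basis_element = (\<lambda>(j, i). element (\<lambda>j'. if j' = j then monom 1 i else 0))"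

lemma element_basis_expansion:
  assumes "\<And>j. j \<in> {1..6} \<Longrightarrow> degree (p j) \<le> d"
  shows "element p s = (\<Sum>(j, i)\<leftarrow>List.product [1..<7] [0..<Suc d]. coeff (p j) i * basis_element (j, i) s)"
proof -
  have piece_mono: "(\<Sum>j'=1..6. piece (\<lambda>j'. if j' = j then monom 1 i else 0) j' s) =
      indicator {lo j..hi j} s * of_real (inv_into {lo j..hi j} (\<phi> j) s) ^ i" if "j \<in> {1..6}" for i j s
  proof -
    have "(\<Sum>j'=1..6. piece (\<lambda>j'. if j' = j then monom 1 i else 0) j' s) =
        (\<Sum>j'\<in>{1..6}. if j' = j then indicator {lo j..hi j} s * of_real (inv_into {lo j..hi j} (\<phi> j) s) ^ i else 0)"
      by (intro sum.cong) (auto simp: piece_def poly_monom)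
    then show ?thesis using that by simp
  qed
  have expand: "piecewise p s = (\<Sum>j=1..6. \<Sum>i\<le>d. coeff (p j) i * piecewise (\<lambda>j'. if j' = j then monom 1 i else 0) s)" for s
  proof -
    have "piece p j s = (\<Sum>i\<le>d. coeff (p j) i * (indicator {lo j..hi j} s * of_real (inv_into {lo j..hi j} (\<phi> j) s) ^ i))"
      if "j \<in> {1..6}" for j
    proof -
      have "poly (p j) x = (\<Sum>i\<le>d. coeff (p j) i * x ^ i)" for x
        by (subst poly_as_sum_of_monoms'[OF assms[OF that], symmetric]) (simp add: poly_sum poly_monom)
      then show ?thesis by (simp add: piece_def sum_distrib_left mult_ac)
    qed
    then have "piecewise p s = (\<Sum>j=1..6. \<Sum>i\<le>d. W s * (coeff (p j) i *
        (indicator {lo j..hi j} s * of_real (inv_into {lo j..hi j} (\<phi> j) s) ^ i)))"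
      unfolding piecewise_def sum_distrib_left by (intro sum.cong) (auto simp: sum_distrib_left)
    also have "\<dots> = (\<Sum>j=1..6. \<Sum>i\<le>d. coeff (p j) i * piecewise (\<lambda>j'. if j' = j then monom 1 i else 0) s)"
      unfolding piecewise_def by (intro sum.cong refl) (simp only: piece_mono mult.left_commute)
    finally show ?thesis .
  qed
  have "element p s = (\<Sum>j=1..6. \<Sum>i\<le>d. coeff (p j) i * basis_element (j, i) s)"
    unfolding element_def basis_element_def periodic_extension_def expand by simp
  also have "\<dots> = (\<Sum>(j, i)\<in>{1..6} \<times> {..d}. coeff (p j) i * basis_element (j, i) s)"
    by (simp add: sum.cartesian_product)
  also have "\<dots> = (\<Sum>(j, i)\<leftarrow>List.product [1..<7] [0..<Suc d]. coeff (p j) i * basis_element (j, i) s)"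
  proof (subst sum_list_distinct_conv_sum_set)
    show "distinct (List.product [1..<7] [0..<Suc d])" by (intro distinct_product) auto
    have "set (List.product [1..<7] [0..<Suc d]) = {1..6} \<times> {..d}" by auto
    then show "(\<Sum>(j, i)\<in>{1..6} \<times> {..d}. coeff (p j) i * basis_element (j, i) s) =
        (\<Sum>(j, i)\<in>set (List.product [1..<7] [0..<Suc d]). coeff (p j) i * basis_element (j, i) s)" by simp
  qed
  finally show ?thesis .
qed

text \<open>
  Up to null sets the space is spanned by the elements whose polynomials are monomials in a single
  region; this finite list is what makes the Galerkin equation solvable.
\<close>

lemma space_spanned:
  assumes "u \<in> space d"
  shows "\<exists>u'\<in>lin_span (map basis_element (List.product [1..<7] [0..<Suc d])).
    AE s in lborel. s \<in> {0..2 * P} \<longrightarrow> u s = u' s"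
proof -
  obtain p where p: "u \<in> L2 P" "\<forall>j\<in>{1..6}. degree (p j) \<le> d"
    "AE s in lborel. s \<in> {T0..T0 + 2 * P} \<longrightarrow> u s = piecewise p s" using assms by (auto simp: space_def)
  define xs where "xs = List.product [1..<7] [0..<Suc d]"
  have "element p = (\<lambda>s. \<Sum>x\<leftarrow>xs. coeff (p (fst x)) (snd x) * basis_element x s)"
    using element_basis_expansion[of p d, folded xs_def] p(2) by (simp add: case_prod_unfold fun_eq_iff)
  then have "element p \<in> lin_span (map basis_element xs)"
    using lin_span_sum_list[of "\<lambda>x. coeff (p (fst x)) (snd x)" basis_element xs] by simp
  moreover have "AE s in lborel. s \<in> {0..2 * P} \<longrightarrow> u s = element p s"
  proof (rule AE_periodic_transfer[where a = T0])
    show "AE s in lborel. s \<in> {T0..T0 + 2 * P} \<longrightarrow> u s = element p s"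
      using p(3) element_AE[of p] by eventually_elim auto
  qed (use p(1) element_L2[of p] P in \<open>auto simp: L2_def\<close>)
  ultimately show ?thesis unfolding xs_def by blast
qed

lemma basis_in_space: "set (map basis_element (List.product [1..<7] [0..<Suc d])) \<subseteq> space d"
  by (auto simp: basis_element_def degree_monom_le intro!: element_in_space order.trans[OF degree_monom_le])

text \<open>
  Away from the finitely many endpoints exactly one of the six pieces is active, so the square norm
  is the sum of the errors on the regions.
\<close>

lemma piecewise_error:
  assumes \<rho>: "\<And>s. \<rho> s = W s * F s" and F: "continuous_on UNIV F" and \<rho>_per: "periodic (2 * P) \<rho>"
    and cover: "{T0..T0 + 2 * P} \<subseteq> (\<Union>j\<in>{1..6}. {lo j..hi j})"
    and disj: "\<And>i j. i \<in> {1..6} \<Longrightarrow> j \<in> {1..6} \<Longrightarrow> i \<noteq> j \<Longrightarrow> {lo i..hi i} \<inter> {lo j<..<hi j} = {}"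
    and err: "\<And>j. j \<in> {1..6} \<Longrightarrow> chart_error F (lo j) (hi j) (\<phi> j) (p j) \<le> e j"
  shows "(l2norm P (\<lambda>s. \<rho> s - element p s))\<^sup>2 \<le> (\<Sum>j=1..6. e j)"
proof -
  define G where "G j s = (cmod (F s - poly (p j) (of_real (inv_into {lo j..hi j} (\<phi> j) s))))\<^sup>2" for j s
  define h where "h = (\<lambda>s. \<rho> s - element p s)"
  have Wm: "W \<in> borel_measurable borel" "F \<in> borel_measurable borel"
    using W(1) F by (auto intro: borel_measurable_continuous_onI)
  have \<rho>m: "\<rho> \<in> borel_measurable borel" using Wm by (simp add: \<rho>[abs_def])
  have hm [measurable]: "h \<in> borel_measurable borel"
    unfolding h_def using \<rho>m L2_measurable[OF element_L2] by measurable
  have "periodic (2 * P) (element p)" using element_L2[of p] by (simp add: L2_def)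
  then have h_per: "periodic (2 * P) (\<lambda>s. ennreal ((cmod (h s))\<^sup>2))"
    using \<rho>_per by (simp add: h_def periodic_def)
  have G_int: "set_integrable lborel {lo j..hi j} (G j)" if "j \<in> {1..6}" for j
    unfolding G_def using inv[OF that] continuous_on_subset[OF F]
    by (intro borel_integrable_atLeastAtMost' continuous_intros) auto
  have G_le: "(\<integral>\<^sup>+s. ennreal (indicator {lo j..hi j} s * G j s) \<partial>lborel) \<le> ennreal (e j)" if "j \<in> {1..6}" for j
  proof -
    have "(\<integral>\<^sup>+s. ennreal (indicator {lo j..hi j} s * G j s) \<partial>lborel) = ennreal (LINT s:{lo j..hi j}|lborel. G j s)"
      using G_int[OF that] unfolding set_lebesgue_integral_def set_integrable_def
      by (subst nn_integral_eq_integral) (auto simp: G_def)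
    also have "(LINT s:{lo j..hi j}|lborel. G j s) = integral {lo j..hi j} (G j)"
      by (rule set_borel_integral_eq_integral(2)[OF G_int[OF that]])
    also have "\<dots> \<le> e j" using err[OF that] by (simp add: G_def[abs_def])
    finally show ?thesis by (simp add: ennreal_leI)
  qed
  have e_nonneg: "e j \<ge> 0" if "j \<in> {1..6}" for j
  proof -
    have "0 \<le> integral {lo j..hi j} (G j)"
      using set_borel_integral_eq_integral(1)[OF G_int[OF that]]
      by (rule Henstock_Kurzweil_Integration.integral_nonneg) (simp add: G_def)
    then show ?thesis using err[OF that] by (simp add: G_def[abs_def])
  qed
  have "AE s in lborel. s \<notin> lo ` {1..6} \<union> hi ` {1..6}"
    by (rule AE_not_in) (auto intro: countable_imp_null_set_lborel countable_finite)
  then have "AE s in lborel. ennreal ((cmod (h s))\<^sup>2) * indicator {T0..T0 + 2 * P} s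
      \<le> (\<Sum>j=1..6. ennreal (indicator {lo j..hi j} s * G j s))"
    using element_AE[of p]
  proof eventually_elim
    case (elim s)
    show ?case
    proof (cases "s \<in> {T0..T0 + 2 * P}")
      case True
      then obtain j where j: "j \<in> {1..6}" "s \<in> {lo j..hi j}" using cover by blast
      then have sj: "s \<in> {lo j<..<hi j}" using elim(1) by fastforce
      have "(\<Sum>i=1..6. piece p i s) = (\<Sum>i\<in>{1..6}. if i = j then piece p j s else 0)"
      proof (intro sum.cong refl)
        fix i :: nat assume "i \<in> {1..6}"
        then have "i \<noteq> j \<Longrightarrow> s \<notin> {lo i..hi i}" using disj[OF _ j(1)] sj by blast
        then show "piece p i s = (if i = j then piece p j s else 0)" by (auto simp: piece_def)
      qed
      then have "(\<Sum>i=1..6. piece p i s) = piece p j s" using j(1) by simp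
      then have "h s = W s * (F s - poly (p j) (of_real (inv_into {lo j..hi j} (\<phi> j) s)))"
        using elim(2) True j(2) by (simp add: h_def \<rho> piecewise_def piece_def right_diff_distrib)
      then have "(cmod (h s))\<^sup>2 = indicator {lo j..hi j} s * G j s"
        using j(2) by (simp add: norm_mult W(3) G_def)
      then have "ennreal ((cmod (h s))\<^sup>2) * indicator {T0..T0 + 2 * P} s = ennreal (indicator {lo j..hi j} s * G j s)"
        using True by simp
      also have "\<dots> \<le> (\<Sum>j=1..6. ennreal (indicator {lo j..hi j} s * G j s))"
        using j(1) by (intro member_le_sum) auto
      finally show ?thesis .
    qed simp
  qed
  then have "(\<integral>\<^sup>+s. ennreal ((cmod (h s))\<^sup>2) * indicator {T0..T0 + 2 * P} s \<partial>lborel)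
      \<le> (\<integral>\<^sup>+s. (\<Sum>j=1..6. ennreal (indicator {lo j..hi j} s * G j s)) \<partial>lborel)"
    by (rule nn_integral_mono_AE)
  also have "\<dots> = (\<Sum>j=1..6. \<integral>\<^sup>+s. ennreal (indicator {lo j..hi j} s * G j s) \<partial>lborel)"
  proof (rule nn_integral_sum)
    fix j :: nat assume "j \<in> {1..6}"
    from G_int[OF this] show "(\<lambda>s. ennreal (indicator {lo j..hi j} s * G j s)) \<in> borel_measurable lborel"
      unfolding set_integrable_def by (auto dest: borel_measurable_integrable)
  qed
  also have "\<dots> \<le> (\<Sum>j=1..6. ennreal (e j))" by (intro sum_mono G_le) auto
  also have "\<dots> = ennreal (\<Sum>j=1..6. e j)" using e_nonneg by (intro sum_ennreal) auto
  finally have "(\<integral>\<^sup>+s. ennreal ((cmod (h s))\<^sup>2) * indicator {0..2 * P} s \<partial>lborel) \<le> ennreal (\<Sum>j=1..6. e j)"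
    using nn_integral_periodic[of "\<lambda>s. ennreal ((cmod (h s))\<^sup>2)" "2 * P" T0] h_per P by simp
  then have "enn2real (\<integral>\<^sup>+s. ennreal ((cmod (h s))\<^sup>2) * indicator {0..2 * P} s \<partial>lborel) \<le> (\<Sum>j=1..6. e j)"
    using e_nonneg by (intro enn2real_leI sum_nonneg) auto
  then show ?thesis using l2norm_nn_integral[OF hm, of P] by (simp add: h_def)
qed

end

section \<open>The error bound\<close>

lemma eta_eq_plane_wave_mult: "eta u \<gamma> \<alpha> s k = plane_wave \<alpha> k (\<gamma> s) * eta_slow u \<gamma> \<alpha> s k"
  by (simp add: eta_slow_def plane_wave_def mult.assoc[symmetric] exp_add[symmetric])

lemma hoermander_continuous:
  assumes "a \<in> hoermander P \<mu> \<rho> \<delta>" "k > 0"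
  shows "continuous_on UNIV (\<lambda>s. a s k)" "periodic (2 * P) (\<lambda>s. a s k)"
proof -
  have "smooth2 a" using assms(1) by (simp add: hoermander_def)
  then show "continuous_on UNIV (\<lambda>s. a s k)"
    using smooth2_Ds[OF _ assms(2), of a 0] has_vector_derivative_continuous
    by (fastforce simp: continuous_on_eq_continuous_within)
  show "periodic (2 * P) (\<lambda>s. a s k)" using assms by (simp add: hoermander_def)
qed

lemma expansion_term_continuous:
  assumes "expansion_data P t b Z \<Psi> a" "i \<in> indices"
  shows "continuous_on UNIV (\<lambda>s. expansion_term b Z \<Psi> i s k)" "periodic (2 * P) (\<lambda>s. expansion_term b Z \<Psi> i s k)"
proof -
  obtain p q r l where i: "i = (p, q, r, l)" by (cases i) auto
  have "l \<le> -1" using assms(2) by (simp add: i indices_def)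
  then have sm: "smooth (b i)" "smooth Z" "smooth (\<Psi> r l)" and per: "periodic (2 * P) (b i)" "periodic (2 * P) Z"
    using assms by (auto simp: expansion_data_def)
  have "continuous_on UNIV (\<lambda>s. (vderiv ^^ p) (\<Psi> r l) (k powr (1/3) * Z s))"
    by (rule continuous_on_compose2[OF smooth_continuous_on[OF smooth_funpow_vderiv[OF sm(3)], of UNIV]])
      (auto intro!: continuous_intros smooth_continuous_on[OF sm(2)])
  then show "continuous_on UNIV (\<lambda>s. expansion_term b Z \<Psi> i s k)"
    using smooth_continuous_on[OF sm(1), of UNIV]
    by (simp add: expansion_term_def i continuous_on_mult continuous_on_const)
  show "periodic (2 * P) (\<lambda>s. expansion_term b Z \<Psi> i s k)"
    using per by (simp add: expansion_term_def i periodic_def)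
qed

text \<open>
  From left to right the regions are 3, 5, 1, 2, 6, 4.
\<close>

lemma regions_tile_period:
  assumes rc: "region_constants P t \<xi> \<xi>' \<zeta> \<zeta>'" and "k > 1"
  shows "{t 1 - \<zeta>' 1..t 1 - \<zeta>' 1 + 2 * P}
      \<subseteq> (\<Union>j\<in>{1..6}. {regions.lo t \<xi> \<xi>' \<zeta> \<zeta>' k j..regions.hi t \<xi> \<xi>' \<zeta> \<zeta>' k j})" (is ?cover)
    and "i \<in> {1..6} \<Longrightarrow> j \<in> {1..6} \<Longrightarrow> i \<noteq> j \<Longrightarrow>
      {regions.lo t \<xi> \<xi>' \<zeta> \<zeta>' k i..regions.hi t \<xi> \<xi>' \<zeta> \<zeta>' k i}
        \<inter> {regions.lo t \<xi> \<xi>' \<zeta> \<zeta>' k j<..<regions.hi t \<xi> \<xi>' \<zeta> \<zeta>' k j} = {}"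
proof -
  define \<epsilon> where "\<epsilon> = k powr (-1/3)"
  have "k powr (-1/3) < k powr 0" using \<open>k > 1\<close> by (intro powr_less_mono) auto
  then have \<epsilon>: "\<epsilon> > 0" "\<epsilon> < 1" using \<open>k > 1\<close> by (auto simp: \<epsilon>_def)
  define lo where "lo = regions.lo t \<xi> \<xi>' \<zeta> \<zeta>' k"
  define hi where "hi = regions.hi t \<xi> \<xi>' \<zeta> \<zeta>' k"
  have pos: "\<xi> 1 > 0" "\<xi> 2 > 0" "\<zeta> 1 > 0" "\<zeta> 2 > 0"
    and le: "\<xi> 1 \<le> \<xi>' 1" "\<xi> 2 \<le> \<xi>' 2" "\<zeta> 1 \<le> \<zeta>' 1" "\<zeta> 2 \<le> \<zeta>' 2"
    and eqs: "t 1 + \<xi>' 1 = t 2 - \<xi>' 2" "t 2 + \<zeta>' 2 = 2 * P + t 1 - \<zeta>' 1"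
    using rc by (auto simp: region_constants_def)
  have small: "c * \<epsilon> < c" "0 < c * \<epsilon>" if "c > 0" for c using that \<epsilon> by auto
  have vals: "lo 1 = t 1 + \<xi> 1 * \<epsilon>" "hi 1 = t 1 + \<xi>' 1" "lo 2 = t 2 - \<xi>' 2" "hi 2 = t 2 - \<xi> 2 * \<epsilon>"
    "lo 3 = t 1 - \<zeta>' 1" "hi 3 = t 1 - \<zeta> 1 * \<epsilon>" "lo 4 = t 2 + \<zeta> 2 * \<epsilon>" "hi 4 = t 2 + \<zeta>' 2"
    "lo 5 = t 1 - \<zeta> 1 * \<epsilon>" "hi 5 = t 1 + \<xi> 1 * \<epsilon>" "lo 6 = t 2 - \<xi> 2 * \<epsilon>" "hi 6 = t 2 + \<zeta> 2 * \<epsilon>"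
    by (simp_all add: lo_def hi_def regions.lo_def regions.hi_def \<epsilon>_def)
  have chain: "lo 3 < hi 3" "hi 3 = lo 5" "lo 5 < hi 5" "hi 5 = lo 1" "lo 1 < hi 1" "hi 1 = lo 2"
    "lo 2 < hi 2" "hi 2 = lo 6" "lo 6 < hi 6" "hi 6 = lo 4" "lo 4 < hi 4"
    and ends: "lo 3 = t 1 - \<zeta>' 1" "hi 4 = t 1 - \<zeta>' 1 + 2 * P"
    using small[OF pos(1)] small[OF pos(2)] small[OF pos(3)] small[OF pos(4)] le eqs
    unfolding vals by linarith+
  have six: "{1..6} = {1, 2, 3, 4, 5, 6 :: nat}" by auto
  show ?cover
  proof
    fix s assume "s \<in> {t 1 - \<zeta>' 1..t 1 - \<zeta>' 1 + 2 * P}"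
    then have "lo 3 \<le> s" "s \<le> hi 4" using ends by auto
    then consider "s \<in> {lo 3..hi 3}" | "s \<in> {lo 5..hi 5}" | "s \<in> {lo 1..hi 1}" | "s \<in> {lo 2..hi 2}"
      | "s \<in> {lo 6..hi 6}" | "s \<in> {lo 4..hi 4}" using chain by fastforce
    then show "s \<in> (\<Union>j\<in>{1..6}. {regions.lo t \<xi> \<xi>' \<zeta> \<zeta>' k j..regions.hi t \<xi> \<xi>' \<zeta> \<zeta>' k j})"
      unfolding lo_def[symmetric] hi_def[symmetric] six by cases auto
  qed
  show "{regions.lo t \<xi> \<xi>' \<zeta> \<zeta>' k i..regions.hi t \<xi> \<xi>' \<zeta> \<zeta>' k i}
        \<inter> {regions.lo t \<xi> \<xi>' \<zeta> \<zeta>' k j<..<regions.hi t \<xi> \<xi>' \<zeta> \<zeta>' k j} = {}"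
    if ij: "i \<in> {1..6}" "j \<in> {1..6}" "i \<noteq> j"
  proof -
    have "hi i \<le> lo j \<or> hi j \<le> lo i"
      using ij chain unfolding six by (elim insertE emptyE) simp_all
    then show ?thesis unfolding lo_def[symmetric] hi_def[symmetric] by auto
  qed
qed

theorem corollary18:
  fixes K :: "(real^2) set" and P :: real and \<gamma> :: "real \<Rightarrow> real^2" and \<alpha> :: "real^2"
    and u :: "real \<Rightarrow> real^2 \<Rightarrow> complex"
    and t \<xi> \<xi>' \<zeta> \<zeta>' :: "nat \<Rightarrow> real"
    and b :: "index \<Rightarrow> real \<Rightarrow> complex" and Z :: "real \<Rightarrow> real"
    and \<Psi> :: "nat \<Rightarrow> int \<Rightarrow> real \<Rightarrow> complex" and a :: "nat \<Rightarrow> int \<Rightarrow> nat \<Rightarrow> complex"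
    and k\<^sub>0 :: real and R :: "real \<Rightarrow> (real \<Rightarrow> complex) \<Rightarrow> real \<Rightarrow> complex"
    and f :: "real \<Rightarrow> real \<Rightarrow> complex" and C\<^sub>R c\<^sub>R :: "real \<Rightarrow> real"
    and \<beta> n :: nat
  assumes "P > 0" and "compact K" and "strictly_convex K" and "ccw_arclength_param K P \<gamma>"
    and "norm \<alpha> = 1" and "shadow_boundary P \<gamma> \<alpha> t"
    and "\<And>k. k > 0 \<Longrightarrow> scattering_solution K \<gamma> \<alpha> k (u k)"
    and "expansion_data P t b Z \<Psi> a"
    and "has_expansion P (eta_slow u \<gamma> \<alpha>) (expansion_term b Z \<Psi>)"
    and "k\<^sub>0 > 1"
    and "\<And>k. k \<ge> k\<^sub>0 \<Longrightarrow> linear_operator P (R k)"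
    and "\<And>k. k \<ge> k\<^sub>0 \<Longrightarrow> C\<^sub>R k > 0 \<and> continuous_operator P (R k) (C\<^sub>R k)"
    and "\<And>k. k \<ge> k\<^sub>0 \<Longrightarrow> c\<^sub>R k > 0 \<and> coercive_operator P (R k) (c\<^sub>R k)"
    and "\<And>k. k \<ge> k\<^sub>0 \<Longrightarrow> f k \<in> L2 P \<and> l2eq (R k (\<lambda>s. eta u \<gamma> \<alpha> s k)) (f k)"
    and "region_constants P t \<xi> \<xi>' \<zeta> \<zeta>'"
  shows "\<exists>C>0. \<forall>k\<ge>k\<^sub>0. \<forall>d::nat. d \<ge> 1 \<and> int d \<ge> int n - 1 \<longrightarrow>
    l2norm P (\<lambda>s. eta u \<gamma> \<alpha> s k -
        asymptotic_galerkin P (R k) (f k)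
          (galerkin_space P \<gamma> \<alpha> t \<xi> \<xi>' \<zeta> \<zeta>' k (\<lambda>j. d))
          (\<lambda>s. sigma_beta \<gamma> \<alpha> (expansion_term b Z \<Psi>) \<beta> s k) s)
      \<le> C * (C\<^sub>R k / c\<^sub>R k) * k powr (- real \<beta> / 3) * (ln k) powr (real n + 1/2) / real d ^ n"
proof -
  note data = \<open>expansion_data P t b Z \<Psi> a\<close> and expn = \<open>has_expansion P (eta_slow u \<gamma> \<alpha>) (expansion_term b Z \<Psi>)\<close>
    and P = \<open>P > 0\<close> and k0 = \<open>k\<^sub>0 > 1\<close> and rc = \<open>region_constants P t \<xi> \<xi>' \<zeta> \<zeta>'\<close>
  let ?lo = "regions.lo t \<xi> \<xi>' \<zeta> \<zeta>'" and ?hi = "regions.hi t \<xi> \<xi>' \<zeta> \<zeta>'" and ?\<phi> = "regions.\<phi> t \<xi> \<xi>' \<zeta> \<zeta>'"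
  have t: "0 < t 1" "t 1 < t 2" "t 2 < 2 * P" "t 1 + t 2 = 2 * P"
    using \<open>shadow_boundary P \<gamma> \<alpha> t\<close> by (auto simp: shadow_boundary_def)
  have \<gamma>: "continuous_on UNIV \<gamma>" "periodic (2 * P) \<gamma>"
    using \<open>ccw_arclength_param K P \<gamma>\<close> smooth_continuous_on by (auto simp: ccw_arclength_param_def)
  define F where "F = (\<lambda>k s. eta_slow u \<gamma> \<alpha> s k - (\<Sum>i\<in>indices_beta \<beta>. expansion_term b Z \<Psi> i s k))"
  define Q where "Q k = k powr (- real \<beta> / 3) * ln k powr (real n + 1 / 2)" for k :: real
  have "\<exists>K. \<forall>j\<in>{1..6}. K j \<ge> 0 \<and> (\<forall>k\<ge>k\<^sub>0. chart_approximable n (F k) (?lo k j) (?hi k j) (?\<phi> k j) (K j) (Q k))"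
  proof (rule bchoice, rule ballI)
    fix j :: nat assume "j \<in> {1..6}"
    from region_approximation[OF data expn P k0 t rc this, of n \<beta>]
    show "\<exists>K. K \<ge> 0 \<and> (\<forall>k\<ge>k\<^sub>0. chart_approximable n (F k) (?lo k j) (?hi k j) (?\<phi> k j) K (Q k))"
      unfolding F_def Q_def .
  qed
  then obtain K where K: "\<And>j. j \<in> {1..6} \<Longrightarrow> K j \<ge> 0"
      "\<And>j k. j \<in> {1..6} \<Longrightarrow> k \<ge> k\<^sub>0 \<Longrightarrow> chart_approximable n (F k) (?lo k j) (?hi k j) (?\<phi> k j) (K j) (Q k)"
    by blast
  define S where "S = (\<Sum>j=1..6. K j)"
  have S: "S \<ge> 0" unfolding S_def using K(1) by (intro sum_nonneg) auto
  have main: "l2norm P (\<lambda>s. eta u \<gamma> \<alpha> s k -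
        asymptotic_galerkin P (R k) (f k)
          (galerkin_space P \<gamma> \<alpha> t \<xi> \<xi>' \<zeta> \<zeta>' k (\<lambda>j. d))
          (\<lambda>s. sigma_beta \<gamma> \<alpha> (expansion_term b Z \<Psi>) \<beta> s k) s)
      \<le> (C\<^sub>R k / c\<^sub>R k) * (sqrt S * (Q k / real d ^ n))"
    if k: "k \<ge> k\<^sub>0" and d: "d \<ge> 1" "n \<le> d + 1" for k and d :: nat
  proof -
    define W where "W = (\<lambda>s. plane_wave \<alpha> k (\<gamma> s))"
    have W: "continuous_on UNIV W" "periodic (2 * P) W" "\<And>s. cmod (W s) = 1"
      using \<gamma> by (auto simp: W_def plane_wave_def periodic_def intro!: continuous_intros)
    interpret PC: piecewise_charts P "t 1 - \<zeta>' 1" W "?lo k" "?hi k" "?\<phi> k"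
    proof
      fix j :: nat assume "j \<in> {1..6}"
      then show "continuous_on {?lo k j..?hi k j} (inv_into {?lo k j..?hi k j} (?\<phi> k j))"
        using K(2)[OF _ k] by (simp add: chart_approximable_def)
    qed (use P W in auto)
    have V: "galerkin_space P \<gamma> \<alpha> t \<xi> \<xi>' \<zeta> \<zeta>' k (\<lambda>j. d) = PC.space d"
    proof -
      have "t 2 + \<zeta>' 2 = t 1 - \<zeta>' 1 + 2 * P" using rc by (simp add: region_constants_def)
      moreover have "plane_wave \<alpha> k (\<gamma> s) = W s" for s by (simp add: W_def)
      ultimately show ?thesis
        by (simp only: galerkin_space_def PC.space_def PC.piecewise_def PC.piece_def regions.\<I>_def)
    qed
    have slow: "continuous_on UNIV (\<lambda>s. eta_slow u \<gamma> \<alpha> s k)" "periodic (2 * P) (\<lambda>s. eta_slow u \<gamma> \<alpha> s k)"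
      using hoermander_continuous[of "eta_slow u \<gamma> \<alpha>" P 0 "2/3" "1/3" k] expn k k0 by (auto simp: has_expansion_def)
    define g where "g = (\<lambda>s. \<Sum>i\<in>indices_beta \<beta>. expansion_term b Z \<Psi> i s k)"
    have g: "continuous_on UNIV g" "periodic (2 * P) g"
    proof -
      have "indices_beta \<beta> \<subseteq> indices" by (auto simp: indices_beta_def)
      then show "continuous_on UNIV g" "periodic (2 * P) g"
        using expansion_term_continuous[OF data]
        by (auto simp: g_def periodic_def subset_iff intro!: continuous_on_sum sum.cong)
    qed
    define \<eta> where "\<eta> = (\<lambda>s. eta u \<gamma> \<alpha> s k)"
    define \<sigma> where "\<sigma> = (\<lambda>s. sigma_beta \<gamma> \<alpha> (expansion_term b Z \<Psi>) \<beta> s k)"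
    have \<eta>_eq: "\<eta> = (\<lambda>s. W s * eta_slow u \<gamma> \<alpha> s k)" by (simp add: \<eta>_def W_def eta_eq_plane_wave_mult[symmetric])
    have \<sigma>_eq: "\<sigma> = (\<lambda>s. W s * g s)" by (simp add: \<sigma>_def sigma_beta_def W_def g_def)
    have \<eta>: "\<eta> \<in> L2 P" and \<sigma>: "\<sigma> \<in> L2 P"
      unfolding \<eta>_eq \<sigma>_eq using slow g W P by (auto intro!: L2_continuous continuous_on_mult simp: periodic_def)
    have F: "F k s = eta_slow u \<gamma> \<alpha> s k - g s" for s by (simp add: F_def g_def)
    have "\<exists>p. \<forall>j\<in>{1..6}. degree (p j) \<le> d \<and> chart_error (F k) (?lo k j) (?hi k j) (?\<phi> k j) (p j) \<le> K j * (Q k / real d ^ n)\<^sup>2"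
      using K(2)[OF _ k] d by (intro bchoice) (auto simp: chart_approximable_def)
    then obtain p where p: "\<And>j. j \<in> {1..6} \<Longrightarrow> degree (p j) \<le> d"
      "\<And>j. j \<in> {1..6} \<Longrightarrow> chart_error (F k) (?lo k j) (?hi k j) (?\<phi> k j) (p j) \<le> K j * (Q k / real d ^ n)\<^sup>2"
      by blast
    have "(l2norm P (\<lambda>s. (\<eta> s - \<sigma> s) - PC.element p s))\<^sup>2 \<le> (\<Sum>j=1..6. K j * (Q k / real d ^ n)\<^sup>2)"
    proof (rule PC.piecewise_error[where F = "F k"])
      show "\<eta> s - \<sigma> s = W s * F k s" for s by (simp add: \<eta>_eq \<sigma>_eq F right_diff_distrib)
      show "continuous_on UNIV (F k)" unfolding F[abs_def] using slow(1) g(1) by (rule continuous_on_diff)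
      show "periodic (2 * P) (\<lambda>s. \<eta> s - \<sigma> s)" using \<eta> \<sigma> by (simp add: L2_def periodic_def)
    qed (use regions_tile_period[OF rc, of k] k k0 p(2) in auto)
    also have "\<dots> = (sqrt S * (Q k / real d ^ n))\<^sup>2"
      unfolding power_mult_distrib real_sqrt_pow2[OF S] by (simp add: S_def sum_distrib_right)
    finally have err: "l2norm P (\<lambda>s. (\<eta> s - \<sigma> s) - PC.element p s) \<le> sqrt S * (Q k / real d ^ n)"
      by (rule power2_le_imp_le) (use S in \<open>simp add: Q_def\<close>)
    have R: "linear_operator P (R k)" and cont: "continuous_operator P (R k) (C\<^sub>R k)" "C\<^sub>R k > 0"
      and coer: "coercive_operator P (R k) (c\<^sub>R k)" "c\<^sub>R k > 0"
      and fk: "f k \<in> L2 P" "l2eq (R k \<eta>) (f k)"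
      using assms(11-14) k by (auto simp: \<eta>_def)
    have "l2norm P (\<lambda>s. \<eta> s - asymptotic_galerkin P (R k) (f k) (PC.space d) \<sigma> s)
        \<le> C\<^sub>R k / c\<^sub>R k * l2norm P (\<lambda>s. \<eta> s - \<sigma> s - PC.element p s)"
    proof (rule galerkin_quasi_optimal[OF R cont coer PC.space_subspace \<eta> \<sigma> fk])
      show "\<exists>\<rho>. galerkin_equation P (R k) (\<lambda>s. f k s - R k \<sigma> s) (PC.space d) \<rho>"
        by (rule galerkin_solvable[OF R coer PC.space_subspace L2_diff[OF fk(1) linear_operator_L2[OF R \<sigma>]]
              PC.basis_in_space PC.space_spanned])
      show "PC.element p \<in> PC.space d" using p(1) by (rule PC.element_in_space)
    qed
    also have "\<dots> \<le> C\<^sub>R k / c\<^sub>R k * (sqrt S * (Q k / real d ^ n))"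
      using err cont(2) coer(2) by (intro mult_left_mono) auto
    finally show ?thesis unfolding V \<eta>_def \<sigma>_def .
  qed
  show ?thesis
  proof (intro exI[of _ "sqrt S + 1"] conjI allI impI)
    show "sqrt S + 1 > 0" using real_sqrt_ge_zero[OF S] by linarith
    fix k and d :: nat assume k: "k \<ge> k\<^sub>0" and "d \<ge> 1 \<and> int d \<ge> int n - 1"
    then have d: "d \<ge> 1" "n \<le> d + 1" by auto
    have "0 \<le> C\<^sub>R k / c\<^sub>R k * (Q k / real d ^ n)"
      using assms(12)[OF k] assms(13)[OF k] by (simp add: Q_def)
    then have "sqrt S * (C\<^sub>R k / c\<^sub>R k * (Q k / real d ^ n)) \<le> (sqrt S + 1) * (C\<^sub>R k / c\<^sub>R k * (Q k / real d ^ n))"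
      by (rule mult_right_mono[rotated]) simp
    then have "C\<^sub>R k / c\<^sub>R k * (sqrt S * (Q k / real d ^ n)) \<le> (sqrt S + 1) * (C\<^sub>R k / c\<^sub>R k * (Q k / real d ^ n))"
      by (simp only: mult.left_commute)
    also have "\<dots> = (sqrt S + 1) * (C\<^sub>R k / c\<^sub>R k) * k powr (- real \<beta> / 3) * (ln k) powr (real n + 1/2) / real d ^ n"
      by (simp add: Q_def)
    finally show "l2norm P (\<lambda>s. eta u \<gamma> \<alpha> s k -
        asymptotic_galerkin P (R k) (f k)
          (galerkin_space P \<gamma> \<alpha> t \<xi> \<xi>' \<zeta> \<zeta>' k (\<lambda>j. d))
          (\<lambda>s. sigma_beta \<gamma> \<alpha> (expansion_term b Z \<Psi>) \<beta> s k) s)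
      \<le> (sqrt S + 1) * (C\<^sub>R k / c\<^sub>R k) * k powr (- real \<beta> / 3) * (ln k) powr (real n + 1/2) / real d ^ n"
      using main[OF k d] by (rule order.trans[rotated])
  qed
qed

end
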